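(* Let $\Gamma$ be a non-elementary word hyperbolic group endowed with a word metric, and let $\mu$ be a non-elementary probability measure on $\Gamma$ with finite exponential moment and such that the pushforward $\varphi_\star\mu$ is centered for some homomorphism $\varphi:\Gamma\to\mathbb{R}$ which is not identically zero on the support of $\mu$. Then for every $\rho,\rho'\in[0,1]$ with $\rho\neq\rho'$ and every $\alpha\in(0,\lambda_\mu)$, we have $$\mathcal{U}^{\alpha n}(\pi^\rho_n,\pi^{\rho'}_n)\to 1\quad\text{as } n\to\infty.$$
   Context: A hyperbolic group is non-elementary if it is neither finite nor virtually cyclic. Write $d$ for the (left-invariant) word metric on $\Gamma$ and $|\gamma|=d(\mathrm{id},\gamma)$. The measure $\mu$ has finite exponential moment if $\sum_{\gamma}e^{c|\gamma|}\mu(\gamma)<\infty$ for some $c>0$. It is non-elementary if the semigroup generated by its support contains at least two loxodromic elements with disjoint pairs of fixed points in the Gromov boundary $\partial\Gamma$. A measure on $\mathbb{R}$ is centered if it has mean $0$. The escape rate $\lambda_\mu>0$ is the constant such that, for $w_n=\gamma_1\cdots\gamma_n$ with $\gamma_i$ i.i.d. of law $\mu$, $\frac1n|w_n|\to\lambda_\mu$ almost surely and in $L^1$. For $\rho\in[0,1]$, $\pi^\rho:=\rho\,\mu\otimes\mu+(1-\rho)\mu_{\mathrm{diag}}$ on $\Gamma\times\Gamma$, where $\mu_{\mathrm{diag}}((\gamma,\gamma'))=\mu(\gamma)$ if $\gamma=\gamma'$ and $0$ otherwise; $\pi^\rho_n$ is its $n$-fold convolution on the product group $\Gamma\times\Gamma$.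 Equip $\Gamma^2$ with the metric $d(g,h)=\max\{d(g_1,h_1),d(g_2,h_2)\}$. For $s\ge 0$ and probability measures $\nu^{(1)},\nu^{(2)}$ on $\Gamma^2$, set $$\mathcal{U}^s(\nu^{(1)},\nu^{(2)}):=\inf_{(Z_1,Z_1',Z_2,Z_2')}\mathbf{P}(Z_1'\neq Z_2'),$$ where the infimum is over $\Gamma^2$-valued random variables $Z_1,Z_1',Z_2,Z_2'$ on a common probability space such that $Z_i$ has law $\nu^{(i)}$ and $d(Z_i,Z_i')\le s$ almost surely, for $i=1,2$. *)

theory Defs
  imports "HOL-Algebra.Algebra" "HOL-Probability.Probability"
begin

definition generating_set :: "('a, 'b) monoid_scheme \<Rightarrow> 'a set \<Rightarrow> bool" where
  "generating_set G S \<longleftrightarrow> finite S \<and> S \<subseteq> carrier G \<and> generate G S = carrier G"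

text \<open>The set \<open>S\<close> is not assumed to be symmetric; words may use inverses of generators.\<close>

definition word_length :: "('a, 'b) monoid_scheme \<Rightarrow> 'a set \<Rightarrow> 'a \<Rightarrow> nat" where
  "word_length G S x =
     (LEAST n. \<exists>xs. length xs = n \<and> set xs \<subseteq> S \<union> m_inv G ` S \<and> foldr (\<otimes>\<^bsub>G\<^esub>) xs \<one>\<^bsub>G\<^esub> = x)"

definition word_dist :: "('a, 'b) monoid_scheme \<Rightarrow> 'a set \<Rightarrow> 'a \<Rightarrow> 'a \<Rightarrow> real" where
  "word_dist G S x y = real (word_length G S (inv\<^bsub>G\<^esub> x \<otimes>\<^bsub>G\<^esub> y))"

definition gromov_product :: "('a, 'b) monoid_scheme \<Rightarrow> 'a set \<Rightarrow> 'a \<Rightarrow> 'a \<Rightarrow> 'a \<Rightarrow> real" where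
  "gromov_product G S w x y = (word_dist G S w x + word_dist G S w y - word_dist G S x y) / 2"

text \<open>Gromov's four-point condition for the metric space formed by the group and its word metric.\<close>

definition hyperbolic_metric :: "('a, 'b) monoid_scheme \<Rightarrow> 'a set \<Rightarrow> bool" where
  "hyperbolic_metric G S \<longleftrightarrow>
     (\<exists>\<delta>\<ge>0. \<forall>w\<in>carrier G. \<forall>x\<in>carrier G. \<forall>y\<in>carrier G. \<forall>z\<in>carrier G.
        gromov_product G S w x z
          \<ge> min (gromov_product G S w x y) (gromov_product G S w y z) - \<delta>)"

definition word_hyperbolic :: "('a, 'b) monoid_scheme \<Rightarrow> bool" where
  "word_hyperbolic G \<longleftrightarrow> (\<exists>S. generating_set G S \<and> hyperbolic_metric G S)"

definition virtually_cyclic :: "('a, 'b) monoid_scheme \<Rightarrow> bool" where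
  "virtually_cyclic G \<longleftrightarrow> (\<exists>x\<in>carrier G. finite (rcosets\<^bsub>G\<^esub> (generate G {x})))"

definition nonelementary_group :: "('a, 'b) monoid_scheme \<Rightarrow> bool" where
  "nonelementary_group G \<longleftrightarrow> \<not> finite (carrier G) \<and> \<not> virtually_cyclic G"

text \<open>\<open>joint_divergence G S u v\<close> says that the Gromov product of \<open>u i\<close> and \<open>v j\<close>, based at the
  identity, tends to infinity as \<open>i\<close> and \<open>j\<close> do. For \<open>u = v\<close> this says that \<open>u\<close> converges to
  infinity; for two sequences converging to infinity it says that they have the same limit.\<close>

definition joint_divergence ::
    "('a, 'b) monoid_scheme \<Rightarrow> 'a set \<Rightarrow> (nat \<Rightarrow> 'a) \<Rightarrow> (nat \<Rightarrow> 'a) \<Rightarrow> bool" where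
  "joint_divergence G S u v \<longleftrightarrow>
     filterlim (\<lambda>(i, j). gromov_product G S \<one>\<^bsub>G\<^esub> (u i) (v j)) at_top
       (sequentially \<times>\<^sub>F sequentially)"

definition gromov_sequences :: "('a, 'b) monoid_scheme \<Rightarrow> 'a set \<Rightarrow> (nat \<Rightarrow> 'a) set" where
  "gromov_sequences G S = {u. range u \<subseteq> carrier G \<and> joint_divergence G S u u}"

definition gromov_boundary :: "('a, 'b) monoid_scheme \<Rightarrow> 'a set \<Rightarrow> (nat \<Rightarrow> 'a) set set" where
  "gromov_boundary G S =
     gromov_sequences G S //
       {(u, v). u \<in> gromov_sequences G S \<and> v \<in> gromov_sequences G S \<and> joint_divergence G S u v}"

text \<open>The image of a whole class under pointwise left translation is again a whole class, since
  left translation by \<open>g\<close> is an isometry that is undone by the translation by the inverse of \<open>g\<close>.\<close>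

definition boundary_action ::
    "('a, 'b) monoid_scheme \<Rightarrow> 'a \<Rightarrow> (nat \<Rightarrow> 'a) set \<Rightarrow> (nat \<Rightarrow> 'a) set" where
  "boundary_action G g \<xi> = (\<lambda>u n. g \<otimes>\<^bsub>G\<^esub> u n) ` \<xi>"

definition boundary_fixed_points ::
    "('a, 'b) monoid_scheme \<Rightarrow> 'a set \<Rightarrow> 'a \<Rightarrow> (nat \<Rightarrow> 'a) set set" where
  "boundary_fixed_points G S g = {\<xi> \<in> gromov_boundary G S. boundary_action G g \<xi> = \<xi>}"

definition loxodromic :: "('a, 'b) monoid_scheme \<Rightarrow> 'a set \<Rightarrow> 'a \<Rightarrow> bool" where
  "loxodromic G S g \<longleftrightarrow> g \<in> carrier G \<and>
     (\<exists>K\<ge>1. \<exists>C\<ge>0. \<forall>m n :: int.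
        \<bar>real_of_int (m - n)\<bar> / K - C \<le> word_dist G S (g [^]\<^bsub>G\<^esub> m) (g [^]\<^bsub>G\<^esub> n) \<and>
        word_dist G S (g [^]\<^bsub>G\<^esub> m) (g [^]\<^bsub>G\<^esub> n) \<le> K * \<bar>real_of_int (m - n)\<bar> + C)"

text \<open>Finitely generated groups are countable, so a probability measure on \<open>G\<close> is a probability
  mass function supported on the carrier.\<close>

inductive_set generated_semigroup :: "('a, 'b) monoid_scheme \<Rightarrow> 'a set \<Rightarrow> 'a set"
  for G :: "('a, 'b) monoid_scheme" and A :: "'a set" where
  base: "x \<in> A \<Longrightarrow> x \<in> generated_semigroup G A"
| mult: "x \<in> generated_semigroup G A \<Longrightarrow> y \<in> generated_semigroup G A
           \<Longrightarrow> x \<otimes>\<^bsub>G\<^esub> y \<in> generated_semigroup G A"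

definition nonelementary_measure :: "('a, 'b) monoid_scheme \<Rightarrow> 'a set \<Rightarrow> 'a pmf \<Rightarrow> bool" where
  "nonelementary_measure G S \<mu> \<longleftrightarrow>
     (\<exists>g\<in>generated_semigroup G (set_pmf \<mu>). \<exists>h\<in>generated_semigroup G (set_pmf \<mu>).
        loxodromic G S g \<and> loxodromic G S h \<and>
        boundary_fixed_points G S g \<inter> boundary_fixed_points G S h = {})"

definition finite_exponential_moment ::
    "('a, 'b) monoid_scheme \<Rightarrow> 'a set \<Rightarrow> 'a pmf \<Rightarrow> bool" where
  "finite_exponential_moment G S \<mu> \<longleftrightarrow>
     (\<exists>c>0. (\<lambda>x. exp (c * real (word_length G S x)) * pmf \<mu> x) summable_on carrier G)"

definition real_additive_group :: "real monoid" where
  "real_additive_group = \<lparr>carrier = UNIV, monoid.mult = (+), one = 0\<rparr>"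

definition centered :: "real pmf \<Rightarrow> bool" where
  "centered \<nu> \<longleftrightarrow> integrable (measure_pmf \<nu>) (\<lambda>x. x) \<and> measure_pmf.expectation \<nu> (\<lambda>x. x) = 0"

definition convolution :: "('a, 'b) monoid_scheme \<Rightarrow> 'a pmf \<Rightarrow> 'a pmf \<Rightarrow> 'a pmf" where
  "convolution G p q = map_pmf (\<lambda>(x, y). x \<otimes>\<^bsub>G\<^esub> y) (pair_pmf p q)"

fun convolution_power :: "('a, 'b) monoid_scheme \<Rightarrow> 'a pmf \<Rightarrow> nat \<Rightarrow> 'a pmf" where
  "convolution_power G p 0 = return_pmf \<one>\<^bsub>G\<^esub>"
| "convolution_power G p (Suc n) = convolution G (convolution_power G p n) p"

text \<open>The increments are the coordinates of the product space. Each factor is restricted to the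
  carrier: the surrounding type may be uncountable, and then functions of several increments need
  not be measurable on the unrestricted product.\<close>

definition increments_space :: "('a, 'b) monoid_scheme \<Rightarrow> 'a pmf \<Rightarrow> (nat \<Rightarrow> 'a) measure" where
  "increments_space G \<mu> = PiM UNIV (\<lambda>_. restrict_space (measure_pmf \<mu>) (carrier G))"

fun walk :: "('a, 'b) monoid_scheme \<Rightarrow> (nat \<Rightarrow> 'a) \<Rightarrow> nat \<Rightarrow> 'a" where
  "walk G \<omega> 0 = \<one>\<^bsub>G\<^esub>"
| "walk G \<omega> (Suc n) = walk G \<omega> n \<otimes>\<^bsub>G\<^esub> \<omega> n"

definition has_escape_rate ::
    "('a, 'b) monoid_scheme \<Rightarrow> 'a set \<Rightarrow> 'a pmf \<Rightarrow> real \<Rightarrow> bool" where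
  "has_escape_rate G S \<mu> l \<longleftrightarrow>
     (AE \<omega> in increments_space G \<mu>. (\<lambda>n. real (word_length G S (walk G \<omega> n)) / real n) \<longlonglongrightarrow> l) \<and>
     (\<forall>n. integrable (increments_space G \<mu>) (\<lambda>\<omega>. real (word_length G S (walk G \<omega> n)))) \<and>
     (\<lambda>n. \<integral>\<omega>. \<bar>real (word_length G S (walk G \<omega> n)) / real n - l\<bar> \<partial>increments_space G \<mu>) \<longlonglongrightarrow> 0"

definition escape_rate :: "('a, 'b) monoid_scheme \<Rightarrow> 'a set \<Rightarrow> 'a pmf \<Rightarrow> real" where
  "escape_rate G S \<mu> = (THE l. has_escape_rate G S \<mu> l)"

definition noise :: "'a pmf \<Rightarrow> real \<Rightarrow> ('a \<times> 'a) pmf" where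
  "noise \<mu> \<rho> = bind_pmf (bernoulli_pmf \<rho>)
     (\<lambda>b. if b then pair_pmf \<mu> \<mu> else map_pmf (\<lambda>x. (x, x)) \<mu>)"

lemma pmf_noise:
  assumes "\<rho> \<in> {0..1}"
  shows "pmf (noise \<mu> \<rho>) (x, y) =
           \<rho> * (pmf \<mu> x * pmf \<mu> y) + (1 - \<rho>) * (if x = y then pmf \<mu> x else 0)"
proof -
  have diag: "pmf (map_pmf (\<lambda>x. (x, x)) \<mu>) (x, y) = (if x = y then pmf \<mu> x else 0)"
  proof (cases "x = y")
    case True
    then show ?thesis
      using pmf_map_inj'[of "\<lambda>x. (x, x)" \<mu> x] by (simp add: inj_def)
  next
    case False
    then have "(x, y) \<notin> set_pmf (map_pmf (\<lambda>x. (x, x)) \<mu>)" by auto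
    with False show ?thesis by (simp add: set_pmf_iff del: set_map_pmf)
  qed
  show ?thesis
    using assms by (simp add: noise_def pmf_bind pmf_pair diag)
qed

definition pair_dist :: "('a, 'b) monoid_scheme \<Rightarrow> 'a set \<Rightarrow> 'a \<times> 'a \<Rightarrow> 'a \<times> 'a \<Rightarrow> real" where
  "pair_dist G S g h = max (word_dist G S (fst g) (fst h)) (word_dist G S (snd g) (snd h))"

text \<open>Quadruples \<open>(Z\<^sub>1, Z\<^sub>1', Z\<^sub>2, Z\<^sub>2')\<close> of random variables on a common probability
  space, with values in the countable square of \<open>G\<close>, are represented by their joint laws: the
  conditions imposed on them and the probability to be minimised only depend on the joint law.\<close>

definition approximate_couplings ::
    "('a, 'b) monoid_scheme \<Rightarrow> 'a set \<Rightarrow> real \<Rightarrow> ('a \<times> 'a) pmf \<Rightarrow> ('a \<times> 'a) pmf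
       \<Rightarrow> (('a \<times> 'a) \<times> ('a \<times> 'a) \<times> ('a \<times> 'a) \<times> ('a \<times> 'a)) pmf set" where
  "approximate_couplings G S s \<nu>\<^sub>1 \<nu>\<^sub>2 =
     {J. map_pmf (\<lambda>(z1, z1', z2, z2'). z1) J = \<nu>\<^sub>1 \<and>
         map_pmf (\<lambda>(z1, z1', z2, z2'). z2) J = \<nu>\<^sub>2 \<and>
         (\<forall>(z1, z1', z2, z2')\<in>set_pmf J.
            z1' \<in> carrier (G \<times>\<times> G) \<and> z2' \<in> carrier (G \<times>\<times> G) \<and>
            pair_dist G S z1 z1' \<le> s \<and> pair_dist G S z2 z2' \<le> s)}"

definition approximate_tv ::
    "('a, 'b) monoid_scheme \<Rightarrow> 'a set \<Rightarrow> real \<Rightarrow> ('a \<times> 'a) pmf \<Rightarrow> ('a \<times> 'a) pmf \<Rightarrow> real" where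
  "approximate_tv G S s \<nu>\<^sub>1 \<nu>\<^sub>2 =
     (INF J\<in>approximate_couplings G S s \<nu>\<^sub>1 \<nu>\<^sub>2.
        measure_pmf.prob J {(z1, z1', z2, z2'). z1' \<noteq> z2'})"

end

theory Submission
  imports Defs "HOL-Real_Asymp.Real_Asymp"
begin

text \<open>For a pair \<open>(X, Y)\<close> of walks with steps of law \<open>noise \<mu> \<rho>\<close>, the difference \<open>\<phi> X - \<phi> Y\<close> is a
  centered real walk with step variance \<open>2 \<rho> \<sigma>\<^sup>2\<close>. Its squared increments over many blocks of equal
  length, hence \<open>\<rho>\<close>, can be read off the values of \<open>\<phi>\<close> along the two paths. So it suffices that an
  endpoint which is only known up to an error \<open>\<alpha> n\<close> determines \<open>\<phi> (X t)\<close> up to \<open>\<epsilon> sqrt n\<close> for the times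
  \<open>t\<close> up to a small multiple of \<open>n\<close>.

  Since \<open>\<alpha>\<close> is below the escape rate, two paths with a common perturbed endpoint have a Gromov product
  that is linear in \<open>n\<close>. The walk stays within \<open>o(sqrt n)\<close> of the geodesic to its endpoint, and since
  \<open>\<phi>\<close> is centered, it hardly moves \<open>\<phi>\<close> during a short window after \<open>t\<close>. Each of the two paths crosses
  more than half of the heights of that window at a time at which both things hold, so they share
  such a height, where they are close to each other, and their values of \<open>\<phi>\<close> at time \<open>t\<close> agree up to
  \<open>\<epsilon> sqrt n\<close>.

  The escape rate exists by the subadditive ergodic theorem, in the form of the covering argument of
  Katznelson and Weiss.\<close>


section \<open>Finite sequences of independent variables\<close>

text \<open>The scale sqrt n shapes everything. Over a block of length proportional to n,
  \<open>\<phi>\<close> fluctuates by about sqrt n, so the tracking error must be below any given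
  multiple of sqrt n. Hence only backtracking over about sqrt n steps matters, and the mean
  backtrack over k steps, \<open>mean_len k - mean_len (2 * k) / 2\<close>, is o(k) as soon as the
  rate exists. Paths are compared at common heights and not at common times, because the time at
  which a path passes a given height is random.

  A single squared increment, even normalised, stays random in the limit and cannot separate two
  correlations. These blocks must fit into the initial stretch that a shared endpoint controls, and
  the accuracy \<epsilon> is chosen last.

  Errors at the endpoint are measured in one word metric, while hyperbolicity is given for some
  possibly different one. The walk is analysed in the hyperbolic metric; the other one is consulted
  for the position of the endpoint.\<close>

lemma replicate_pmf_Suc_pair:
  "replicate_pmf (Suc n) p = map_pmf (\<lambda>(x, xs). x # xs) (pair_pmf p (replicate_pmf n p))"
  by (simp add: map_pmf_def pair_pmf_def bind_assoc_pmf bind_return_pmf)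

lemma replicate_pmf_add:
  "replicate_pmf (m + n) p
    = map_pmf (\<lambda>(xs, ys). xs @ ys) (pair_pmf (replicate_pmf m p) (replicate_pmf n p))"
  by (simp add: replicate_pmf_distrib map_pmf_def pair_pmf_def bind_assoc_pmf bind_return_pmf)

lemma length_replicate_pmf: "xs \<in> set_pmf (replicate_pmf n p) \<Longrightarrow> length xs = n"
  and set_replicate_pmf_subset: "xs \<in> set_pmf (replicate_pmf n p) \<Longrightarrow> set xs \<subseteq> set_pmf p"
  by (auto simp: set_replicate_pmf)

lemma map_replicate_pmf: "map_pmf (map f) (replicate_pmf n p) = replicate_pmf n (map_pmf f p)"
proof (induction n)
  case (Suc n)
  have "map_pmf (map f) (replicate_pmf (Suc n) p)
      = map_pmf (\<lambda>(x, xs). x # xs) (map_pmf (\<lambda>(x, xs). (f x, map f xs)) (pair_pmf p (replicate_pmf n p)))"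
    unfolding replicate_pmf_Suc_pair by (simp add: pmf.map_comp o_def case_prod_unfold)
  also have "\<dots> = replicate_pmf (Suc n) (map_pmf f p)"
    unfolding map_pair Suc.IH replicate_pmf_Suc_pair ..
  finally show ?case .
qed simp

text \<open>Reversal serves the past of the walk: the inverse of a product multiplies the inverses
  in the opposite order.\<close>

lemma rev_replicate_pmf: "map_pmf rev (replicate_pmf n p) = replicate_pmf n p"
proof (induction n)
  case (Suc n)
  have "map_pmf rev (replicate_pmf (Suc n) p)
      = map_pmf (\<lambda>(x, xs). rev xs @ [x]) (pair_pmf p (replicate_pmf n p))"
    unfolding replicate_pmf_Suc_pair by (simp add: pmf.map_comp o_def case_prod_unfold)
  also have "\<dots> = map_pmf (\<lambda>(xs, x). xs @ [x]) (map_pmf (\<lambda>(xs, x). (rev xs, id x)) (pair_pmf (replicate_pmf n p) p))"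
    by (subst pair_commute_pmf) (simp add: pmf.map_comp o_def case_prod_unfold)
  also have "\<dots> = map_pmf (\<lambda>(xs, x). xs @ [x]) (pair_pmf (replicate_pmf n p) p)"
    unfolding map_pair Suc.IH pmf.map_id ..
  also have "\<dots> = map_pmf (\<lambda>(xs, x). xs @ x) (map_pmf (\<lambda>(xs, x). (id xs, [x])) (pair_pmf (replicate_pmf n p) p))"
    by (simp add: pmf.map_comp o_def case_prod_unfold)
  also have "\<dots> = replicate_pmf (n + 1) p"
    unfolding map_pair replicate_pmf_add replicate_pmf_1 pmf.map_id ..
  finally show ?case by simp
qed simp

lemma concat_replicate_pmf:
  "map_pmf concat (replicate_pmf k (replicate_pmf s p)) = replicate_pmf (k * s) p"
proof (induction k)
  case (Suc k)
  have "map_pmf concat (replicate_pmf (Suc k) (replicate_pmf s p))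
      = map_pmf (\<lambda>(xs, ys). xs @ ys) (map_pmf (\<lambda>(xs, xss). (id xs, concat xss))
          (pair_pmf (replicate_pmf s p) (replicate_pmf k (replicate_pmf s p))))"
    unfolding replicate_pmf_Suc_pair by (simp add: pmf.map_comp o_def case_prod_unfold)
  also have "\<dots> = replicate_pmf (s + k * s) p"
    unfolding map_pair Suc.IH pmf.map_id replicate_pmf_add ..
  finally show ?case by simp
qed simp

lemma take_drop_replicate_pmf:
  assumes "m \<le> n"
  shows "map_pmf (\<lambda>xs. (take m xs, drop m xs)) (replicate_pmf n p)
    = pair_pmf (replicate_pmf m p) (replicate_pmf (n - m) p)"
proof -
  have "map_pmf (\<lambda>xs. (take m xs, drop m xs)) (replicate_pmf (m + (n - m)) p)
      = map_pmf (\<lambda>(xs, ys). (take m (xs @ ys), drop m (xs @ ys)))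
          (pair_pmf (replicate_pmf m p) (replicate_pmf (n - m) p))"
    unfolding replicate_pmf_add by (simp add: pmf.map_comp o_def case_prod_unfold)
  also have "\<dots> = map_pmf id (pair_pmf (replicate_pmf m p) (replicate_pmf (n - m) p))"
    by (intro map_pmf_cong) (auto dest!: length_replicate_pmf)
  finally show ?thesis using assms by simp
qed

lemma take_replicate_pmf: "m \<le> n \<Longrightarrow> map_pmf (take m) (replicate_pmf n p) = replicate_pmf m p"
  using arg_cong[OF take_drop_replicate_pmf[of m n p], of "map_pmf fst"]
  by (simp add: pmf.map_comp o_def map_fst_pair_pmf)

lemma drop_replicate_pmf: "m \<le> n \<Longrightarrow> map_pmf (drop m) (replicate_pmf n p) = replicate_pmf (n - m) p"
  using arg_cong[OF take_drop_replicate_pmf[of m n p], of "map_pmf snd"]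
  by (simp add: pmf.map_comp o_def map_snd_pair_pmf)

lemma nth_replicate_pmf:
  assumes "i < n"
  shows "map_pmf (\<lambda>xs. xs ! i) (replicate_pmf n p) = p"
proof -
  have "map_pmf (\<lambda>xs. xs ! i) (replicate_pmf n p)
      = map_pmf (\<lambda>xs. hd (drop i xs)) (replicate_pmf n p)"
    using assms by (intro map_pmf_cong) (auto dest!: length_replicate_pmf simp: hd_drop_conv_nth)
  also have "\<dots> = map_pmf hd (replicate_pmf (Suc (n - i - 1)) p)"
    using assms drop_replicate_pmf[of i n p, symmetric] by (simp add: pmf.map_comp o_def Suc_diff_Suc)
  also have "\<dots> = p"
    unfolding replicate_pmf_Suc_pair
    by (simp add: pmf.map_comp o_def case_prod_unfold map_fst_pair_pmf)
  finally show ?thesis .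
qed

section \<open>Integrals over independent variables and moments of their sums\<close>

lemma integrable_measure_pmf_iff:
  fixes f :: "'a \<Rightarrow> real"
  shows "integrable (measure_pmf p) f
    \<longleftrightarrow> Infinite_Set_Sum.abs_summable_on (\<lambda>x. pmf p x * f x) UNIV"
  unfolding Infinite_Set_Sum.abs_summable_on_def measure_pmf_eq_density
  by (subst integrable_density) (auto simp: mult.commute)

text \<open>\<open>measure_pmf (pair_pmf p q)\<close> lives on the full power set, which over
  uncountable types may exceed the product sigma-algebra. So the product rule comes from absolutely
  convergent sums over the countable supports rather than from Fubini.\<close>

lemma
  fixes f :: "'a \<Rightarrow> real" and g :: "'b \<Rightarrow> real"
  assumes "integrable (measure_pmf p) f" "integrable (measure_pmf q) g"
  shows integrable_pair_pmf_mult: "integrable (measure_pmf (pair_pmf p q)) (\<lambda>(x, y). f x * g y)"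
    and expectation_pair_pmf_mult: "measure_pmf.expectation (pair_pmf p q) (\<lambda>(x, y). f x * g y)
      = measure_pmf.expectation p f * measure_pmf.expectation q g"
proof -
  define F where "F = (\<lambda>x. pmf p x * f x)"
  define H where "H = (\<lambda>y. pmf q y * g y)"
  have eq: "(\<lambda>xy. pmf (pair_pmf p q) xy * (case xy of (x, y) \<Rightarrow> f x * g y)) = (\<lambda>(x, y). F x * H y)"
    by (auto simp: pmf_pair F_def H_def)
  have "Infinite_Set_Sum.abs_summable_on F UNIV" "Infinite_Set_Sum.abs_summable_on H UNIV"
    using assms by (auto simp: integrable_measure_pmf_iff F_def H_def)
  then have FH: "Infinite_Set_Sum.abs_summable_on F (set_pmf p)" "Infinite_Set_Sum.abs_summable_on H (set_pmf q)"
    using abs_summable_on_subset by blast+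
  note c = countable_set_pmf[of p] countable_set_pmf[of q]
  have zero: "(case x of (x, y) \<Rightarrow> F x * H y) = 0" if "x \<in> UNIV - set_pmf p \<times> set_pmf q" for x
    using that by (cases x) (auto simp: F_def H_def set_pmf_iff)
  show "integrable (measure_pmf (pair_pmf p q)) (\<lambda>(x, y). f x * g y)"
    unfolding integrable_measure_pmf_iff eq
    using abs_summable_on_product[OF c FH] zero
    by (subst abs_summable_on_cong_neutral[where B = "set_pmf p \<times> set_pmf q"
          and g = "\<lambda>(x, y). F x * H y"]) auto
  have "infsetsum (\<lambda>(x, y). F x * H y) UNIV = infsetsum (\<lambda>(x, y). F x * H y) (set_pmf p \<times> set_pmf q)"
    using zero by (intro infsetsum_cong_neutral) auto
  also have "\<dots> = infsetsum F (set_pmf p) * infsetsum H (set_pmf q)"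
    by (rule infsetsum_product[OF c FH])
  also have "infsetsum F (set_pmf p) = infsetsum F UNIV"
    by (intro infsetsum_cong_neutral) (auto simp: F_def set_pmf_iff)
  also have "infsetsum H (set_pmf q) = infsetsum H UNIV"
    by (intro infsetsum_cong_neutral) (auto simp: H_def set_pmf_iff)
  finally show "measure_pmf.expectation (pair_pmf p q) (\<lambda>(x, y). f x * g y)
      = measure_pmf.expectation p f * measure_pmf.expectation q g"
    unfolding pmf_expectation_eq_infsetsum eq by (simp add: F_def H_def)
qed

lemma integrable_lower_power:
  fixes f :: "'a \<Rightarrow> real"
  assumes "integrable (measure_pmf p) (\<lambda>x. f x ^ 4)" "j \<le> 4"
  shows "integrable (measure_pmf p) (\<lambda>x. f x ^ j)"
proof (rule Bochner_Integration.integrable_bound)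
  show "integrable (measure_pmf p) (\<lambda>x. 1 + f x ^ 4)" using assms by simp
  show "AE x in measure_pmf p. norm (f x ^ j) \<le> norm (1 + f x ^ 4)"
  proof (rule AE_I2)
    fix x
    have "\<bar>f x\<bar> ^ j \<le> 1 + \<bar>f x\<bar> ^ 4"
    proof (cases "\<bar>f x\<bar> \<le> 1")
      case True
      then have "\<bar>f x\<bar> ^ j \<le> 1" by (intro power_le_one) auto
      moreover have "\<bar>f x\<bar> ^ 4 \<ge> 0" by (intro zero_le_power) simp
      ultimately show ?thesis by linarith
    next
      case False
      then have "\<bar>f x\<bar> ^ j \<le> \<bar>f x\<bar> ^ 4" using assms by (intro power_increasing) auto
      then show ?thesis by simp
    qed
    then show "norm (f x ^ j) \<le> norm (1 + f x ^ 4)" by (simp add: power_abs)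
  qed
qed simp

lemma pmf_Markov:
  fixes f :: "'a \<Rightarrow> real"
  assumes "integrable (measure_pmf p) f" "\<And>x. x \<in> set_pmf p \<Longrightarrow> f x \<ge> 0" "c > 0"
  shows "measure_pmf.prob p {x. f x \<ge> c} \<le> measure_pmf.expectation p f / c"
proof -
  have "measure_pmf.prob p {x \<in> space (measure_pmf p). f x \<ge> c} \<le> measure_pmf.expectation p f / c"
    using assms by (intro integral_Markov_inequality_measure[where A = UNIV])
      (auto simp: AE_measure_pmf_iff)
  then show ?thesis by simp
qed

lemma expectation_mult_split:
  fixes f :: "'a \<Rightarrow> real" and g :: "'b \<Rightarrow> real"
  assumes "integrable (measure_pmf p) f" "integrable (measure_pmf q) g"
  shows "integrable (measure_pmf (pair_pmf p q)) (\<lambda>x. f (fst x) * g (snd x))"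
    and "measure_pmf.expectation (pair_pmf p q) (\<lambda>x. f (fst x) * g (snd x))
      = measure_pmf.expectation p f * measure_pmf.expectation q g"
  using integrable_pair_pmf_mult[OF assms] expectation_pair_pmf_mult[OF assms]
  by (simp_all add: case_prod_unfold)

lemma integrable_sum_list_power:
  fixes f :: "'a \<Rightarrow> real"
  assumes f4: "integrable (measure_pmf p) (\<lambda>x. f x ^ 4)" and "j \<le> 4"
  shows "integrable (measure_pmf (replicate_pmf n p)) (\<lambda>xs. sum_list (map f xs) ^ j)"
  using \<open>j \<le> 4\<close>
proof (induction n arbitrary: j)
  case 0
  then show ?case by (auto intro!: integrable_measure_pmf_finite)
next
  case (Suc n)
  have "integrable (measure_pmf (pair_pmf p (replicate_pmf n p)))
      (\<lambda>x. (f (fst x) + sum_list (map f (snd x))) ^ j)"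
    unfolding binomial_ring using Suc.prems
    by (intro Bochner_Integration.integrable_sum integrable_mult_right)
       (auto simp: mult.assoc intro!: expectation_mult_split integrable_lower_power[OF f4] Suc.IH)
  then show ?case unfolding replicate_pmf_Suc_pair by (simp add: case_prod_unfold)
qed

text \<open>Adding an independent centred step kills every cross term that contains a first power,
  so E (f + S)^4 = m4 + 6 m2 E S^2 + E S^4. The growth of order n^2 later yields summable deviation
  probabilities for the length and a variance bound for squared block sums.\<close>

lemma sum_list_moments:
  fixes f :: "'a \<Rightarrow> real"
  defines "S \<equiv> \<lambda>xs. sum_list (map f xs)"
  assumes f4: "integrable (measure_pmf p) (\<lambda>x. f x ^ 4)"
    and f0: "measure_pmf.expectation p f = 0"
  shows "measure_pmf.expectation (replicate_pmf n p) S = 0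
    \<and> measure_pmf.expectation (replicate_pmf n p) (\<lambda>xs. S xs ^ 2)
        = real n * measure_pmf.expectation p (\<lambda>x. f x ^ 2)
    \<and> measure_pmf.expectation (replicate_pmf n p) (\<lambda>xs. S xs ^ 4)
        \<le> 4 * real n ^ 2 * measure_pmf.expectation p (\<lambda>x. f x ^ 4)"
proof -
  define m2 where "m2 = measure_pmf.expectation p (\<lambda>x. f x ^ 2)"
  define m4 where "m4 = measure_pmf.expectation p (\<lambda>x. f x ^ 4)"
  have fj: "integrable (measure_pmf p) (\<lambda>x. f x ^ j)" if "j \<le> 4" for j
    using integrable_lower_power[OF f4 that] .
  have f1: "integrable (measure_pmf p) f" using fj[of 1] by simp
  have m2sq: "m2 ^ 2 \<le> m4"
  proof -
    have "0 \<le> measure_pmf.expectation p (\<lambda>x. (f x ^ 2 - m2) ^ 2)" by simp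
    also have "(\<lambda>x. (f x ^ 2 - m2) ^ 2) = (\<lambda>x. f x ^ 4 - 2 * m2 * f x ^ 2 + m2 ^ 2)"
      by (auto simp: fun_eq_iff power2_eq_square power4_eq_xxxx algebra_simps)
    also have "measure_pmf.expectation p \<dots> = m4 - m2 ^ 2"
      using fj[of 4] fj[of 2] by (simp add: m2_def m4_def power2_eq_square)
    finally show ?thesis by simp
  qed
  have m2_0: "m2 \<ge> 0" and m4_0: "m4 \<ge> 0" by (auto simp: m2_def m4_def)
  have "measure_pmf.expectation (replicate_pmf n p) S = 0
    \<and> measure_pmf.expectation (replicate_pmf n p) (\<lambda>xs. S xs ^ 2) = real n * m2
    \<and> measure_pmf.expectation (replicate_pmf n p) (\<lambda>xs. S xs ^ 4) \<le> real n * m4 + 3 * real n ^ 2 * m2 ^ 2"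
  proof (induction n)
    case 0
    then show ?case by (simp add: S_def)
  next
    case (Suc n)
    let ?r = "replicate_pmf n p"
    let ?pp = "pair_pmf p ?r"
    have Sj: "integrable (measure_pmf ?r) (\<lambda>xs. S xs ^ j)" if "j \<le> 4" for j
      unfolding S_def using f4 that by (rule integrable_sum_list_power)
    have S1: "integrable (measure_pmf ?r) S" using Sj[of 1] by simp
    have S_Cons: "S (x # xs) = f x + S xs" for x xs by (simp add: S_def)
    have rew: "measure_pmf.expectation (replicate_pmf (Suc n) p) (\<lambda>xs. h (S xs))
          = measure_pmf.expectation ?pp (\<lambda>x. h (f (fst x) + S (snd x)))" for h :: "real \<Rightarrow> real"
      unfolding replicate_pmf_Suc_pair by (simp add: case_prod_unfold S_Cons)
    have ij: "integrable (measure_pmf ?pp) (\<lambda>x. f (fst x) ^ i * S (snd x) ^ j)" 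
      "measure_pmf.expectation ?pp (\<lambda>x. f (fst x) ^ i * S (snd x) ^ j)
        = measure_pmf.expectation p (\<lambda>x. f x ^ i) * measure_pmf.expectation ?r (\<lambda>x. S x ^ j)"
      if "i \<le> 4" "j \<le> 4" for i j
      using expectation_mult_split[OF fj[OF that(1)] Sj[OF that(2)]] by auto
    have ES: "measure_pmf.expectation ?r S = 0"
      "measure_pmf.expectation ?r (\<lambda>x. S x ^ 2) = real n * m2"
      "measure_pmf.expectation ?r (\<lambda>x. S x ^ 4) \<le> real n * m4 + 3 * real n ^ 2 * m2 ^ 2"
      using Suc by auto
    have E1: "measure_pmf.expectation ?pp (\<lambda>x. f (fst x) + S (snd x)) = 0"
    proof -
      have "integrable (measure_pmf ?pp) (\<lambda>x. f (fst x))" "integrable (measure_pmf ?pp) (\<lambda>x. S (snd x))"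
        using ij(1)[of 1 0] ij(1)[of 0 1] by simp_all
      then show ?thesis using f0 ES by simp
    qed
    have E2: "measure_pmf.expectation ?pp (\<lambda>x. (f (fst x) + S (snd x)) ^ 2) = real (Suc n) * m2"
    proof -
      have "(\<lambda>x. (f (fst x) + S (snd x)) ^ 2)
          = (\<lambda>x. f (fst x) ^ 2 * S (snd x) ^ 0 + 2 * (f (fst x) ^ 1 * S (snd x) ^ 1) + f (fst x) ^ 0 * S (snd x) ^ 2)"
        by (auto simp: fun_eq_iff power2_eq_square algebra_simps)
      then have "measure_pmf.expectation ?pp (\<lambda>x. (f (fst x) + S (snd x)) ^ 2)
         = measure_pmf.expectation ?pp (\<lambda>x. f (fst x) ^ 2 * S (snd x) ^ 0)
         + 2 * measure_pmf.expectation ?pp (\<lambda>x. f (fst x) ^ 1 * S (snd x) ^ 1)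
         + measure_pmf.expectation ?pp (\<lambda>x. f (fst x) ^ 0 * S (snd x) ^ 2)"
        using ij(1)[of 2 0] ij(1)[of 1 1] ij(1)[of 0 2] by simp
      also have "\<dots> = m2 + real n * m2"
        using ij(2)[of 2 0] ij(2)[of 1 1] ij(2)[of 0 2] f0 ES by (simp add: m2_def)
      finally show ?thesis by (simp add: algebra_simps)
    qed
    have E4: "measure_pmf.expectation ?pp (\<lambda>x. (f (fst x) + S (snd x)) ^ 4)
        \<le> real (Suc n) * m4 + 3 * real (Suc n) ^ 2 * m2 ^ 2"
    proof -
      have "(\<lambda>x. (f (fst x) + S (snd x)) ^ 4)
          = (\<lambda>x. f (fst x) ^ 4 * S (snd x) ^ 0 + 4 * (f (fst x) ^ 3 * S (snd x) ^ 1)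
              + 6 * (f (fst x) ^ 2 * S (snd x) ^ 2)
              + 4 * (f (fst x) ^ 1 * S (snd x) ^ 3) + f (fst x) ^ 0 * S (snd x) ^ 4)"
        by (auto simp: fun_eq_iff power2_eq_square power3_eq_cube power4_eq_xxxx algebra_simps)
      then have "measure_pmf.expectation ?pp (\<lambda>x. (f (fst x) + S (snd x)) ^ 4)
         = measure_pmf.expectation ?pp (\<lambda>x. f (fst x) ^ 4 * S (snd x) ^ 0)
         + 4 * measure_pmf.expectation ?pp (\<lambda>x. f (fst x) ^ 3 * S (snd x) ^ 1)
         + 6 * measure_pmf.expectation ?pp (\<lambda>x. f (fst x) ^ 2 * S (snd x) ^ 2)
         + 4 * measure_pmf.expectation ?pp (\<lambda>x. f (fst x) ^ 1 * S (snd x) ^ 3)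
         + measure_pmf.expectation ?pp (\<lambda>x. f (fst x) ^ 0 * S (snd x) ^ 4)"
        using ij(1)[of 4 0] ij(1)[of 3 1] ij(1)[of 2 2] ij(1)[of 1 3] ij(1)[of 0 4] by simp
      also have "\<dots> = m4 + 6 * (m2 * (real n * m2)) + measure_pmf.expectation ?r (\<lambda>x. S x ^ 4)"
        using ij(2)[of 4 0] ij(2)[of 3 1] ij(2)[of 2 2] ij(2)[of 1 3] ij(2)[of 0 4] f0 ES
        by (simp add: m2_def m4_def)
      also have "\<dots> \<le> m4 + 6 * (m2 * (real n * m2)) + (real n * m4 + 3 * real n ^ 2 * m2 ^ 2)"
        using ES by simp
      also have "\<dots> \<le> real (Suc n) * m4 + 3 * real (Suc n) ^ 2 * m2 ^ 2"
        by (simp add: power2_eq_square algebra_simps)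
      finally show ?thesis .
    qed
    show ?case
      using E1 E2 E4 rew[of "\<lambda>x. x"] rew[of "\<lambda>x. x ^ 2"] rew[of "\<lambda>x. x ^ 4"] by simp
  qed
  moreover have "real n * m4 + 3 * real n ^ 2 * m2 ^ 2 \<le> 4 * real n ^ 2 * m4"
  proof -
    have "real n * m4 \<le> real n ^ 2 * m4"
      using m4_0 by (intro mult_right_mono) (cases n, auto simp: power2_eq_square)
    moreover have "real n ^ 2 * m2 ^ 2 \<le> real n ^ 2 * m4" using m2sq by (intro mult_left_mono) auto
    ultimately show ?thesis by linarith
  qed
  ultimately show ?thesis unfolding m2_def[symmetric] m4_def[symmetric] by (blast intro: order_trans)
qed

section \<open>Length functions and hyperbolicity\<close>

text \<open>The word lengths of two generating sets will both be instances on the same group, so the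
  assumptions are what they share. Countability of the carrier serves the measurability of finite
  prefixes of a path.\<close>

locale length_group = group G for G :: "('a, 'b) monoid_scheme" (structure) +
  fixes len :: "'a \<Rightarrow> nat"
  assumes len_one [simp]: "len \<one> = 0"
    and len_mult: "x \<in> carrier G \<Longrightarrow> y \<in> carrier G \<Longrightarrow> len (x \<otimes> y) \<le> len x + len y"
    and len_inv [simp]: "x \<in> carrier G \<Longrightarrow> len (inv x) = len x"
    and countable_carrier: "countable (carrier G)"
begin

definition ldist :: "'a \<Rightarrow> 'a \<Rightarrow> real" where
  "ldist x y = real (len (inv x \<otimes> y))"

text \<open>The Gromov product based at the identity.\<close>

definition gp :: "'a \<Rightarrow> 'a \<Rightarrow> real" where
  "gp x y = (real (len x) + real (len y) - ldist x y) / 2"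

definition wp :: "'a list \<Rightarrow> 'a" where
  "wp xs = foldr (\<otimes>) xs \<one>"

lemma wp_Nil [simp]: "wp [] = \<one>" and wp_Cons [simp]: "wp (x # xs) = x \<otimes> wp xs"
  by (simp_all add: wp_def)

lemma wp_closed [simp, intro]: "set xs \<subseteq> carrier G \<Longrightarrow> wp xs \<in> carrier G"
  by (induction xs) auto

lemma wp_append:
  "set xs \<subseteq> carrier G \<Longrightarrow> set ys \<subseteq> carrier G \<Longrightarrow> wp (xs @ ys) = wp xs \<otimes> wp ys"
  by (induction xs) (auto simp: m_assoc)

lemma wp_rev_inv:
  "set xs \<subseteq> carrier G \<Longrightarrow> wp (rev (map (m_inv G) xs)) = inv (wp xs)"
proof (induction xs)
  case (Cons x xs)
  then have "set (rev (map (m_inv G) xs)) \<subseteq> carrier G" by auto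
  with Cons show ?case
    by (simp add: wp_append inv_mult_group del: set_rev)
qed simp

lemma len_wp_le: "set xs \<subseteq> carrier G \<Longrightarrow> len (wp xs) \<le> sum_list (map len xs)"
proof (induction xs)
  case (Cons x xs)
  then have "len (x \<otimes> wp xs) \<le> len x + len (wp xs)" by (intro len_mult) auto
  with Cons show ?case by simp
qed simp

lemma ldist_sym: "x \<in> carrier G \<Longrightarrow> y \<in> carrier G \<Longrightarrow> ldist x y = ldist y x"
  unfolding ldist_def using len_inv[of "inv x \<otimes> y"] by (simp add: inv_mult_group)

lemma gp_sym: "x \<in> carrier G \<Longrightarrow> y \<in> carrier G \<Longrightarrow> gp x y = gp y x"
  using ldist_sym by (simp add: gp_def)

lemma ldist_refl [simp]: "x \<in> carrier G \<Longrightarrow> ldist x x = 0"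
  by (simp add: ldist_def)

lemma ldist_ge: "x \<in> carrier G \<Longrightarrow> y \<in> carrier G \<Longrightarrow> ldist x y \<ge> real (len x) - real (len y)"
proof -
  assume x: "x \<in> carrier G" and y: "y \<in> carrier G"
  have "x = y \<otimes> inv (inv x \<otimes> y)"
    using x y by (simp add: inv_mult_group m_assoc[symmetric])
  then have "len x \<le> len y + len (inv (inv x \<otimes> y))"
    using x y len_mult[of y "inv (inv x \<otimes> y)"] by simp
  then show ?thesis using x y by (simp add: ldist_def)
qed

lemma gp_ge: "x \<in> carrier G \<Longrightarrow> y \<in> carrier G \<Longrightarrow> gp x y \<ge> real (len x) - ldist x y"
  using ldist_ge[of x y] by (simp add: gp_def field_simps)

lemma gp_nonneg: "x \<in> carrier G \<Longrightarrow> y \<in> carrier G \<Longrightarrow> gp x y \<ge> 0"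
  using len_mult[of "inv x" y] by (simp add: gp_def ldist_def)

text \<open>Both sides are the Gromov product of the identity and \<open>x \<otimes> y\<close> seen
  from \<open>x\<close>. With \<open>x\<close> the past and \<open>y\<close> the future of a walk,
  this turns a failure of tracking into an event about the two independent walks that lead to
  \<open>inv x\<close> and to \<open>y\<close>.\<close>

lemma gp_inv:
  assumes "x \<in> carrier G" "y \<in> carrier G"
  shows "real (len x) - gp x (x \<otimes> y) = gp (inv x) y"
proof -
  have "inv x \<otimes> (x \<otimes> y) = y" using assms by (simp add: m_assoc[symmetric])
  then show ?thesis using assms by (simp add: gp_def ldist_def field_simps)
qed

end

locale hyperbolic_group = length_group +
  fixes \<delta> :: real
  assumes delta_nonneg: "\<delta> \<ge> 0"
    and hyp: "\<lbrakk>x \<in> carrier G; y \<in> carrier G; z \<in> carrier G\<rbrakk>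
      \<Longrightarrow> gp x z \<ge> min (gp x y) (gp y z) - \<delta>"
begin

lemma gp_trans:
  "\<lbrakk>gp x y \<ge> A; gp y z \<ge> A; x \<in> carrier G; y \<in> carrier G; z \<in> carrier G\<rbrakk> \<Longrightarrow> gp x z \<ge> A - \<delta>"
  using hyp[of x y z] by linarith

text \<open>Bisection: joining two halves costs one \<open>\<delta>\<close>, so a chain of 2^j links
  loses j times \<open>\<delta>\<close> in all. A path that keeps away from the identity thus pays
  only for the logarithm of its length.\<close>

lemma gp_chain:
  assumes "\<And>i. i \<le> l \<Longrightarrow> y i \<in> carrier G" and "\<And>i. i < l \<Longrightarrow> gp (y i) (y (Suc i)) \<ge> A"
    and "1 \<le> l" "l \<le> 2 ^ j"
  shows "gp (y 0) (y l) \<ge> A - real j * \<delta>"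
  using assms
proof (induction j arbitrary: l y)
  case 0
  then have "l = 1" by simp
  with 0 show ?case by (metis One_nat_def diff_0_right lessI mult_zero_left of_nat_0)
next
  case (Suc j)
  show ?case
  proof (cases "l \<le> 2 ^ j")
    case True
    then have "gp (y 0) (y l) \<ge> A - real j * \<delta>" using Suc by blast
    then show ?thesis using delta_nonneg by (simp add: algebra_simps)
  next
    case False
    have "gp (y 0) (y (2 ^ j)) \<ge> A - real j * \<delta>"
      using Suc.prems False by (intro Suc.IH) auto
    moreover have "gp (y (2 ^ j + 0)) (y (2 ^ j + (l - 2 ^ j))) \<ge> A - real j * \<delta>"
      using Suc.prems False
      by (intro Suc.IH[where y = "\<lambda>i. y (2 ^ j + i)"]) auto
    ultimately have "gp (y 0) (y l) \<ge> A - real j * \<delta> - \<delta>"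
      using Suc.prems False by (intro gp_trans[where y = "y (2 ^ j)"]) auto
    then show ?thesis by (simp add: algebra_simps)
  qed
qed

lemma gp_chain_log:
  assumes "\<And>i. i \<le> l \<Longrightarrow> y i \<in> carrier G" and "\<And>i. i < l \<Longrightarrow> gp (y i) (y (Suc i)) \<ge> A"
    and "1 \<le> l" "l \<le> n"
  shows "gp (y 0) (y l) \<ge> A - (log 2 (real n) + 1) * \<delta>"
proof -
  define j where "j = nat \<lceil>log 2 (real n)\<rceil>"
  have n: "n \<ge> 1" using assms by linarith
  have "real n = 2 powr (log 2 (real n))" using n by simp
  also have "\<dots> \<le> 2 powr (real j)" unfolding j_def by (intro powr_mono real_nat_ceiling_ge) auto
  also have "\<dots> = real (2 ^ j)" by (simp add: powr_realpow)
  finally have "l \<le> 2 ^ j" using assms(4) by linarith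
  then have "gp (y 0) (y l) \<ge> A - real j * \<delta>" using assms by (intro gp_chain) auto
  moreover have "real j \<le> log 2 (real n) + 1"
  proof -
    have "log 2 (real n) \<ge> 0" using n by simp
    then show ?thesis unfolding j_def by linarith
  qed
  then have "real j * \<delta> \<le> (log 2 (real n) + 1) * \<delta>" using delta_nonneg by (intro mult_right_mono)
  ultimately show ?thesis by linarith
qed

end

section \<open>The word length as a length function\<close>

context group
begin

lemma generating_word_exists:
  assumes "generating_set G S" "x \<in> carrier G"
  shows "\<exists>xs. set xs \<subseteq> S \<union> m_inv G ` S \<and> foldr (\<otimes>) xs \<one> = x"
proof -
  have S: "S \<subseteq> carrier G" and x: "x \<in> generate G S"
    using assms by (auto simp: generating_set_def)
  have app: "foldr (\<otimes>) (xs @ ys) \<one> = foldr (\<otimes>) xs \<one> \<otimes> foldr (\<otimes>) ys \<one>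
      \<and> foldr (\<otimes>) xs \<one> \<in> carrier G"
    if "set xs \<subseteq> carrier G" "foldr (\<otimes>) ys \<one> \<in> carrier G" for xs ys
    using that by (induction xs) (auto simp: m_assoc)
  have "\<exists>xs. set xs \<subseteq> S \<union> m_inv G ` S \<and> foldr (\<otimes>) xs \<one> = x"
    using x
  proof (induction rule: generate.induct)
    case one
    then show ?case by (intro exI[of _ "[]"]) auto
  next
    case (incl h)
    then show ?case using S by (intro exI[of _ "[h]"]) auto
  next
    case (inv h)
    then show ?case using S by (intro exI[of _ "[inv h]"]) auto
  next
    case (eng h1 h2)
    then obtain xs ys where "set xs \<subseteq> S \<union> m_inv G ` S" "foldr (\<otimes>) xs \<one> = h1"
      "set ys \<subseteq> S \<union> m_inv G ` S" "foldr (\<otimes>) ys \<one> = h2" by blast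
    moreover have "h2 \<in> carrier G" using eng S generate_in_carrier by blast
    moreover have "S \<union> m_inv G ` S \<subseteq> carrier G" using S by auto
    ultimately show ?case by (intro exI[of _ "xs @ ys"]) (use app[of xs ys] in auto)
  qed
  then show ?thesis .
qed

lemma word_length_witness:
  assumes "generating_set G S" "x \<in> carrier G"
  obtains xs where "length xs = word_length G S x" "set xs \<subseteq> S \<union> m_inv G ` S"
    "foldr (\<otimes>) xs \<one> = x"
proof -
  have "\<exists>n xs. length xs = n \<and> set xs \<subseteq> S \<union> m_inv G ` S \<and> foldr (\<otimes>) xs \<one> = x"
    using generating_word_exists[OF assms] by blast
  from LeastI_ex[OF this] show thesis
    unfolding word_length_def[symmetric] using that by blast
qed

lemma word_length_le:
  "set xs \<subseteq> S \<union> m_inv G ` S \<Longrightarrow> foldr (\<otimes>) xs \<one> = x \<Longrightarrow> word_length G S x \<le> length xs"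
  unfolding word_length_def by (intro Least_le) auto

lemma length_group_word_length:
  assumes S: "generating_set G S"
  shows "length_group G (word_length G S)"
proof -
  have Sc: "S \<union> m_inv G ` S \<subseteq> carrier G" and fin: "finite S"
    using S by (auto simp: generating_set_def)
  have cl: "foldr (\<otimes>) zs \<one> \<in> carrier G" if "set zs \<subseteq> carrier G" for zs
    using that by (induction zs) auto
  have app: "foldr (\<otimes>) (xs @ ys) \<one> = foldr (\<otimes>) xs \<one> \<otimes> foldr (\<otimes>) ys \<one>"
    if "set xs \<subseteq> carrier G" "set ys \<subseteq> carrier G" for xs ys
    using that by (induction xs) (auto simp: m_assoc cl)
  have inv_le: "word_length G S (inv x) \<le> word_length G S x" if x: "x \<in> carrier G" for x
  proof -
    obtain xs where xs: "length xs = word_length G S x" "set xs \<subseteq> S \<union> m_inv G ` S"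
      "foldr (\<otimes>) xs \<one> = x" using word_length_witness[OF S x] .
    have "foldr (\<otimes>) (rev (map (m_inv G) zs)) \<one> = inv (foldr (\<otimes>) zs \<one>)"
      if "set zs \<subseteq> carrier G" for zs
      using that
    proof (induction zs)
      case (Cons z zs)
      then have "set (rev (map (m_inv G) zs)) \<subseteq> carrier G" "set [inv z] \<subseteq> carrier G" by auto
      from app[OF this] Cons cl show ?case
        by (simp add: inv_mult_group)
    qed simp
    from this[of xs] xs Sc have "foldr (\<otimes>) (rev (map (m_inv G) xs)) \<one> = inv x"
      by (metis subset_trans)
    moreover have "set (rev (map (m_inv G) xs)) \<subseteq> S \<union> m_inv G ` S"
    proof
      fix y assume "y \<in> set (rev (map (m_inv G) xs))"
      then obtain z where z: "z \<in> set xs" "y = inv z" by auto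
      with xs have "z \<in> S \<or> (\<exists>s\<in>S. z = inv s)" by auto
      then show "y \<in> S \<union> m_inv G ` S" using z Sc by auto
    qed
    ultimately have "word_length G S (inv x) \<le> length (rev (map (m_inv G) xs))"
      by (intro word_length_le)
    then show ?thesis using xs by simp
  qed
  show ?thesis
  proof
    show "word_length G S \<one> = 0" using word_length_le[of "[]"] by simp
  next
    fix x y assume x: "x \<in> carrier G" and y: "y \<in> carrier G"
    obtain xs where xs: "length xs = word_length G S x" "set xs \<subseteq> S \<union> m_inv G ` S"
      "foldr (\<otimes>) xs \<one> = x" using word_length_witness[OF S x] .
    obtain ys where ys: "length ys = word_length G S y" "set ys \<subseteq> S \<union> m_inv G ` S"
      "foldr (\<otimes>) ys \<one> = y" using word_length_witness[OF S y] .
    have "word_length G S (x \<otimes> y) \<le> length (xs @ ys)"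
      using xs ys Sc app[of xs ys] by (intro word_length_le) auto
    then show "word_length G S (x \<otimes> y) \<le> word_length G S x + word_length G S y"
      using xs ys by simp
  next
    fix x assume x: "x \<in> carrier G"
    show "word_length G S (inv x) = word_length G S x"
      using inv_le[OF x] inv_le[of "inv x"] x by simp
  next
    have "carrier G \<subseteq> (\<lambda>xs. foldr (\<otimes>) xs \<one>) ` lists (S \<union> m_inv G ` S)"
      using generating_word_exists[OF S] by (auto simp: image_iff lists_eq_set Bex_def eq_commute)
    moreover have "countable (lists (S \<union> m_inv G ` S))"
      using fin by (intro countable_lists countable_finite) auto
    ultimately show "countable (carrier G)"
      using countable_subset countable_image by metis
  qed
qed

end

section \<open>Existence of the escape rate\<close>

text \<open>A fourth moment has the strength that two estimates below ask for: deviation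
  probabilities of order 1/n^2, and n steps of which none exceeds a given multiple of sqrt n, since
  n / (sqrt n)^4 tends to 0.\<close>

locale random_walk = length_group +
  fixes \<mu> :: "'a pmf"
  assumes supp: "set_pmf \<mu> \<subseteq> carrier G"
    and moment: "integrable (measure_pmf \<mu>) (\<lambda>x. real (len x) ^ 4)"
begin

definition norm_wp :: "'a list \<Rightarrow> real" where
  "norm_wp xs = real (len (wp xs))"

definition mean_len :: "nat \<Rightarrow> real" where
  "mean_len n = measure_pmf.expectation (replicate_pmf n \<mu>) norm_wp"

text \<open>Taken as an infimum so that \<open>rate * real n \<le> mean_len n\<close> holds for
  every \<open>n\<close>, not only in the limit.\<close>

definition rate :: real where
  "rate = (INF n\<in>{1..}. mean_len n / real n)"

lemma support_replicate: "xs \<in> set_pmf (replicate_pmf n \<mu>) \<Longrightarrow> set xs \<subseteq> carrier G"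
  using set_replicate_pmf_subset supp by blast

lemma norm_wp_nonneg [simp]: "norm_wp xs \<ge> 0"
  by (simp add: norm_wp_def)

lemma norm_wp_le_sum: "set xs \<subseteq> carrier G \<Longrightarrow> norm_wp xs \<le> sum_list (map (\<lambda>x. real (len x)) xs)"
proof -
  have "real (sum_list (map len xs)) = sum_list (map (\<lambda>x. real (len x)) xs)" for xs
    by (induction xs) auto
  then show "set xs \<subseteq> carrier G \<Longrightarrow> norm_wp xs \<le> sum_list (map (\<lambda>x. real (len x)) xs)"
    using len_wp_le[of xs] unfolding norm_wp_def by (metis of_nat_mono)
qed

lemma norm_wp_append:
  "set xs \<subseteq> carrier G \<Longrightarrow> set ys \<subseteq> carrier G \<Longrightarrow> norm_wp (xs @ ys) \<le> norm_wp xs + norm_wp ys"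
  unfolding norm_wp_def using len_mult[of "wp xs" "wp ys"] by (simp add: wp_append)

lemma norm_wp_concat:
  "(\<And>xs. xs \<in> set xss \<Longrightarrow> set xs \<subseteq> carrier G)
    \<Longrightarrow> norm_wp (concat xss) \<le> sum_list (map norm_wp xss)"
proof (induction xss)
  case (Cons xs xss)
  then have "norm_wp (xs @ concat xss) \<le> norm_wp xs + norm_wp (concat xss)"
    by (intro norm_wp_append) auto
  with Cons show ?case by fastforce
qed (simp add: norm_wp_def)

lemma integrable_norm_wp_power:
  assumes "j \<le> 4"
  shows "integrable (measure_pmf (replicate_pmf n \<mu>)) (\<lambda>xs. norm_wp xs ^ j)"
proof (rule Bochner_Integration.integrable_bound)
  show "integrable (measure_pmf (replicate_pmf n \<mu>)) (\<lambda>xs. sum_list (map (\<lambda>x. real (len x)) xs) ^ j)"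
    using moment assms by (rule integrable_sum_list_power)
  show "AE xs in measure_pmf (replicate_pmf n \<mu>).
      norm (norm_wp xs ^ j) \<le> norm (sum_list (map (\<lambda>x. real (len x)) xs) ^ j)"
  proof (rule AE_pmfI)
    fix xs assume "xs \<in> set_pmf (replicate_pmf n \<mu>)"
    then have le: "norm_wp xs \<le> sum_list (map (\<lambda>x. real (len x)) xs)"
      by (intro norm_wp_le_sum support_replicate)
    then have "norm_wp xs ^ j \<le> sum_list (map (\<lambda>x. real (len x)) xs) ^ j"
      by (intro power_mono) auto
    then show "norm (norm_wp xs ^ j) \<le> norm (sum_list (map (\<lambda>x. real (len x)) xs) ^ j)"
      by simp
  qed
qed simp

lemma integrable_norm_wp: "integrable (measure_pmf (replicate_pmf n \<mu>)) norm_wp"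
  using integrable_norm_wp_power[of 1 n] by simp

lemma mean_len_nonneg: "mean_len n \<ge> 0"
  by (simp add: mean_len_def)

lemma mean_len_add: "mean_len (m + n) \<le> mean_len m + mean_len n"
proof -
  let ?p = "pair_pmf (replicate_pmf m \<mu>) (replicate_pmf n \<mu>)"
  have i: "integrable (measure_pmf ?p) (\<lambda>x. norm_wp (fst x))"
    "integrable (measure_pmf ?p) (\<lambda>x. norm_wp (snd x))"
    using integrable_norm_wp
    by (metis integrable_map_pmf_eq map_fst_pair_pmf, metis integrable_map_pmf_eq map_snd_pair_pmf)
  have "mean_len (m + n) = measure_pmf.expectation ?p (\<lambda>x. norm_wp (fst x @ snd x))"
    unfolding mean_len_def replicate_pmf_add by (simp add: case_prod_unfold)
  also have "\<dots> \<le> measure_pmf.expectation ?p (\<lambda>x. norm_wp (fst x) + norm_wp (snd x))"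
  proof (rule integral_mono_AE)
    show "integrable (measure_pmf ?p) (\<lambda>x. norm_wp (fst x @ snd x))"
      using integrable_norm_wp[of "m + n"] unfolding replicate_pmf_add by (simp add: case_prod_unfold)
    show "AE x in measure_pmf ?p. norm_wp (fst x @ snd x) \<le> norm_wp (fst x) + norm_wp (snd x)"
      by (rule AE_pmfI) (auto intro!: norm_wp_append dest!: support_replicate)
  qed (use i in auto)
  also have "\<dots> = mean_len m + mean_len n" using i by (simp add: mean_len_def)
  finally show ?thesis .
qed

lemma mean_len_0 [simp]: "mean_len 0 = 0"
  by (simp add: mean_len_def norm_wp_def)

lemma mean_len_mult: "mean_len (k * m + r) \<le> real k * mean_len m + mean_len r"
proof (induction k)
  case (Suc k)
  have "mean_len (Suc k * m + r) \<le> mean_len m + mean_len (k * m + r)"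
    using mean_len_add[of m "k * m + r"] by (simp add: add.assoc)
  with Suc show ?case by (simp add: algebra_simps)
qed simp

lemma rate_le: "n \<ge> 1 \<Longrightarrow> rate \<le> mean_len n / real n"
  unfolding rate_def
  by (rule cINF_lower) (auto intro!: bdd_belowI[of _ 0] simp: mean_len_nonneg)

lemma rate_mult_le: "rate * real n \<le> mean_len n"
  using rate_le[of n] by (cases "n = 0") (auto simp: field_simps)

lemma rate_nonneg: "rate \<ge> 0"
  unfolding rate_def by (rule cINF_greatest) (auto simp: mean_len_nonneg)

lemma rate_approx:
  assumes "\<epsilon> > 0"
  obtains m where "m \<ge> 1" "mean_len m / real m < rate + \<epsilon>"
proof -
  have "\<exists>m\<in>{1..}. mean_len m / real m < rate + \<epsilon>"
    unfolding rate_def using assms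
    by (subst cINF_less_iff[symmetric]) (auto intro!: bdd_belowI[of _ 0] simp: mean_len_nonneg)
  then show thesis using that by auto
qed

text \<open>Fekete's argument: divide \<open>n\<close> with remainder by an \<open>m\<close> that
  nearly attains the infimum.\<close>

lemma mean_len_tendsto: "(\<lambda>n. mean_len n / real n) \<longlonglongrightarrow> rate"
proof (rule LIMSEQ_I)
  fix e :: real assume e: "e > 0"
  obtain m where m: "m \<ge> 1" "mean_len m / real m < rate + e / 2"
    using rate_approx[of "e / 2"] e by auto
  define C where "C = (\<Sum>r<m. mean_len r)"
  have C: "mean_len r \<le> C" if "r < m" for r
    unfolding C_def using that by (intro member_le_sum) (auto simp: mean_len_nonneg)
  obtain n0 where n0: "real n0 > 2 * C / e" using reals_Archimedean2 by blast
  show "\<exists>no. \<forall>n\<ge>no. norm (mean_len n / real n - rate) < e"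
  proof (intro exI allI impI)
    fix n assume n: "n \<ge> Suc n0"
    have "mean_len n = mean_len ((n div m) * m + n mod m)" by simp
    also have "\<dots> \<le> real (n div m) * mean_len m + mean_len (n mod m)" by (rule mean_len_mult)
    also have "\<dots> \<le> real n / real m * mean_len m + C"
    proof -
      have "real (n div m * m) \<le> real n" by (intro of_nat_mono) simp
      then have "real (n div m) \<le> real n / real m" using m by (simp add: field_simps)
      then show ?thesis using m C[of "n mod m"] mean_len_nonneg[of m]
        by (intro add_mono mult_right_mono) auto
    qed
    finally have "mean_len n / real n \<le> mean_len m / real m + C / real n"
      using n by (simp add: field_simps)
    moreover have "C / real n < e / 2"
    proof -
      have "2 * C / e < real n" using n0 n by linarith
      then show ?thesis using e n by (simp add: field_simps)
    qed
    moreover have "rate \<le> mean_len n / real n" using n by (intro rate_le) simp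
    ultimately show "norm (mean_len n / real n - rate) < e"
      unfolding real_norm_def using m by linarith
  qed
qed

section \<open>The space of infinite paths and its finite prefixes\<close>

abbreviation step_measure :: "'a measure" where
  "step_measure \<equiv> restrict_space (measure_pmf \<mu>) (carrier G)"

abbreviation path_measure :: "(nat \<Rightarrow> 'a) measure" where
  "path_measure \<equiv> increments_space G \<mu>"

definition prefix :: "nat \<Rightarrow> (nat \<Rightarrow> 'a) \<Rightarrow> 'a list" where
  "prefix n \<omega> = map \<omega> [0..<n]"

lemma emeasure_carrier: "emeasure (measure_pmf \<mu>) (carrier G) = 1"
  using supp by (intro measure_pmf.emeasure_eq_1_AE) (auto simp: AE_measure_pmf_iff)

lemma prob_space_step: "prob_space step_measure"
  by (intro prob_spaceI) (simp add: emeasure_restrict_space space_restrict_space emeasure_carrier)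

lemma space_step: "space step_measure = carrier G"
  by (simp add: space_restrict_space)

lemma sets_step: "sets step_measure = Pow (carrier G)"
  by (auto simp: sets_restrict_space)

sublocale steps: prob_space step_measure by (rule prob_space_step)

sublocale seq: sequence_space step_measure ..

lemma path_measure_eq: "path_measure = Pi\<^sub>M UNIV (\<lambda>_. step_measure)"
  by (simp add: increments_space_def)

sublocale paths: prob_space path_measure
  unfolding path_measure_eq by (rule seq.prob_space_axioms)

lemma space_path: "space path_measure = {\<omega>. range \<omega> \<subseteq> carrier G}"
  by (auto simp: path_measure_eq space_PiM space_step PiE_def)

lemma prefix_in_lists: "\<omega> \<in> space path_measure \<Longrightarrow> set (prefix n \<omega>) \<subseteq> carrier G"
  by (auto simp: space_path prefix_def)

lemma prefix_Suc: "prefix (Suc n) \<omega> = prefix n \<omega> @ [\<omega> n]"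
  by (simp add: prefix_def)

lemma length_prefix [simp]: "length (prefix n \<omega>) = n"
  by (simp add: prefix_def)

lemma take_prefix: "m \<le> n \<Longrightarrow> take m (prefix n \<omega>) = prefix m \<omega>"
  by (simp add: prefix_def take_map)

lemma walk_eq: "\<omega> \<in> space path_measure \<Longrightarrow> walk G \<omega> n = wp (prefix n \<omega>)"
proof (induction n)
  case (Suc n)
  have "\<omega> n \<in> carrier G" using Suc.prems by (auto simp: space_path)
  moreover have "wp (prefix n \<omega> @ [\<omega> n]) = wp (prefix n \<omega>) \<otimes> wp [\<omega> n]"
    using prefix_in_lists[OF Suc.prems] calculation by (intro wp_append) auto
  ultimately show ?case using Suc by (simp add: prefix_Suc)
qed (simp add: prefix_def)

text \<open>A prefix takes countably many values because the carrier is countable, so it is enough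
  that each fibre is a finite intersection of coordinate events. Measurability of
  \<open>walk_len\<close> factors through this map.\<close>

lemma measurable_prefix [measurable]: "prefix n \<in> path_measure \<rightarrow>\<^sub>M count_space UNIV"
proof -
  have "prefix n \<in> path_measure \<rightarrow>\<^sub>M count_space (lists (carrier G))"
  proof (subst measurable_count_space_eq_countable)
    show "countable (lists (carrier G))" using countable_carrier by (rule countable_lists)
    show "prefix n \<in> space path_measure \<rightarrow> lists (carrier G) \<and>
        (\<forall>a\<in>lists (carrier G). prefix n -` {a} \<inter> space path_measure \<in> sets path_measure)"
    proof (intro conjI ballI funcsetI)
      fix \<omega> assume "\<omega> \<in> space path_measure"
      then show "prefix n \<omega> \<in> lists (carrier G)" using prefix_in_lists by auto
    next
      fix xs assume xs: "xs \<in> lists (carrier G)"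
      show "prefix n -` {xs} \<inter> space path_measure \<in> sets path_measure"
      proof (cases "length xs = n")
        case True
        have "prefix n \<omega> = xs \<longleftrightarrow> (\<forall>i<n. \<omega> i = xs ! i)" for \<omega>
          unfolding prefix_def list_eq_iff_nth_eq using True by simp
        then have "prefix n -` {xs} \<inter> space path_measure
            = space path_measure \<inter> (\<Inter>i\<in>{..<n}. {\<omega> \<in> space path_measure. \<omega> i = xs ! i})"
          by blast
        also have "\<dots> \<in> sets path_measure"
        proof (cases "n = 0")
          case False
          have "{\<omega> \<in> space path_measure. \<omega> i = xs ! i} \<in> sets path_measure" if "i < n" for i
          proof -
            have "{xs ! i} \<in> sets step_measure"
              using xs True that by (auto simp: sets_step)
            then have "{\<omega> \<in> space (Pi\<^sub>M UNIV (\<lambda>_::nat. step_measure)). \<omega> i \<in> {xs ! i}}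
                \<in> sets (Pi\<^sub>M UNIV (\<lambda>_. step_measure))"
              by (intro sets_Collect_single) auto
            then show ?thesis unfolding path_measure_eq by simp
          qed
          then have "(\<Inter>i\<in>{..<n}. {\<omega> \<in> space path_measure. \<omega> i = xs ! i}) \<in> sets path_measure"
            using False by (intro sets.finite_INT) auto
          then show ?thesis by (intro sets.Int) auto
        qed simp
        finally show ?thesis .
      next
        case False
        then have "prefix n -` {xs} \<inter> space path_measure = {}" by auto
        then show ?thesis by simp
      qed
    qed
  qed
  moreover have "id \<in> count_space (lists (carrier G)) \<rightarrow>\<^sub>M count_space UNIV" by simp
  ultimately have "id \<circ> prefix n \<in> path_measure \<rightarrow>\<^sub>M count_space UNIV"
    by (rule measurable_comp)
  then show ?thesis by simp
qed

lemma nn_integral_step: "(\<integral>\<^sup>+x. h x \<partial>step_measure) = (\<integral>\<^sup>+x. h x \<partial>measure_pmf \<mu>)"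
proof -
  have "(\<integral>\<^sup>+x. h x \<partial>step_measure) = (\<integral>\<^sup>+x. h x * indicator (carrier G) x \<partial>measure_pmf \<mu>)"
    by (subst nn_integral_restrict_space) auto
  also have "\<dots> = (\<integral>\<^sup>+x. h x \<partial>measure_pmf \<mu>)"
    using supp by (intro nn_integral_cong_AE AE_pmfI) (auto simp: indicator_def)
  finally show ?thesis .
qed

lemma nn_integral_prefix:
  "(\<integral>\<^sup>+\<omega>. h (prefix n \<omega>) \<partial>path_measure) = (\<integral>\<^sup>+xs. h xs \<partial>measure_pmf (replicate_pmf n \<mu>))"
proof (induction n arbitrary: h)
  case 0
  then show ?case by (simp add: prefix_def paths.emeasure_space_1)
next
  case (Suc n)
  let ?S = "Pi\<^sub>M (UNIV :: nat set) (\<lambda>_. step_measure)"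
  interpret pair: pair_sigma_finite step_measure path_measure ..
  have cn: "(\<lambda>(s, \<omega>). case_nat s \<omega>) \<in> step_measure \<Otimes>\<^sub>M ?S \<rightarrow>\<^sub>M ?S" by measurable
  have cons: "prefix (Suc n) (case_nat s \<omega>) = s # prefix n \<omega>" for s \<omega>
    by (simp add: prefix_def upt_conv_Cons map_Suc_upt[symmetric] del: upt_Suc)
  have m: "(\<lambda>\<omega>. h (prefix k \<omega>)) \<in> borel_measurable ?S" for k and h :: "'a list \<Rightarrow> ennreal"
    using measurable_prefix[of k] unfolding path_measure_eq
    by (rule measurable_compose) simp
  have "(\<integral>\<^sup>+\<omega>. h (prefix (Suc n) \<omega>) \<partial>path_measure)
      = (\<integral>\<^sup>+\<omega>. h (prefix (Suc n) \<omega>) \<partial>distr (step_measure \<Otimes>\<^sub>M ?S) ?S (\<lambda>(s, \<omega>). case_nat s \<omega>))"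
    unfolding seq.PiM_iter path_measure_eq ..
  also have "\<dots> = (\<integral>\<^sup>+p. h (fst p # prefix n (snd p)) \<partial>(step_measure \<Otimes>\<^sub>M ?S))"
    using m[of h "Suc n"] by (subst nn_integral_distr[OF cn]) (simp_all add: case_prod_unfold cons)
  also have "\<dots> = (\<integral>\<^sup>+s. \<integral>\<^sup>+\<omega>. h (s # prefix n \<omega>) \<partial>?S \<partial>step_measure)"
  proof -
    have "(\<lambda>p. h (prefix (Suc n) (case p of (s, \<omega>) \<Rightarrow> case_nat s \<omega>)))
        \<in> borel_measurable (step_measure \<Otimes>\<^sub>M ?S)"
      by (rule measurable_compose[OF cn m])
    then have "(\<lambda>p. h (fst p # prefix n (snd p))) \<in> borel_measurable (step_measure \<Otimes>\<^sub>M ?S)"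
      by (simp add: case_prod_unfold cons)
    from seq.P.nn_integral_fst[OF this] show ?thesis by simp
  qed
  also have "\<dots> = (\<integral>\<^sup>+s. \<integral>\<^sup>+xs. h (s # xs) \<partial>measure_pmf (replicate_pmf n \<mu>) \<partial>measure_pmf \<mu>)"
    unfolding nn_integral_step path_measure_eq[symmetric]
    by (rule nn_integral_cong) (rule Suc)
  also have "\<dots> = (\<integral>\<^sup>+xs. h xs \<partial>measure_pmf (replicate_pmf (Suc n) \<mu>))"
    by simp
  finally show ?case .
qed

text \<open>The bridge between two settings: almost sure limits live on the path space, the
  quantitative estimates on \<open>replicate_pmf\<close>.\<close>

lemma distr_prefix: "distr path_measure (count_space UNIV) (prefix n) = measure_pmf (replicate_pmf n \<mu>)"
proof (rule measure_eqI)
  fix A assume "A \<in> sets (distr path_measure (count_space UNIV) (prefix n))"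
  have "emeasure (distr path_measure (count_space UNIV) (prefix n)) A
      = (\<integral>\<^sup>+xs. indicator A xs \<partial>distr path_measure (count_space UNIV) (prefix n))"
    by simp
  also have "\<dots> = (\<integral>\<^sup>+\<omega>. indicator A (prefix n \<omega>) \<partial>path_measure)"
    by (subst nn_integral_distr[OF measurable_prefix]) simp_all
  also have "\<dots> = emeasure (measure_pmf (replicate_pmf n \<mu>)) A"
    unfolding nn_integral_prefix by simp
  finally show "emeasure (distr path_measure (count_space UNIV) (prefix n)) A
    = emeasure (measure_pmf (replicate_pmf n \<mu>)) A" .
qed simp

lemma prob_prefix:
  "paths.prob {\<omega> \<in> space path_measure. prefix n \<omega> \<in> A} = measure_pmf.prob (replicate_pmf n \<mu>) A"
proof -
  have "measure_pmf.prob (replicate_pmf n \<mu>) A = paths.prob (prefix n -` A \<inter> space path_measure)"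
    unfolding distr_prefix[symmetric] by (rule measure_distr[OF measurable_prefix]) simp
  also have "prefix n -` A \<inter> space path_measure = {\<omega> \<in> space path_measure. prefix n \<omega> \<in> A}"
    by blast
  finally show ?thesis ..
qed

lemma
  fixes h :: "'a list \<Rightarrow> real"
  shows integrable_prefix: "integrable path_measure (\<lambda>\<omega>. h (prefix n \<omega>))
      \<longleftrightarrow> integrable (measure_pmf (replicate_pmf n \<mu>)) h"
    and integral_prefix: "(\<integral>\<omega>. h (prefix n \<omega>) \<partial>path_measure)
      = measure_pmf.expectation (replicate_pmf n \<mu>) h"
proof -
  have h: "h \<in> borel_measurable (count_space UNIV)" by simp
  show "integrable path_measure (\<lambda>\<omega>. h (prefix n \<omega>)) \<longleftrightarrow> integrable (measure_pmf (replicate_pmf n \<mu>)) h"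
    unfolding distr_prefix[symmetric] by (rule integrable_distr_eq[OF measurable_prefix h, symmetric])
  show "(\<integral>\<omega>. h (prefix n \<omega>) \<partial>path_measure) = measure_pmf.expectation (replicate_pmf n \<mu>) h"
    unfolding distr_prefix[symmetric] by (rule integral_distr[OF measurable_prefix h, symmetric])
qed

section \<open>Shifts, subadditivity along a path and the covering bound\<close>

definition shift :: "nat \<Rightarrow> (nat \<Rightarrow> 'a) \<Rightarrow> nat \<Rightarrow> 'a" where
  "shift k \<omega> = (\<lambda>i. \<omega> (i + k))"

definition walk_len :: "nat \<Rightarrow> (nat \<Rightarrow> 'a) \<Rightarrow> real" where
  "walk_len n \<omega> = norm_wp (prefix n \<omega>)"

lemma walk_len_0 [simp]: "walk_len 0 \<omega> = 0"
  by (simp add: walk_len_def prefix_def norm_wp_def)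

lemma walk_len_nonneg [simp]: "walk_len n \<omega> \<ge> 0"
  by (simp add: walk_len_def)

lemma walk_len_eq_walk: "\<omega> \<in> space path_measure \<Longrightarrow> walk_len n \<omega> = real (len (walk G \<omega> n))"
  by (simp add: walk_len_def norm_wp_def walk_eq)

lemma measurable_walk_len [measurable]: "walk_len n \<in> borel_measurable path_measure"
proof -
  have "(\<lambda>\<omega>. norm_wp (prefix n \<omega>)) \<in> borel_measurable path_measure"
    by (rule measurable_compose[OF measurable_prefix]) simp
  then show ?thesis by (simp add: walk_len_def[abs_def])
qed

lemma shift_space: "\<omega> \<in> space path_measure \<Longrightarrow> shift k \<omega> \<in> space path_measure"
  by (auto simp: space_path shift_def)

lemma prefix_add: "prefix (m + n) \<omega> = prefix m \<omega> @ prefix n (shift m \<omega>)"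
  by (rule nth_equalityI) (auto simp: prefix_def shift_def nth_append)

lemma walk_len_add: "\<omega> \<in> space path_measure \<Longrightarrow> walk_len (m + n) \<omega> \<le> walk_len m \<omega> + walk_len n (shift m \<omega>)"
  unfolding walk_len_def prefix_add by (intro norm_wp_append prefix_in_lists shift_space)

lemma len_component: "\<omega> \<in> space path_measure \<Longrightarrow> real (len (\<omega> 0)) = walk_len 1 \<omega>"
  by (subgoal_tac "\<omega> 0 \<in> carrier G") (auto simp: walk_len_def prefix_def norm_wp_def space_path)

lemma walk_len_sum: "\<omega> \<in> space path_measure \<Longrightarrow> walk_len n \<omega> \<le> (\<Sum>i<n. walk_len 1 (shift i \<omega>))"
proof (induction n)
  case (Suc n)
  then show ?case using walk_len_add[of \<omega> n 1] by simp
qed simp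

text \<open>The triangle inequality in the direction opposite to \<open>walk_len_add\<close>.
  Together they show that dropping the first step does not affect the growth rate of the
  length.\<close>

lemma walk_len_shift: 
  assumes "\<omega> \<in> space path_measure"
  shows "walk_len n (shift 1 \<omega>) \<le> walk_len (Suc n) \<omega> + walk_len 1 \<omega>"
proof -
  have s: "\<omega> 0 \<in> carrier G" "set (prefix n (shift 1 \<omega>)) \<subseteq> carrier G"
    using assms prefix_in_lists shift_space by (auto simp: space_path)
  let ?y = "wp (prefix n (shift 1 \<omega>))"
  have y: "?y \<in> carrier G" using s by auto
  have "?y = inv (\<omega> 0) \<otimes> (\<omega> 0 \<otimes> ?y)" using s(1) y by (simp add: m_assoc[symmetric])
  then have "len ?y \<le> len (\<omega> 0) + len (\<omega> 0 \<otimes> ?y)"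
    using len_mult[of "inv (\<omega> 0)" "\<omega> 0 \<otimes> ?y"] s(1) y by simp
  moreover have "prefix (Suc n) \<omega> = \<omega> 0 # prefix n (shift 1 \<omega>)"
    using prefix_add[of 1 n \<omega>] by (simp add: prefix_def)
  ultimately show ?thesis using len_component[OF assms] by (simp add: walk_len_def norm_wp_def)
qed

lemma measurable_shift [measurable]: "shift k \<in> path_measure \<rightarrow>\<^sub>M path_measure"
  unfolding path_measure_eq shift_def[abs_def]
  by (rule measurable_PiM_single') (auto simp: space_PiM PiE_def intro!: measurable_component_singleton)

lemma distr_shift: "distr path_measure path_measure (shift k) = path_measure"
proof -
  have "distr (Pi\<^sub>M UNIV (\<lambda>_. step_measure)) (Pi\<^sub>M UNIV (\<lambda>_. step_measure)) (\<lambda>\<omega>. \<lambda>n\<in>UNIV. \<omega> (n + k))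
      = Pi\<^sub>M UNIV (\<lambda>_. step_measure)"
    by (rule distr_PiM_reindex[where f = "\<lambda>n. n + k" and M = "\<lambda>_. step_measure" and K = UNIV and I = UNIV])
       (auto intro: prob_space_step)
  then show ?thesis by (simp add: path_measure_eq shift_def[abs_def] restrict_def)
qed

lemma integral_shift:
  fixes h :: "(nat \<Rightarrow> 'a) \<Rightarrow> real"
  assumes "h \<in> borel_measurable path_measure"
  shows "(\<integral>\<omega>. h (shift k \<omega>) \<partial>path_measure) = (\<integral>\<omega>. h \<omega> \<partial>path_measure)"
    and "integrable path_measure (\<lambda>\<omega>. h (shift k \<omega>)) \<longleftrightarrow> integrable path_measure h"
proof -
  show "(\<integral>\<omega>. h (shift k \<omega>) \<partial>path_measure) = (\<integral>\<omega>. h \<omega> \<partial>path_measure)"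
    by (subst (2) distr_shift[of k, symmetric]) (rule integral_distr[OF measurable_shift assms, symmetric])
  show "integrable path_measure (\<lambda>\<omega>. h (shift k \<omega>)) \<longleftrightarrow> integrable path_measure h"
    by (subst (2) distr_shift[of k, symmetric]) (rule integrable_distr_eq[OF measurable_shift assms, symmetric])
qed

lemma integrable_walk_len: "integrable path_measure (walk_len n)"
  unfolding walk_len_def[abs_def] integrable_prefix by (rule integrable_norm_wp)

lemma integral_walk_len: "(\<integral>\<omega>. walk_len n \<omega> \<partial>path_measure) = mean_len n"
  unfolding walk_len_def[abs_def] integral_prefix mean_len_def ..

text \<open>A shift-invariant event is independent of every finite prefix of the path.\<close>

lemma integral_walk_len_invariant:
  assumes B: "B \<in> sets path_measure"
    and inv: "\<And>\<omega>. \<omega> \<in> space path_measure \<Longrightarrow> shift n \<omega> \<in> B \<longleftrightarrow> \<omega> \<in> B"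
  shows "(\<integral>\<omega>. walk_len n \<omega> * indicator B \<omega> \<partial>path_measure) = mean_len n * paths.prob B"
proof -
  let ?S = "Pi\<^sub>M (UNIV :: nat set) (\<lambda>_. step_measure)"
  have cn: "(\<lambda>(\<omega>, \<omega>'). comb_seq n \<omega> \<omega>') \<in> ?S \<Otimes>\<^sub>M ?S \<rightarrow>\<^sub>M ?S" by (rule measurable_comb_seq)
  have XS [measurable]: "walk_len n \<in> borel_measurable ?S" using measurable_walk_len unfolding path_measure_eq .
  have BS [measurable]: "B \<in> sets ?S" using B unfolding path_measure_eq .
  have shift_comb: "shift n (comb_seq n \<omega> \<omega>') = \<omega>'" for \<omega> \<omega>' :: "nat \<Rightarrow> 'a"
    by (auto simp: shift_def comb_seq_add)
  have prefix_comb: "prefix n (comb_seq n \<omega> \<omega>') = prefix n \<omega>" for \<omega> \<omega>' :: "nat \<Rightarrow> 'a"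
    by (auto simp: prefix_def comb_seq_less)
  have "(\<integral>\<^sup>+\<omega>. ennreal (walk_len n \<omega>) * indicator B \<omega> \<partial>?S)
      = (\<integral>\<^sup>+\<omega>. ennreal (walk_len n \<omega>) * indicator B \<omega> \<partial>distr (?S \<Otimes>\<^sub>M ?S) ?S (\<lambda>(\<omega>, \<omega>'). comb_seq n \<omega> \<omega>'))"
    unfolding seq.PiM_comb_seq ..
  also have "\<dots> = (\<integral>\<^sup>+p. ennreal (walk_len n (comb_seq n (fst p) (snd p)))
      * indicator B (comb_seq n (fst p) (snd p)) \<partial>(?S \<Otimes>\<^sub>M ?S))"
    by (subst nn_integral_distr[OF cn]) (auto simp: case_prod_unfold)
  also have "\<dots> = (\<integral>\<^sup>+p. ennreal (walk_len n (fst p)) * indicator B (snd p) \<partial>(?S \<Otimes>\<^sub>M ?S))"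
  proof (rule nn_integral_cong)
    fix p assume "p \<in> space (?S \<Otimes>\<^sub>M ?S)"
    then have "comb_seq n (fst p) (snd p) \<in> space path_measure"
      using measurable_space[OF cn] by (auto simp: case_prod_unfold path_measure_eq)
    from inv[OF this] show "ennreal (walk_len n (comb_seq n (fst p) (snd p)))
      * indicator B (comb_seq n (fst p) (snd p)) = ennreal (walk_len n (fst p)) * indicator B (snd p)"
      unfolding shift_comb walk_len_def prefix_comb by (auto simp: indicator_def)
  qed
  also have "\<dots> = (\<integral>\<^sup>+\<omega>. \<integral>\<^sup>+\<omega>'. ennreal (walk_len n \<omega>) * indicator B \<omega>' \<partial>?S \<partial>?S)"
    by (subst seq.P.nn_integral_fst[symmetric]) simp_all
  also have "\<dots> = (\<integral>\<^sup>+\<omega>. ennreal (walk_len n \<omega>) * emeasure ?S B \<partial>?S)"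
    by (simp add: nn_integral_cmult)
  also have "\<dots> = (\<integral>\<^sup>+\<omega>. ennreal (walk_len n \<omega>) \<partial>?S) * emeasure ?S B"
    by (simp add: nn_integral_multc)
  also have "(\<integral>\<^sup>+\<omega>. ennreal (walk_len n \<omega>) \<partial>?S) = ennreal (mean_len n)"
    unfolding path_measure_eq[symmetric] integral_walk_len[symmetric]
    by (rule nn_integral_eq_integral[OF integrable_walk_len]) simp
  finally have nn: "(\<integral>\<^sup>+\<omega>. ennreal (walk_len n \<omega> * indicator B \<omega>) \<partial>path_measure)
      = ennreal (mean_len n * paths.prob B)"
    unfolding path_measure_eq[symmetric]
    by (simp add: paths.emeasure_eq_measure ennreal_mult'' ennreal_indicator)
  have "(\<integral>\<omega>. walk_len n \<omega> * indicator B \<omega> \<partial>path_measure)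
      = enn2real (\<integral>\<^sup>+\<omega>. ennreal (walk_len n \<omega> * indicator B \<omega>) \<partial>path_measure)"
    using B by (intro integral_eq_nn_integral) auto
  also have "\<dots> = mean_len n * paths.prob B"
    unfolding nn by (simp add: mean_len_nonneg)
  finally show ?thesis .
qed

definition good_start :: "real \<Rightarrow> nat \<Rightarrow> (nat \<Rightarrow> 'a) \<Rightarrow> bool" where
  "good_start q K \<omega> \<longleftrightarrow> (\<exists>k\<in>{1..K}. walk_len k \<omega> \<le> q * real k)"

definition bad_cost :: "real \<Rightarrow> nat \<Rightarrow> (nat \<Rightarrow> 'a) \<Rightarrow> real" where
  "bad_cost q K \<omega> = (if good_start q K \<omega> then 0 else walk_len 1 \<omega>)"

lemma measurable_good_start [measurable]: "Measurable.pred path_measure (good_start q K)"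
  unfolding good_start_def[abs_def] by measurable

lemma measurable_bad_cost [measurable]: "bad_cost q K \<in> borel_measurable path_measure"
  unfolding bad_cost_def[abs_def] by measurable

lemma bad_cost_nonneg [simp]: "bad_cost q K \<omega> \<ge> 0"
  by (simp add: bad_cost_def)

lemma shift_shift: "shift i (shift j \<omega>) = shift (i + j) \<omega>"
  by (auto simp: shift_def add.assoc)

text \<open>Greedy covering of the \<open>n\<close> steps: from a good start jump over a block of at
  most \<open>K\<close> steps with average cost at most \<open>q\<close>; from a bad start advance
  one step and pay for it in full. A block can overshoot the end only when at most \<open>K\<close>
  steps remain, and these are paid for by the last sum.\<close>

lemma covering_bound:
  assumes "q \<ge> 0" "\<omega> \<in> space path_measure"
  shows "walk_len n \<omega> \<le> q * real n + (\<Sum>i<n. bad_cost q K (shift i \<omega>))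
      + (\<Sum>i\<in>{n - K..<n}. walk_len 1 (shift i \<omega>))"
  using assms(2)
proof (induction n arbitrary: \<omega> rule: less_induct)
  case (less n)
  let ?R = "\<lambda>n \<omega>. \<Sum>i\<in>{n - K..<n}. walk_len 1 (shift i \<omega>)"
  let ?C = "\<lambda>n \<omega>. \<Sum>i<n. bad_cost q K (shift i \<omega>)"
  have nn: "?R j \<eta> \<ge> 0" "?C j \<eta> \<ge> 0" for j \<eta> by (auto intro!: sum_nonneg)
  have step: "?C k \<omega> + ?C (n - k) (shift k \<omega>) = ?C n \<omega>" if "k \<le> n" for k
  proof -
    have "?C (k + m) \<omega> = ?C k \<omega> + (\<Sum>i<m. bad_cost q K (shift (k + i) \<omega>))" for m
      by (induction m) (auto simp: add.assoc)
    from this[of "n - k"]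
    show ?thesis using that by (simp add: shift_shift add.commute)
  qed
  have tail: "?R (n - k) (shift k \<omega>) \<le> ?R n \<omega>" if "k \<le> n" for k
  proof -
    have "?R (n - k) (shift k \<omega>) = (\<Sum>i\<in>(\<lambda>i. i + k) ` {n - k - K..<n - k}. walk_len 1 (shift i \<omega>))"
      by (subst sum.reindex) (auto simp: shift_shift)
    also have "\<dots> \<le> ?R n \<omega>"
      by (intro sum_mono2) auto
    finally show ?thesis .
  qed
  consider "n = 0" | "n > 0" "\<not> good_start q K \<omega>"
    | k where "1 \<le> k" "k \<le> K" "walk_len k \<omega> \<le> q * real k" "k \<le> n"
    | "n > 0" "n \<le> K"
    unfolding good_start_def by (metis atLeastAtMost_iff le_eq_less_or_eq nat_le_linear neq0_conv order_trans)
  then show ?case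
  proof cases
    case 2
    have "walk_len n \<omega> \<le> walk_len 1 \<omega> + walk_len (n - 1) (shift 1 \<omega>)" using walk_len_add[OF less.prems, of 1 "n - 1"] 2 by simp
    also have "walk_len (n - 1) (shift 1 \<omega>) \<le> q * real (n - 1) + ?C (n - 1) (shift 1 \<omega>) + ?R (n - 1) (shift 1 \<omega>)"
      by (intro less.IH shift_space less.prems) (use 2 in auto)
    also have "walk_len 1 \<omega> = ?C 1 \<omega>" using 2 by (simp add: bad_cost_def shift_def)
    finally show ?thesis
      using step[of 1] tail[of 1] 2 assms mult_left_mono[of "real (n - 1)" "real n" q] by simp
  next
    case (3 k)
    have "walk_len n \<omega> \<le> walk_len k \<omega> + walk_len (n - k) (shift k \<omega>)" using walk_len_add[OF less.prems, of k "n - k"] 3 by simp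
    also have "walk_len (n - k) (shift k \<omega>) \<le> q * real (n - k) + ?C (n - k) (shift k \<omega>) + ?R (n - k) (shift k \<omega>)"
      by (intro less.IH shift_space less.prems) (use 3 in auto)
    also have "walk_len k \<omega> \<le> q * real k" by fact
    finally have "walk_len n \<omega> \<le> q * real n + ?C (n - k) (shift k \<omega>) + ?R (n - k) (shift k \<omega>)"
      using 3 by (simp add: of_nat_diff algebra_simps)
    then show ?thesis using step[OF 3(4)] tail[OF 3(4)] nn(2)[of \<omega> k] by simp
  next
    \<comment> \<open>Here \<open>n - K = 0\<close>, so the last sum runs over all remaining
      steps.\<close>
    case 4
    then have "walk_len n \<omega> \<le> ?R n \<omega>" using walk_len_sum[OF less.prems, of n] by (simp add: atLeast0LessThan)
    moreover have "0 \<le> q * real n" using assms by simp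
    ultimately show ?thesis using nn(2)[of \<omega> n] by linarith
  qed simp
qed

end

text \<open>A bounded change and a shift of the index do not affect whether the lower limit of x n /
  n is at most q. The slack \<open>h = 1 / (k + 1)\<close> is split: the index
  \<open>2 * k + 1\<close> leaves \<open>h / 2\<close>, and the other half, multiplied by a large n,
  absorbs the constants.\<close>

lemma frequently_below_shift:
  fixes x y :: "nat \<Rightarrow> real"
  assumes x: "\<And>k m. \<exists>n\<ge>m. x n < (q + 1 / (real k + 1)) * real n"
    and "\<And>n. y n \<le> x (Suc n) + c"
  shows "\<exists>n\<ge>m. y n < (q + 1 / (real k + 1)) * real n"
proof -
  define h where "h = 1 / (real k + 1)"
  have h: "h > 0" by (simp add: h_def)
  obtain N :: nat where N: "real N > (q + h / 2 + c) / (h / 2)" using reals_Archimedean2 by blast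
  obtain n where n: "n \<ge> Suc (max m N)" "x n < (q + 1 / (real (2 * k + 1) + 1)) * real n"
    using x by blast
  then obtain n' where n': "n = Suc n'" "n' \<ge> m" "n' \<ge> N" by (cases n) auto
  have "real n' > (q + h / 2 + c) / (h / 2)" using N n' by linarith
  then have a: "q + h / 2 + c < h / 2 * real n'" using h by (simp add: field_simps)
  have "1 / (real (2 * k + 1) + 1) = h / 2" by (simp add: h_def field_simps)
  with n n' have "x (Suc n') < (q + h / 2) * real (Suc n')" by metis
  then have "x (Suc n') < (q + h / 2) * (real n' + 1)" by (simp add: add.commute)
  then have "y n' < (q + h / 2) * (real n' + 1) + c" using assms(2)[of n'] by linarith
  also have "\<dots> = (q + h / 2) * real n' + (q + h / 2 + c)" by (simp add: algebra_simps)
  also have "\<dots> < (q + h / 2) * real n' + h / 2 * real n'" using a by simp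
  also have "\<dots> = (q + h) * real n'" by (simp add: algebra_simps)
  finally show ?thesis using n' unfolding h_def by blast
qed

lemma frequently_below_unshift:
  fixes x y :: "nat \<Rightarrow> real"
  assumes y: "\<And>k m. \<exists>n\<ge>m. y n < (q + 1 / (real k + 1)) * real n"
    and "\<And>n. x (Suc n) \<le> y n + c" and "q \<ge> 0"
  shows "\<exists>n\<ge>m. x n < (q + 1 / (real k + 1)) * real n"
proof -
  define h where "h = 1 / (real k + 1)"
  have h: "h > 0" by (simp add: h_def)
  obtain N :: nat where N: "real N > c / (h / 2)" using reals_Archimedean2 by blast
  obtain n where n: "n \<ge> max m N" "y n < (q + 1 / (real (2 * k + 1) + 1)) * real n"
    using y by blast
  have "real n > c / (h / 2)" using N n by simp
  then have a: "c < h / 2 * real n" using h by (simp add: field_simps)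
  have "1 / (real (2 * k + 1) + 1) = h / 2" by (simp add: h_def field_simps)
  with n have "y n < (q + h / 2) * real n" by metis
  then have "x (Suc n) < (q + h / 2) * real n + c" using assms(2)[of n] by linarith
  also have "\<dots> \<le> (q + h) * real n" using a by (simp add: algebra_simps)
  also have "\<dots> \<le> (q + h) * real (Suc n)" using assms(3) h by (intro mult_left_mono) auto
  finally show ?thesis using n unfolding h_def by (intro exI[of _ "Suc n"]) auto
qed

section \<open>Lower bound for the speed\<close>

context random_walk
begin

text \<open>The event that the lower limit of \<open>walk_len n \<omega> / n\<close> is at most
  \<open>q\<close>, written with countable quantifiers so that measurability is immediate.\<close>

definition low_event :: "real \<Rightarrow> (nat \<Rightarrow> 'a) set" where
  "low_event q = {\<omega> \<in> space path_measure. \<forall>k m. \<exists>n\<ge>m. walk_len n \<omega> < (q + 1 / (real k + 1)) * real n}"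

lemma sets_low_event [measurable]: "low_event q \<in> sets path_measure"
  unfolding low_event_def by measurable

lemma low_event_shift:
  assumes "q \<ge> 0" "\<omega> \<in> space path_measure"
  shows "shift n \<omega> \<in> low_event q \<longleftrightarrow> \<omega> \<in> low_event q"
proof -
  have one: "shift 1 \<omega> \<in> low_event q \<longleftrightarrow> \<omega> \<in> low_event q" if w: "\<omega> \<in> space path_measure" for \<omega>
  proof
    assume "shift 1 \<omega> \<in> low_event q"
    then have "\<And>k m. \<exists>n\<ge>m. walk_len n (shift 1 \<omega>) < (q + 1 / (real k + 1)) * real n"
      by (auto simp: low_event_def)
    from frequently_below_unshift[of "\<lambda>n. walk_len n (shift 1 \<omega>)" q "\<lambda>n. walk_len n \<omega>" "walk_len 1 \<omega>", OF this]
    show "\<omega> \<in> low_event q"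
      using walk_len_add[OF w, of 1] assms(1) w by (simp add: low_event_def add.commute)
  next
    assume "\<omega> \<in> low_event q"
    then have "\<And>k m. \<exists>n\<ge>m. walk_len n \<omega> < (q + 1 / (real k + 1)) * real n"
      by (auto simp: low_event_def)
    from frequently_below_shift[of "\<lambda>n. walk_len n \<omega>" q "\<lambda>n. walk_len n (shift 1 \<omega>)" "walk_len 1 \<omega>", OF this]
    show "shift 1 \<omega> \<in> low_event q"
      using walk_len_shift[OF w] shift_space[OF w] by (simp add: low_event_def)
  qed
  show ?thesis
  proof (induction n)
    case 0
    then show ?case by (simp add: shift_def)
  next
    case (Suc n)
    then show ?case
      using one[OF shift_space[OF assms(2), of n]] by (simp add: shift_shift)
  qed
qed

text \<open>The covering argument of Katznelson and Weiss, carried out on the invariant event.\<close>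

lemma prob_low_event:
  assumes q: "0 \<le> q" "q < rate"
  shows "paths.prob (low_event q) = 0"
proof (rule ccontr)
  let ?B = "low_event q"
  let ?b = "paths.prob ?B"
  let ?M = path_measure
  assume "?b \<noteq> 0"
  then have b: "?b > 0" using measure_nonneg[of ?M ?B] by linarith
  \<comment> \<open>There is room on both sides: \<open>q'\<close> exceeds \<open>q\<close>, so that
    a path of the event has a cheap block once \<open>K\<close> is large; it stays below
    \<open>rate\<close>, so that covering by such blocks contradicts
    \<open>rate * real n \<le> mean_len n\<close>.\<close>
  define q' where "q' = (q + rate) / 2"
  have q': "q < q'" "q' < rate" "0 \<le> q'" using q by (auto simp: q'_def)
  define g where "g K = (\<integral>\<omega>. bad_cost q' K \<omega> * indicator ?B \<omega> \<partial>?M)" for K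
  have int1: "integrable ?M (\<lambda>\<omega>. walk_len 1 \<omega>)" using integrable_walk_len .
  have intb: "integrable ?M (\<lambda>\<omega>. bad_cost q' K \<omega> * indicator ?B \<omega>)" for K
    by (rule Bochner_Integration.integrable_bound[OF int1])
       (auto simp: bad_cost_def indicator_def)
  have main: "(rate - q') * ?b \<le> g K + real K * mean_len 1 / real n" if n: "n \<ge> 1" for K n
  proof -
    let ?h = "\<lambda>\<omega>. bad_cost q' K \<omega> * indicator ?B \<omega>"
    have hm: "?h \<in> borel_measurable ?M" by measurable
    have i1: "integrable ?M (\<lambda>\<omega>. ?h (shift i \<omega>))" for i
      using integral_shift(2)[OF hm, of i] intb by simp
    have i2: "integrable ?M (\<lambda>\<omega>. walk_len 1 (shift i \<omega>))" for i
      using integral_shift(2)[OF measurable_walk_len, of 1 i] int1 by simp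
    have "mean_len n * ?b = (\<integral>\<omega>. walk_len n \<omega> * indicator ?B \<omega> \<partial>?M)"
      by (rule integral_walk_len_invariant[symmetric]) (auto simp: low_event_shift q)
    also have "\<dots> \<le> (\<integral>\<omega>. q' * real n * indicator ?B \<omega> + (\<Sum>i<n. ?h (shift i \<omega>))
        + (\<Sum>i\<in>{n - K..<n}. walk_len 1 (shift i \<omega>)) \<partial>?M)"
    proof (rule integral_mono)
      show "integrable ?M (\<lambda>\<omega>. walk_len n \<omega> * indicator ?B \<omega>)"
        by (rule Bochner_Integration.integrable_bound[OF integrable_walk_len[of n]]) (auto simp: indicator_def)
      show "integrable ?M (\<lambda>\<omega>. q' * real n * indicator ?B \<omega> + (\<Sum>i<n. ?h (shift i \<omega>))
        + (\<Sum>i\<in>{n - K..<n}. walk_len 1 (shift i \<omega>)))"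
        by (intro Bochner_Integration.integrable_add Bochner_Integration.integrable_sum i1 i2
              integrable_mult_right integrable_real_indicator)
           (auto simp: paths.emeasure_eq_measure)
      fix \<omega> assume w: "\<omega> \<in> space ?M"
      show "walk_len n \<omega> * indicator ?B \<omega> \<le> q' * real n * indicator ?B \<omega> + (\<Sum>i<n. ?h (shift i \<omega>))
        + (\<Sum>i\<in>{n - K..<n}. walk_len 1 (shift i \<omega>))"
      proof (cases "\<omega> \<in> ?B")
        case True
        then have "shift i \<omega> \<in> ?B" for i using low_event_shift[OF q(1) w] by simp
        then show ?thesis using covering_bound[OF q'(3) w, of n K] True by simp
      next
        case False
        have "0 \<le> (\<Sum>i<n. ?h (shift i \<omega>))" "0 \<le> (\<Sum>i\<in>{n - K..<n}. walk_len 1 (shift i \<omega>))"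
          by (auto intro!: sum_nonneg)
        then show ?thesis using False by simp
      qed
    qed
    also have "\<dots> = q' * real n * ?b + (\<Sum>i<n. \<integral>\<omega>. ?h (shift i \<omega>) \<partial>?M)
        + (\<Sum>i\<in>{n - K..<n}. \<integral>\<omega>. walk_len 1 (shift i \<omega>) \<partial>?M)"
    proof -
      have "integrable ?M (\<lambda>\<omega>. q' * real n * indicator ?B \<omega>)"
        by (intro integrable_mult_right integrable_real_indicator) (auto simp: paths.emeasure_eq_measure)
      then show ?thesis using i1 i2
        by (subst Bochner_Integration.integral_add Bochner_Integration.integral_sum integral_mult_right_zero
              | intro Bochner_Integration.integrable_add Bochner_Integration.integrable_sum
              | simp)+
    qed
    also have "\<dots> = q' * real n * ?b + real n * g K + real (card {n - K..<n}) * mean_len 1"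
      using integral_shift(1)[OF hm] integral_shift(1)[OF measurable_walk_len, of 1]
      by (simp add: g_def integral_walk_len[unfolded One_nat_def] integral_walk_len)
    also have "\<dots> \<le> q' * real n * ?b + real n * g K + real K * mean_len 1"
      using mean_len_nonneg[of 1] by (intro add_left_mono mult_right_mono) auto
    finally have "mean_len n * ?b \<le> q' * real n * ?b + real n * g K + real K * mean_len 1" .
    moreover have "rate * real n * ?b \<le> mean_len n * ?b"
      using rate_mult_le b by (intro mult_right_mono) auto
    ultimately have "real n * ((rate - q') * ?b) \<le> real n * g K + real K * mean_len 1"
      by (simp add: algebra_simps)
    then show ?thesis using n by (simp add: field_simps)
  qed
  have step: "(rate - q') * ?b \<le> g K" for K
  proof (rule field_le_epsilon)
    fix e :: real assume e: "e > 0"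
    obtain n :: nat where n: "real n > real K * mean_len 1 / e" using reals_Archimedean2 by blast
    have "real (Suc n) > real K * mean_len 1 / e" using n by simp
    then have "real K * mean_len 1 / real (Suc n) < e" using e by (simp add: field_simps)
    then show "(rate - q') * ?b \<le> g K + e" using main[of "Suc n" K] by linarith
  qed
  \<comment> \<open>For fixed \<open>K\<close>, letting \<open>n\<close> grow has removed the
    contribution of the last \<open>K\<close> steps. Now \<open>K\<close> grows: each path of the
    event eventually has a good start, and its bad cost vanishes.\<close>
  have "(\<lambda>K. g K) \<longlonglongrightarrow> (\<integral>\<omega>. 0 \<partial>?M)"
    unfolding g_def
  proof (rule integral_dominated_convergence[where w = "walk_len 1"])
    show "AE \<omega> in ?M. (\<lambda>K. bad_cost q' K \<omega> * indicator ?B \<omega>) \<longlonglongrightarrow> 0"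
    proof (rule AE_I2)
      fix \<omega> assume w: "\<omega> \<in> space ?M"
      show "(\<lambda>K. bad_cost q' K \<omega> * indicator ?B \<omega>) \<longlonglongrightarrow> 0"
      proof (cases "\<omega> \<in> ?B")
        case True
        obtain k :: nat where k: "real k > 1 / (q' - q)" using reals_Archimedean2 by blast
        then have "real k + 1 > 1 / (q' - q)" by linarith
        then have "1 / (real k + 1) < q' - q" using q' by (simp add: field_simps)
        moreover obtain n where n: "n \<ge> 1" "walk_len n \<omega> < (q + 1 / (real k + 1)) * real n"
          using True unfolding low_event_def by blast
        ultimately have "walk_len n \<omega> \<le> q' * real n"
          using mult_right_mono[of "q + 1 / (real k + 1)" q' "real n"] by linarith
        then have "good_start q' K \<omega>" if "K \<ge> n" for K
          using n that by (auto simp: good_start_def)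
        then have "eventually (\<lambda>K. bad_cost q' K \<omega> * indicator ?B \<omega> = 0) sequentially"
          by (intro eventually_sequentiallyI[of n]) (simp add: bad_cost_def)
        then show ?thesis by (rule tendsto_eventually)
      qed simp
    qed
  qed (use int1 in \<open>auto simp: bad_cost_def indicator_def\<close>)
  then have "(\<lambda>K. g K) \<longlonglongrightarrow> 0" by simp
  then have "(rate - q') * ?b \<le> 0"
    using step by (intro LIMSEQ_le_const) auto
  then show False using b q' by (simp add: mult_le_0_iff)
qed

lemma AE_rate_lower:
  assumes "q < rate"
  shows "AE \<omega> in path_measure. \<forall>\<^sub>F n in sequentially. q * real n \<le> walk_len n \<omega>"
proof (cases "q \<ge> 0")
  case True
  have "AE \<omega> in path_measure. \<omega> \<notin> low_event q"
    using prob_low_event[OF True assms]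
    by (subst AE_iff_measurable[OF sets_low_event[of q]])
       (auto simp: paths.emeasure_eq_measure low_event_def)
  then show ?thesis
  proof (rule AE_mp[OF _ AE_I2], intro impI)
    fix \<omega> assume "\<omega> \<in> space path_measure" "\<omega> \<notin> low_event q"
    then obtain k m where km: "\<And>n. n \<ge> m \<Longrightarrow> walk_len n \<omega> \<ge> (q + 1 / (real k + 1)) * real n"
      by (fastforce simp: low_event_def not_less)
    have "q * real n \<le> (q + 1 / (real k + 1)) * real n" for n
      by (intro mult_right_mono) auto
    then show "\<forall>\<^sub>F n in sequentially. q * real n \<le> walk_len n \<omega>"
      using km by (intro eventually_sequentiallyI[of m]) (meson order_trans)
  qed
next
  case False
  then show ?thesis by (auto intro!: AE_I2 always_eventually order_trans[OF mult_nonpos_nonneg])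
qed

end

section \<open>Upper bound for the speed and convergence to the rate\<close>

lemma integrable_minus_power:
  fixes f :: "'a \<Rightarrow> real"
  assumes "integrable (measure_pmf p) (\<lambda>x. f x ^ 4)"
  shows "integrable (measure_pmf p) (\<lambda>x. (f x - c) ^ 4)"
proof -
  have "integrable (measure_pmf p) (\<lambda>x. (f x + - c) ^ 4)"
    unfolding binomial_ring
    by (intro Bochner_Integration.integrable_sum integrable_mult_right integrable_mult_left
          integrable_lower_power[OF assms]) simp_all
  then show ?thesis by simp
qed

lemma integrable_bounded_power:
  fixes f g :: "'a \<Rightarrow> real"
  assumes "integrable (measure_pmf p) (\<lambda>x. g x ^ 4)"
    and "\<And>x. x \<in> set_pmf p \<Longrightarrow> \<bar>f x\<bar> \<le> c * g x"
  shows "integrable (measure_pmf p) (\<lambda>x. f x ^ 4)"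
proof (rule Bochner_Integration.integrable_bound)
  show "integrable (measure_pmf p) (\<lambda>x. c ^ 4 * g x ^ 4)" using assms(1) by simp
  show "AE x in measure_pmf p. norm (f x ^ 4) \<le> norm (c ^ 4 * g x ^ 4)"
  proof (rule AE_pmfI)
    fix x assume "x \<in> set_pmf p"
    then have "\<bar>f x\<bar> ^ 4 \<le> (c * g x) ^ 4" using assms(2) by (intro power_mono) auto
    then show "norm (f x ^ 4) \<le> norm (c ^ 4 * g x ^ 4)" by (simp add: power_mult_distrib power_abs)
  qed
qed simp

lemma pmf_Markov_fourth:
  fixes f :: "'a \<Rightarrow> real"
  assumes "integrable (measure_pmf p) (\<lambda>x. f x ^ 4)" "c > 0"
  shows "measure_pmf.prob p {x. f x \<ge> c} \<le> measure_pmf.expectation p (\<lambda>x. f x ^ 4) / c ^ 4"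
proof -
  have "measure_pmf.prob p {x. f x \<ge> c} \<le> measure_pmf.prob p {x. f x ^ 4 \<ge> c ^ 4}"
    using assms(2) by (intro measure_pmf.finite_measure_mono) (auto intro: power_mono)
  also have "\<dots> \<le> measure_pmf.expectation p (\<lambda>x. f x ^ 4) / c ^ 4"
    using assms by (intro pmf_Markov) auto
  finally show ?thesis .
qed

lemma prob_pair_Un_le:
  "measure_pmf.prob (pair_pmf p q) {x. fst x \<in> A \<or> snd x \<in> B}
    \<le> measure_pmf.prob p A + measure_pmf.prob q B"
proof -
  have "measure_pmf.prob (pair_pmf p q) {x. fst x \<in> A \<or> snd x \<in> B}
      \<le> measure_pmf.prob (pair_pmf p q) {x. fst x \<in> A} + measure_pmf.prob (pair_pmf p q) {x. snd x \<in> B}"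
    unfolding Collect_disj_eq by (rule measure_Un_le) auto
  also have "measure_pmf.prob (pair_pmf p q) {x. fst x \<in> A} = measure_pmf.prob (map_pmf fst (pair_pmf p q)) A"
    by (simp add: vimage_def)
  also have "measure_pmf.prob (pair_pmf p q) {x. snd x \<in> B} = measure_pmf.prob (map_pmf snd (pair_pmf p q)) B"
    by (simp add: vimage_def)
  finally show ?thesis by (simp add: map_fst_pair_pmf map_snd_pair_pmf)
qed

context random_walk
begin

text \<open>By subadditivity the length is at most a sum of independent lengths of blocks of
  \<open>m\<close> steps plus a remainder. The centred block sum has fourth moment of order n^2
  against a threshold of order n, so the bound is 1/n^2, summable for Borel-Cantelli; a variance
  bound would give only 1/n.\<close>

lemma prob_norm_wp_large:
  assumes m: "m \<ge> 1" and e: "e > 0"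
  obtains C where "\<And>n. n \<ge> 1 \<Longrightarrow> measure_pmf.prob (replicate_pmf n \<mu>)
    {xs. norm_wp xs \<ge> (mean_len m / real m + e) * real n} \<le> C / real n ^ 2"
proof -
  let ?P = "\<lambda>n. replicate_pmf n \<mu>"
  define f where "f xs = norm_wp xs - mean_len m" for xs
  define m4 where "m4 = measure_pmf.expectation (?P m) (\<lambda>xs. f xs ^ 4)"
  define Q where "Q = (\<Sum>r<m. measure_pmf.expectation (?P r) (\<lambda>xs. norm_wp xs ^ 4))"
  have f4: "integrable (measure_pmf (?P m)) (\<lambda>xs. f xs ^ 4)"
    unfolding f_def by (intro integrable_minus_power integrable_norm_wp_power) simp
  have f0: "measure_pmf.expectation (?P m) f = 0"
    unfolding f_def using integrable_norm_wp by (simp add: mean_len_def)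
  have m4: "m4 \<ge> 0" by (simp add: m4_def)
  have Qr: "measure_pmf.expectation (?P r) (\<lambda>xs. norm_wp xs ^ 4) \<le> Q" if "r < m" for r
    unfolding Q_def using that
    by (intro member_le_sum[where f = "\<lambda>r. measure_pmf.expectation (?P r) (\<lambda>xs. norm_wp xs ^ 4)"]) auto
  have Q: "Q \<ge> 0" unfolding Q_def by (intro sum_nonneg) simp
  show thesis
  proof (rule that)
    fix n :: nat assume n: "n \<ge> 1"
    define J r where "J = n div m" and "r = n mod m"
    have nJ: "n = J * m + r" and r: "r < m" using m by (auto simp: J_def r_def)
    have Jn: "J \<le> n" unfolding J_def by simp
    have Jm: "real J * mean_len m \<le> mean_len m / real m * real n"
    proof -
      have "real (J * m) \<le> real n" using nJ by (intro of_nat_mono) simp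
      then have "real J \<le> real n / real m" using m by (simp add: field_simps)
      then have "real J * mean_len m \<le> real n / real m * mean_len m"
        using mean_len_nonneg by (intro mult_right_mono)
      then show ?thesis by (simp add: field_simps)
    qed
    \<comment> \<open>The excess \<open>e * real n\<close> is shared equally by the centred block
      sum and the remainder.\<close>
    define c where "c = e * real n / 2"
    have c: "c > 0" using e n by (simp add: c_def)
    let ?A = "{xss. sum_list (map f xss) \<ge> c}"
    let ?B = "{ys. norm_wp ys \<ge> c}"
    let ?J = "replicate_pmf J (?P m)"
    have "?P n = map_pmf (\<lambda>(xs, ys). xs @ ys) (pair_pmf (map_pmf concat ?J) (map_pmf id (?P r)))"
      unfolding concat_replicate_pmf pmf.map_id by (subst nJ) (rule replicate_pmf_add)
    also have "\<dots> = map_pmf (\<lambda>x. concat (fst x) @ snd x) (pair_pmf ?J (?P r))"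
      unfolding map_pair[symmetric] by (simp add: pmf.map_comp o_def case_prod_unfold)
    finally have "measure_pmf.prob (?P n) {xs. norm_wp xs \<ge> (mean_len m / real m + e) * real n}
      = measure_pmf.prob (pair_pmf ?J (?P r))
          {x. norm_wp (concat (fst x) @ snd x) \<ge> (mean_len m / real m + e) * real n}"
      by (simp add: vimage_def)
    also have "\<dots> \<le> measure_pmf.prob (pair_pmf ?J (?P r)) {x. fst x \<in> ?A \<or> snd x \<in> ?B}"
    proof (rule measure_pmf.finite_measure_mono_AE)
      show "AE x in pair_pmf ?J (?P r).
          x \<in> {x. norm_wp (concat (fst x) @ snd x) \<ge> (mean_len m / real m + e) * real n}
          \<longrightarrow> x \<in> {x. fst x \<in> ?A \<or> snd x \<in> ?B}"
      proof (intro AE_pmfI impI)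
        fix x assume x: "x \<in> set_pmf (pair_pmf ?J (?P r))"
          and big: "x \<in> {x. norm_wp (concat (fst x) @ snd x) \<ge> (mean_len m / real m + e) * real n}"
        obtain xss ys where xy: "x = (xss, ys)" by (cases x)
        have xin: "xss \<in> set_pmf ?J" and yin: "ys \<in> set_pmf (?P r)" using x xy by auto
        have xss: "length xss = J" "\<And>xs. xs \<in> set xss \<Longrightarrow> set xs \<subseteq> carrier G"
          using length_replicate_pmf[OF xin] set_replicate_pmf_subset[OF xin] support_replicate by blast+
        have ys: "set ys \<subseteq> carrier G" using yin by (rule support_replicate)
        have "norm_wp (concat xss @ ys) \<le> norm_wp (concat xss) + norm_wp ys"
          using xss ys by (intro norm_wp_append) auto
        also have "norm_wp (concat xss) \<le> sum_list (map norm_wp xss)"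
          using xss by (intro norm_wp_concat) auto
        also have "sum_list (map norm_wp xss) = sum_list (map f xss) + real J * mean_len m"
          unfolding xss(1)[symmetric] f_def by (induction xss) (auto simp: algebra_simps)
        finally have "(mean_len m / real m + e) * real n
            \<le> sum_list (map f xss) + real J * mean_len m + norm_wp ys"
          using big xy by simp
        then have "2 * c \<le> sum_list (map f xss) + norm_wp ys"
          using Jm by (simp add: c_def algebra_simps)
        then show "x \<in> {x. fst x \<in> ?A \<or> snd x \<in> ?B}" using xy by auto
      qed
    qed auto
    also have "\<dots> \<le> measure_pmf.prob ?J ?A + measure_pmf.prob (?P r) ?B"
      by (rule prob_pair_Un_le)
    also have "measure_pmf.prob ?J ?A
        \<le> measure_pmf.expectation ?J (\<lambda>xss. sum_list (map f xss) ^ 4) / c ^ 4"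
      using c by (intro pmf_Markov_fourth integrable_sum_list_power f4) auto
    also have "\<dots> \<le> 4 * real n ^ 2 * m4 / c ^ 4"
    proof (rule divide_right_mono)
      have "measure_pmf.expectation ?J (\<lambda>xss. sum_list (map f xss) ^ 4) \<le> 4 * real J ^ 2 * m4"
        using sum_list_moments[OF f4 f0, of J] unfolding m4_def by simp
      also have "\<dots> \<le> 4 * real n ^ 2 * m4"
        using Jn m4 by (intro mult_right_mono mult_left_mono power_mono) auto
      finally show "measure_pmf.expectation ?J (\<lambda>xss. sum_list (map f xss) ^ 4) \<le> 4 * real n ^ 2 * m4" .
    qed (use c in simp)
    also have "measure_pmf.prob (?P r) ?B \<le> measure_pmf.expectation (?P r) (\<lambda>xs. norm_wp xs ^ 4) / c ^ 4"
      using c by (intro pmf_Markov_fourth integrable_norm_wp_power) auto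
    also have "\<dots> \<le> real n ^ 2 * Q / c ^ 4"
    proof (rule divide_right_mono)
      have "1 * Q \<le> real n ^ 2 * Q" using Q n by (intro mult_right_mono) auto
      then show "measure_pmf.expectation (?P r) (\<lambda>xs. norm_wp xs ^ 4) \<le> real n ^ 2 * Q"
        using Qr[OF r] by simp
    qed (use c in simp)
    finally have le: "measure_pmf.prob (?P n) {xs. norm_wp xs \<ge> (mean_len m / real m + e) * real n}
        \<le> 4 * real n ^ 2 * m4 / c ^ 4 + real n ^ 2 * Q / c ^ 4" by simp
    have c4: "c ^ 4 = e ^ 4 / 16 * (real n ^ 2 * real n ^ 2)"
      by (simp add: c_def power_divide power_mult_distrib flip: power_add)
    have "4 * real n ^ 2 * m4 / c ^ 4 + real n ^ 2 * Q / c ^ 4 = (64 * m4 + 16 * Q) / e ^ 4 / real n ^ 2"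
      unfolding c4 using e n by (simp add: divide_simps) (simp add: algebra_simps)
    with le show "measure_pmf.prob (?P n) {xs. norm_wp xs \<ge> (mean_len m / real m + e) * real n}
        \<le> (64 * m4 + 16 * Q) / e ^ 4 / real n ^ 2" by simp
  qed
qed

lemma AE_rate_upper:
  assumes "m \<ge> 1" "e > 0"
  shows "AE \<omega> in path_measure. \<forall>\<^sub>F n in sequentially. walk_len n \<omega> < (mean_len m / real m + e) * real n"
proof -
  obtain C where C: "\<And>n. n \<ge> 1 \<Longrightarrow> measure_pmf.prob (replicate_pmf n \<mu>)
      {xs. norm_wp xs \<ge> (mean_len m / real m + e) * real n} \<le> C / real n ^ 2"
    using prob_norm_wp_large[OF assms] by metis
  define A where "A n = {\<omega> \<in> space path_measure. walk_len n \<omega> \<ge> (mean_len m / real m + e) * real n}" for n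
  have A: "A n \<in> sets path_measure" for n unfolding A_def by measurable
  have "paths.prob (A n) = measure_pmf.prob (replicate_pmf n \<mu>) {xs. norm_wp xs \<ge> (mean_len m / real m + e) * real n}" for n
    unfolding A_def walk_len_def prob_prefix[symmetric] by simp
  then have bnd: "norm (paths.prob (A n)) \<le> C / real n ^ 2" if "n \<ge> 1" for n
    using C[OF that] by simp
  have "summable (\<lambda>n. paths.prob (A n))"
  proof (rule summable_comparison_test')
    show "summable (\<lambda>n. C / real n ^ 2)"
      using summable_mult[OF inverse_power_summable[of 2, where ?'a = real], of C]
      by (simp add: divide_inverse power_inverse)
    show "norm (paths.prob (A n)) \<le> C / real n ^ 2" if "n \<ge> 1" for n by (rule bnd[OF that])
  qed
  then have "AE \<omega> in path_measure. eventually (\<lambda>n. \<omega> \<in> space path_measure - A n) sequentially"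
    by (intro borel_cantelli_AE1 A) (auto simp: paths.emeasure_eq_measure)
  then show ?thesis
    by (rule AE_mp[OF _ AE_I2]) (auto elim!: eventually_mono simp: A_def not_le)
qed

theorem AE_rate: "AE \<omega> in path_measure. (\<lambda>n. walk_len n \<omega> / real n) \<longlonglongrightarrow> rate"
proof -
  have "AE \<omega> in path_measure. \<forall>l::nat. \<forall>\<^sub>F n in sequentially. (rate - 1 / (real l + 1)) * real n \<le> walk_len n \<omega>"
    by (subst AE_all_countable) (auto intro!: AE_rate_lower)
  moreover have "AE \<omega> in path_measure. \<forall>m::nat. \<forall>l::nat. m \<ge> 1 \<longrightarrow>
      (\<forall>\<^sub>F n in sequentially. walk_len n \<omega> < (mean_len m / real m + 1 / (real l + 1)) * real n)"
    unfolding AE_all_countable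
  proof (intro allI)
    fix m l :: nat
    show "AE \<omega> in path_measure. m \<ge> 1 \<longrightarrow>
      (\<forall>\<^sub>F n in sequentially. walk_len n \<omega> < (mean_len m / real m + 1 / (real l + 1)) * real n)"
      by (cases "m \<ge> 1") (use AE_rate_upper[of m "1 / (real l + 1)"] in auto)
  qed
  ultimately show ?thesis
  proof eventually_elim
    case (elim \<omega>)
    show ?case
    proof (rule tendstoI)
      fix e :: real assume e: "e > 0"
      obtain m where m: "m \<ge> 1" "mean_len m / real m < rate + e / 2"
        using rate_approx[of "e / 2"] e by auto
      obtain l :: nat where "real l > 2 / e" using reals_Archimedean2 by blast
      then have "real l + 1 > 2 / e" by linarith
      then have l: "1 / (real l + 1) < e / 2" using e by (simp add: field_simps)
      have "\<forall>\<^sub>F n in sequentially. (rate - 1 / (real l + 1)) * real n \<le> walk_len n \<omega>" using elim by blast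
      moreover have "\<forall>\<^sub>F n in sequentially. walk_len n \<omega> < (mean_len m / real m + 1 / (real l + 1)) * real n"
        using elim m by blast
      ultimately show "\<forall>\<^sub>F n in sequentially. dist (walk_len n \<omega> / real n) rate < e"
        using eventually_gt_at_top[of 0]
      proof eventually_elim
        case (elim n)
        then have "rate - 1 / (real l + 1) \<le> walk_len n \<omega> / real n"
          "walk_len n \<omega> / real n < mean_len m / real m + 1 / (real l + 1)"
          by (simp_all add: pos_le_divide_eq pos_divide_less_eq)
        then show ?case using l m unfolding dist_real_def by linarith
      qed
    qed
  qed
qed

text \<open>Scheffe's argument: the absolute value of \<open>x - rate\<close> is
  \<open>x - rate\<close> plus twice the negative part. The negative part is at most
  \<open>rate\<close>, so dominated convergence applies to it, and the mean of the rest tends to 0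
  by \<open>mean_len_tendsto\<close>.\<close>

theorem L1_rate: "(\<lambda>n. \<integral>\<omega>. \<bar>walk_len n \<omega> / real n - rate\<bar> \<partial>path_measure) \<longlonglongrightarrow> 0"
proof -
  define h where "h n \<omega> = max 0 (rate - walk_len n \<omega> / real n)" for n \<omega>
  have hm [measurable]: "h n \<in> borel_measurable path_measure" for n
    unfolding h_def[abs_def] by measurable
  have "(\<lambda>n. \<integral>\<omega>. h n \<omega> \<partial>path_measure) \<longlonglongrightarrow> (\<integral>\<omega>. 0 \<partial>path_measure)"
  proof (rule integral_dominated_convergence[where w = "\<lambda>_. rate"])
    show "AE \<omega> in path_measure. (\<lambda>n. h n \<omega>) \<longlonglongrightarrow> 0"
      using AE_rate
    proof eventually_elim
      case (elim \<omega>)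
      have "(\<lambda>n. max 0 (rate - walk_len n \<omega> / real n)) \<longlonglongrightarrow> max 0 (rate - rate)"
        by (intro tendsto_intros elim)
      then show ?case by (simp add: h_def)
    qed
    show "AE \<omega> in path_measure. norm (h n \<omega>) \<le> rate" for n
      by (rule AE_I2) (auto simp: h_def rate_nonneg)
  qed simp_all
  then have h0: "(\<lambda>n. \<integral>\<omega>. h n \<omega> \<partial>path_measure) \<longlonglongrightarrow> 0" by simp
  have eq: "(\<integral>\<omega>. \<bar>walk_len n \<omega> / real n - rate\<bar> \<partial>path_measure)
      = mean_len n / real n - rate + 2 * (\<integral>\<omega>. h n \<omega> \<partial>path_measure)" for n
  proof -
    have ih: "integrable path_measure (h n)"
      by (rule paths.integrable_const_bound[where B = rate, OF AE_I2 hm]) (auto simp: h_def rate_nonneg)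
    have iw: "integrable path_measure (\<lambda>\<omega>. walk_len n \<omega> / real n)"
      using integrable_walk_len by simp
    have "(\<integral>\<omega>. \<bar>walk_len n \<omega> / real n - rate\<bar> \<partial>path_measure)
        = (\<integral>\<omega>. (walk_len n \<omega> / real n - rate) + 2 * h n \<omega> \<partial>path_measure)"
      by (intro Bochner_Integration.integral_cong) (simp_all add: h_def max_def abs_if)
    also have "\<dots> = (\<integral>\<omega>. walk_len n \<omega> / real n - rate \<partial>path_measure) + (\<integral>\<omega>. 2 * h n \<omega> \<partial>path_measure)"
      using ih iw by (intro Bochner_Integration.integral_add) auto
    also have "(\<integral>\<omega>. walk_len n \<omega> / real n - rate \<partial>path_measure) = mean_len n / real n - rate"
      using iw integral_walk_len[of n] by (simp add: paths.prob_space)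
    finally show ?thesis by simp
  qed
  have "(\<lambda>n. mean_len n / real n - rate + 2 * (\<integral>\<omega>. h n \<omega> \<partial>path_measure)) \<longlonglongrightarrow> rate - rate + 2 * 0"
    by (intro tendsto_intros mean_len_tendsto h0)
  then show ?thesis unfolding eq by simp
qed

lemma escape_rate_eq:
  assumes S: "len = word_length G S"
  shows "escape_rate G S \<mu> = rate"
proof -
  have walk: "AE \<omega> in path_measure. \<forall>n. real (word_length G S (walk G \<omega> n)) = walk_len n \<omega>"
    unfolding S[symmetric] by (rule AE_I2) (simp add: walk_len_eq_walk)
  have eq: "(\<integral>\<omega>. \<bar>real (word_length G S (walk G \<omega> n)) / real n - rate\<bar> \<partial>path_measure)
      = (\<integral>\<omega>. \<bar>walk_len n \<omega> / real n - rate\<bar> \<partial>path_measure)" for n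
    unfolding S[symmetric] by (intro Bochner_Integration.integral_cong) (simp_all add: walk_len_eq_walk)
  have int: "integrable path_measure (\<lambda>\<omega>. real (word_length G S (walk G \<omega> n)))" for n
    unfolding S[symmetric] using integrable_walk_len[of n]
    by (subst Bochner_Integration.integrable_cong[where g = "walk_len n"]) (simp_all add: walk_len_eq_walk)
  have "has_escape_rate G S \<mu> rate"
    unfolding has_escape_rate_def eq
  proof (intro conjI allI int L1_rate)
    show "AE \<omega> in path_measure. (\<lambda>n. real (word_length G S (walk G \<omega> n)) / real n) \<longlonglongrightarrow> rate"
      using AE_rate walk by eventually_elim simp
  qed
  moreover have "l = rate" if "has_escape_rate G S \<mu> l" for l
  proof -
    have "AE \<omega> in path_measure. (\<lambda>n. real (word_length G S (walk G \<omega> n)) / real n) \<longlonglongrightarrow> l"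
      using that by (simp add: has_escape_rate_def)
    then have "AE \<omega> in path_measure. l = rate"
      using AE_rate walk by eventually_elim (auto intro: LIMSEQ_unique)
    then show ?thesis by simp
  qed
  ultimately show ?thesis unfolding escape_rate_def by (intro the_equality)
qed

end

section \<open>Tracking of the endpoint\<close>

lemma prob_map_pmf: "measure_pmf.prob (map_pmf f p) A = measure_pmf.prob p {x. f x \<in> A}"
  by (simp add: vimage_def)

lemma prob_Un_le:
  "measure_pmf.prob p {x. P x \<or> Q x} \<le> measure_pmf.prob p {x. P x} + measure_pmf.prob p {x. Q x}"
  unfolding Collect_disj_eq by (rule measure_Un_le) auto

lemma prob_mono_support:
  assumes "\<And>x. x \<in> set_pmf p \<Longrightarrow> P x \<Longrightarrow> Q x"
  shows "measure_pmf.prob p {x. P x} \<le> measure_pmf.prob p {x. Q x}"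
  by (rule measure_pmf.finite_measure_mono_AE) (auto intro!: AE_pmfI assms)

lemma prob_exists_element_le:
  "measure_pmf.prob (replicate_pmf n p) {xs. \<exists>x\<in>set xs. P x} \<le> real n * measure_pmf.prob p {x. P x}"
proof (induction n)
  case (Suc n)
  have "measure_pmf.prob (replicate_pmf (Suc n) p) {xs. \<exists>x\<in>set xs. P x}
      = measure_pmf.prob (pair_pmf p (replicate_pmf n p)) {x. fst x \<in> {x. P x} \<or> snd x \<in> {xs. \<exists>x\<in>set xs. P x}}"
    unfolding replicate_pmf_Suc_pair prob_map_pmf by (simp add: case_prod_unfold)
  also have "\<dots> \<le> measure_pmf.prob p {x. P x} + measure_pmf.prob (replicate_pmf n p) {xs. \<exists>x\<in>set xs. P x}"
    by (rule prob_pair_Un_le)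
  finally show ?case using Suc by (simp add: algebra_simps)
qed simp

context random_walk
begin

text \<open>Almost sure convergence makes the events "some later time violates the bound" decrease
  to a null set. The gain over convergence in probability is that one \<open>k0\<close>, independent
  of \<open>n\<close>, controls all later times of the path simultaneously.\<close>

lemma uniform_rate:
  assumes "\<theta> > 0" "\<epsilon> > 0"
  obtains k0 where "\<And>n. measure_pmf.prob (replicate_pmf n \<mu>)
    {xs. \<exists>i\<in>{k0..n}. \<bar>norm_wp (take i xs) - rate * real i\<bar> > \<epsilon> * real i} \<le> \<theta>"
proof -
  define E where "E k = {\<omega> \<in> space path_measure. \<exists>i\<ge>k. \<bar>walk_len i \<omega> - rate * real i\<bar> > \<epsilon> * real i}" for k
  have E: "E k \<in> sets path_measure" for k unfolding E_def by measurable
  have "decseq E" unfolding decseq_def E_def by (auto intro: order_trans)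
  then have lim: "(\<lambda>k. paths.prob (E k)) \<longlonglongrightarrow> paths.prob (\<Inter>k. E k)"
    using E by (intro paths.finite_Lim_measure_decseq) auto
  have "AE \<omega> in path_measure. \<omega> \<notin> (\<Inter>k. E k)"
    using AE_rate
  proof eventually_elim
    case (elim \<omega>)
    then have "\<forall>\<^sub>F n in sequentially. dist (walk_len n \<omega> / real n) rate < \<epsilon>"
      using tendstoD assms(2) by blast
    then obtain k where k: "\<And>n. n \<ge> k \<Longrightarrow> dist (walk_len n \<omega> / real n) rate < \<epsilon>"
      by (auto simp: eventually_sequentially)
    have "\<bar>walk_len n \<omega> - rate * real n\<bar> \<le> \<epsilon> * real n" if "n \<ge> Suc k" for n
    proof -
      have "\<bar>walk_len n \<omega> / real n - rate\<bar> < \<epsilon>" using k[of n] that by (simp add: dist_real_def)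
      moreover have "walk_len n \<omega> - rate * real n = (walk_len n \<omega> / real n - rate) * real n"
        using that by (simp add: field_simps)
      ultimately show ?thesis using that by (simp add: abs_mult mult_right_mono)
    qed
    then have "\<omega> \<notin> E (Suc k)" by (force simp: E_def)
    then show ?case by blast
  qed
  then have "paths.prob (\<Inter>k. E k) = 0"
    using E by (subst paths.prob_eq_0) auto
  with lim have "\<forall>\<^sub>F k in sequentially. paths.prob (E k) < \<theta>"
    using assms(1) by (simp add: order_tendstoD)
  then obtain k0 where k0: "paths.prob (E k0) < \<theta>"
    by (meson eventually_sequentially order_refl)
  show thesis
  proof (rule that[of k0])
    fix n
    let ?A = "{xs. \<exists>i\<in>{k0..n}. \<bar>norm_wp (take i xs) - rate * real i\<bar> > \<epsilon> * real i}"
    have "measure_pmf.prob (replicate_pmf n \<mu>) ?A = paths.prob {\<omega> \<in> space path_measure. prefix n \<omega> \<in> ?A}"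
      by (rule prob_prefix[symmetric])
    also have "\<dots> \<le> paths.prob (E k0)"
      by (rule paths.finite_measure_mono[OF _ E]) (auto simp: E_def walk_len_def take_prefix)
    finally show "measure_pmf.prob (replicate_pmf n \<mu>) ?A \<le> \<theta>" using k0 by simp
  qed
qed

lemma rate_in_prob:
  assumes "\<theta> > 0" "\<epsilon> > 0"
  obtains k0 where "\<And>n. n \<ge> k0 \<Longrightarrow> measure_pmf.prob (replicate_pmf n \<mu>)
    {xs. \<bar>norm_wp xs - rate * real n\<bar> > \<epsilon> * real n} \<le> \<theta>"
proof -
  obtain k0 where k0: "\<And>n. measure_pmf.prob (replicate_pmf n \<mu>)
    {xs. \<exists>i\<in>{k0..n}. \<bar>norm_wp (take i xs) - rate * real i\<bar> > \<epsilon> * real i} \<le> \<theta>"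
    using uniform_rate[OF assms] by blast
  show thesis
  proof (rule that[of k0])
    fix n assume n: "n \<ge> k0"
    have "measure_pmf.prob (replicate_pmf n \<mu>) {xs. \<bar>norm_wp xs - rate * real n\<bar> > \<epsilon> * real n}
      \<le> measure_pmf.prob (replicate_pmf n \<mu>)
          {xs. \<exists>i\<in>{k0..n}. \<bar>norm_wp (take i xs) - rate * real i\<bar> > \<epsilon> * real i}"
      using n by (intro prob_mono_support bexI[of _ n]) (auto dest!: length_replicate_pmf)
    then show "measure_pmf.prob (replicate_pmf n \<mu>) {xs. \<bar>norm_wp xs - rate * real n\<bar> > \<epsilon> * real n} \<le> \<theta>"
      using k0[of n] by linarith
  qed
qed

lemma prob_large_step:
  assumes "c > 0"
  shows "measure_pmf.prob (replicate_pmf n \<mu>) {xs. \<exists>x\<in>set xs. real (len x) \<ge> c}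
    \<le> real n * (measure_pmf.expectation \<mu> (\<lambda>x. real (len x) ^ 4) / c ^ 4)"
  by (rule order_trans[OF prob_exists_element_le]) (intro mult_left_mono pmf_Markov_fourth moment assms, simp)

section \<open>The inverse walk\<close>

lemma support_inv: "set_pmf (map_pmf (m_inv G) \<mu>) \<subseteq> carrier G"
  using supp by auto

lemma random_walk_inv: "random_walk G len (map_pmf (m_inv G) \<mu>)"
proof
  have "integrable (measure_pmf \<mu>) (\<lambda>x. real (len (inv x)) ^ 4) \<longleftrightarrow> integrable (measure_pmf \<mu>) (\<lambda>x. real (len x) ^ 4)"
    using supp by (intro integrable_cong_AE) (auto intro!: AE_pmfI)
  then show "integrable (measure_pmf (map_pmf (m_inv G) \<mu>)) (\<lambda>x. real (len x) ^ 4)"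
    using moment by simp
qed (rule support_inv)

text \<open>Seen from its end, a path has the inverted increments in reverse order. As reversal
  preserves the law, the past is again a random walk, with step law
  \<open>map_pmf (m_inv G) \<mu>\<close>.\<close>

lemma replicate_pmf_inv:
  "replicate_pmf n (map_pmf (m_inv G) \<mu>) = map_pmf (\<lambda>xs. rev (map (m_inv G) xs)) (replicate_pmf n \<mu>)"
  unfolding map_replicate_pmf[symmetric]
  by (subst rev_replicate_pmf[symmetric]) (simp add: map_replicate_pmf[symmetric] pmf.map_comp o_def rev_map)

lemma rate_inv: "random_walk.rate G len (map_pmf (m_inv G) \<mu>) = rate"
proof -
  interpret inv_walk: random_walk G len "map_pmf (m_inv G) \<mu>" by (rule random_walk_inv)
  have "inv_walk.mean_len n = mean_len n" for n
    unfolding inv_walk.mean_len_def mean_len_def replicate_pmf_inv integral_map_pmf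
  proof (rule integral_cong_AE)
    show "AE xs in replicate_pmf n \<mu>. norm_wp (rev (map (m_inv G) xs)) = norm_wp xs"
      by (rule AE_pmfI) (auto simp: norm_wp_def wp_rev_inv dest!: support_replicate)
  qed auto
  then show ?thesis by (simp add: inv_walk.rate_def rate_def)
qed

end

section \<open>Gromov products along the path\<close>

locale hyperbolic_walk = hyperbolic_group + random_walk +
  assumes rate_pos: "rate > 0"
begin

lemma hyperbolic_walk_inv: "hyperbolic_walk G len \<delta> (map_pmf (m_inv G) \<mu>)"
proof -
  interpret inv_walk: random_walk G len "map_pmf (m_inv G) \<mu>" by (rule random_walk_inv)
  show ?thesis
    by unfold_locales (simp add: rate_inv rate_pos)
qed

lemma gp_path_step:
  assumes "set xs \<subseteq> carrier G" "i < length xs"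
  shows "gp (wp (take i xs)) (wp (take (Suc i) xs)) \<ge> norm_wp (take i xs) - real (len (xs ! i))"
proof -
  have s: "set (take i xs) \<subseteq> carrier G" "xs ! i \<in> carrier G" "set (take (Suc i) xs) \<subseteq> carrier G"
    using assms set_take_subset by (force dest: in_set_takeD)+
  have "wp (take (Suc i) xs) = wp (take i xs) \<otimes> xs ! i"
    using assms s wp_append[of "take i xs" "[xs ! i]"] by (simp add: take_Suc_conv_app_nth)
  then have "ldist (wp (take i xs)) (wp (take (Suc i) xs)) = real (len (xs ! i))"
    using s by (simp add: ldist_def m_assoc[symmetric])
  then show ?thesis using gp_ge[of "wp (take i xs)" "wp (take (Suc i) xs)"] s
    by (simp add: norm_wp_def)
qed

text \<open>After time \<open>k\<close> the walk stays above height 3/4 \<open>rate * k\<close>, and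
  with high probability its steps are shorter than a small multiple of sqrt n, hence of
  \<open>k\<close>. So consecutive positions have a large Gromov product, and
  \<open>gp_chain_log\<close> passes to the endpoint at the price of a logarithm.\<close>

lemma far_future:
  assumes "\<theta> > 0" "c > 0"
  obtains n0 where "\<And>n k m. n \<ge> n0 \<Longrightarrow> c * sqrt (real n) \<le> real k \<Longrightarrow> k \<le> m \<Longrightarrow> m \<le> n \<Longrightarrow>
    measure_pmf.prob (replicate_pmf m \<mu>) {xs. gp (wp (take k xs)) (wp xs) < rate / 2 * real k} \<le> \<theta>"
proof -
  let ?P = "\<lambda>n. replicate_pmf n \<mu>"
  define M4 where "M4 = measure_pmf.expectation \<mu> (\<lambda>x. real (len x) ^ 4)"
  have M4: "M4 \<ge> 0" by (simp add: M4_def)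
  \<comment> \<open>Two losses, the longest step and the logarithmic term, must fit between 3/4 and
    1/2 of \<open>rate * real k\<close>; each is allowed an eighth.\<close>
  define a where "a n = rate / 8 * (c * sqrt (real n))" for n :: nat
  obtain k0 where k0: "\<And>n. measure_pmf.prob (?P n)
    {xs. \<exists>i\<in>{k0..n}. \<bar>norm_wp (take i xs) - rate * real i\<bar> > rate / 4 * real i} \<le> \<theta> / 2"
    using uniform_rate[of "\<theta> / 2" "rate / 4"] assms rate_pos by auto
  have ev1: "\<forall>\<^sub>F n in sequentially. real k0 \<le> c * sqrt (real n)"
    using assms(2) by real_asymp
  have ev2: "\<forall>\<^sub>F n in sequentially. real n * (M4 / a n ^ 4) \<le> \<theta> / 2"
  proof -
    have "real n / a n ^ 4 = 1 / (rate / 8 * c) ^ 4 * (1 / real n)" for n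
    proof -
      have "sqrt (real n) ^ 4 = real n ^ 2" using power_mult[of "sqrt (real n)" 2 2] by simp
      then have "a n ^ 4 = (rate / 8 * c) ^ 4 * (real n * real n)"
        unfolding a_def by (simp add: power_mult_distrib power_divide power2_eq_square)
      then show ?thesis by simp
    qed
    then have "(\<lambda>n::nat. real n / a n ^ 4) \<longlonglongrightarrow> 0"
      using tendsto_mult_right_zero[OF lim_1_over_n, of "1 / (rate / 8 * c) ^ 4"] by simp
    from tendsto_mult_right_zero[OF this, of M4]
    have "(\<lambda>n::nat. real n * (M4 / a n ^ 4)) \<longlonglongrightarrow> 0" by (simp add: mult_ac)
    then have "\<forall>\<^sub>F n in sequentially. real n * (M4 / a n ^ 4) < \<theta> / 2"
      using assms(1) by (intro order_tendstoD) auto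
    then show ?thesis by eventually_elim simp
  qed
  have ev3: "\<forall>\<^sub>F n in sequentially. (log 2 (real n) + 1) * \<delta> \<le> a n"
  proof -
    have "\<forall>\<^sub>F n in sequentially. (log 2 (real n) + 1) * d \<le> b * sqrt (real n)" if "d > 0" "b > 0" for b d
      using that by real_asymp
    from this[of "\<delta> + 1" "rate / 8 * c"]
    have "\<forall>\<^sub>F n in sequentially. (log 2 (real n) + 1) * (\<delta> + 1) \<le> a n"
      using delta_nonneg assms(2) rate_pos by (simp add: a_def mult_ac)
    then show ?thesis using eventually_ge_at_top[of 1]
    proof eventually_elim
      case (elim n)
      have "(log 2 (real n) + 1) * \<delta> \<le> (log 2 (real n) + 1) * (\<delta> + 1)"
        using elim by (intro mult_left_mono) auto
      then show ?case using elim by linarith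
    qed
  qed
  have "\<forall>\<^sub>F n in sequentially. real k0 \<le> c * sqrt (real n) \<and> real n * (M4 / a n ^ 4) \<le> \<theta> / 2
      \<and> (log 2 (real n) + 1) * \<delta> \<le> a n \<and> n \<ge> 1"
    using ev1 ev2 ev3 eventually_ge_at_top[of 1] by eventually_elim simp
  then obtain n0 where n0: "\<And>n. n \<ge> n0 \<Longrightarrow> real k0 \<le> c * sqrt (real n) \<and> real n * (M4 / a n ^ 4) \<le> \<theta> / 2
      \<and> (log 2 (real n) + 1) * \<delta> \<le> a n \<and> n \<ge> 1"
    by (auto simp: eventually_sequentially)
  show thesis
  proof (rule that[of n0])
    fix n k m assume n: "n \<ge> n0" and k: "c * sqrt (real n) \<le> real k" "k \<le> m" and m: "m \<le> n"
    note N = n0[OF n]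
    have a_pos: "a n > 0" using N assms(2) rate_pos by (auto simp: a_def)
    have a_k: "a n \<le> rate / 8 * real k"
      unfolding a_def using k rate_pos by (intro mult_left_mono) auto
    have k0k: "k0 \<le> k" using N k by linarith
    let ?A = "\<lambda>xs. \<exists>i\<in>{k0..m}. \<bar>norm_wp (take i xs) - rate * real i\<bar> > rate / 4 * real i"
    let ?B = "\<lambda>xs. \<exists>x\<in>set xs. real (len x) \<ge> a n"
    have "measure_pmf.prob (?P m) {xs. gp (wp (take k xs)) (wp xs) < rate / 2 * real k}
        \<le> measure_pmf.prob (?P m) {xs. ?A xs \<or> ?B xs}"
    proof (rule prob_mono_support, rule ccontr)
      fix xs assume xs: "xs \<in> set_pmf (?P m)"
        and small: "gp (wp (take k xs)) (wp xs) < rate / 2 * real k"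
        and nAB: "\<not> (?A xs \<or> ?B xs)"
      have len_xs: "length xs = m" using xs by (rule length_replicate_pmf)
      have sx: "set xs \<subseteq> carrier G" using xs by (rule support_replicate)
      then have st: "wp (take i xs) \<in> carrier G" for i by (meson wp_closed set_take_subset subset_trans)
      have lower: "norm_wp (take i xs) \<ge> 3 / 4 * rate * real k" if "k \<le> i" "i \<le> m" for i
      proof -
        have "\<bar>norm_wp (take i xs) - rate * real i\<bar> \<le> rate / 4 * real i"
          using nAB that k0k by (auto simp: not_less)
        then have "rate * real i - rate / 4 * real i \<le> norm_wp (take i xs)" by linarith
        moreover have "rate * real i - rate / 4 * real i = 3 / 4 * rate * real i"
          by (simp add: algebra_simps)
        ultimately have "norm_wp (take i xs) \<ge> 3 / 4 * rate * real i" by linarith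
        moreover have "3 / 4 * rate * real k \<le> 3 / 4 * rate * real i"
          using that rate_pos by (intro mult_left_mono) auto
        ultimately show ?thesis by linarith
      qed
      have "gp (wp (take k xs)) (wp (take m xs)) \<ge> rate / 2 * real k"
      proof (cases "k = m")
        case True
        have "gp (wp xs) (wp xs) = norm_wp xs"
          using sx by (simp add: gp_def norm_wp_def)
        moreover have "rate / 2 * real m \<le> 3 / 4 * rate * real m"
          using rate_pos by (intro mult_right_mono) auto
        then have "rate / 2 * real m \<le> norm_wp (take m xs)"
          using lower[OF k(2) order_refl] unfolding True by linarith
        ultimately show ?thesis using True len_xs by simp
      next
        case False
        have "gp (wp (take (k + 0) xs)) (wp (take (k + (m - k)) xs))
            \<ge> (3 / 4 * rate * real k - a n) - (log 2 (real n) + 1) * \<delta>"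
        proof (rule gp_chain_log[where y = "\<lambda>i. wp (take (k + i) xs)"])
          fix i assume i: "i < m - k"
          then have ki: "k + i < length xs" "k \<le> k + i" "k + i \<le> m" using len_xs by auto
          have "real (len (xs ! (k + i))) < a n"
            using nAB ki by (auto simp: not_le)
          then have "3 / 4 * rate * real k - a n \<le> gp (wp (take (k + i) xs)) (wp (take (Suc (k + i)) xs))"
            using gp_path_step[OF sx ki(1)] lower[OF ki(2,3)] by linarith
          then show "gp (wp (take (k + i) xs)) (wp (take (k + Suc i) xs)) \<ge> 3 / 4 * rate * real k - a n"
            by simp
        qed (use st False k m in auto)
        moreover have "(log 2 (real n) + 1) * \<delta> \<le> a n" using N by blast
        ultimately have "gp (wp (take k xs)) (wp (take m xs)) \<ge> 3 / 4 * rate * real k - 2 * a n"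
          using k by simp
        then show ?thesis using a_k by linarith
      qed
      then show False using small len_xs by simp
    qed
    also have "\<dots> \<le> measure_pmf.prob (?P m) {xs. ?A xs} + measure_pmf.prob (?P m) {xs. ?B xs}"
      by (rule prob_Un_le)
    also have "measure_pmf.prob (?P m) {xs. ?A xs} \<le> \<theta> / 2" by (rule k0)
    also have "measure_pmf.prob (?P m) {xs. ?B xs} \<le> real m * (M4 / a n ^ 4)"
      unfolding M4_def by (rule prob_large_step[OF a_pos])
    also have "\<dots> \<le> real n * (M4 / a n ^ 4)"
      using m M4 a_pos by (intro mult_right_mono) auto
    also have "\<dots> \<le> \<theta> / 2" using N by blast
    finally show "measure_pmf.prob (?P m) {xs. gp (wp (take k xs)) (wp xs) < rate / 2 * real k} \<le> \<theta>"
      by simp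
  qed
qed

end

lemma pair_pmf_map_first: "pair_pmf (map_pmf f p) q = map_pmf (\<lambda>x. (f (fst x), snd x)) (pair_pmf p q)"
  using map_pair[of f id p q] by (simp add: case_prod_unfold)

section \<open>Backtracking and the distance to the geodesic\<close>

context hyperbolic_walk
begin

text \<open>The Gromov product of the inverse past and the future is half the defect of the triangle
  inequality at their junction, and past followed by future is a walk of \<open>2 * k\<close> steps.
  Convergence of \<open>mean_len n / n\<close> alone therefore makes the mean backtrack
  sublinear.\<close>

lemma expectation_backtrack:
  fixes k :: nat
  defines "q \<equiv> pair_pmf (replicate_pmf k \<mu>) (replicate_pmf k \<mu>)"
  shows "integrable (measure_pmf q) (\<lambda>x. gp (inv (wp (fst x))) (wp (snd x)))"
    and "measure_pmf.expectation q (\<lambda>x. gp (inv (wp (fst x))) (wp (snd x)))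
      = mean_len k - mean_len (2 * k) / 2"
proof -
  let ?h = "\<lambda>x. (norm_wp (fst x) + norm_wp (snd x) - norm_wp (fst x @ snd x)) / 2"
  have eq: "AE x in measure_pmf q. gp (inv (wp (fst x))) (wp (snd x)) = ?h x"
  proof (rule AE_pmfI)
    fix x assume "x \<in> set_pmf q"
    then have s: "set (fst x) \<subseteq> carrier G" "set (snd x) \<subseteq> carrier G"
      by (auto simp: q_def dest!: support_replicate)
    then have "wp (fst x) \<in> carrier G" by auto
    then show "gp (inv (wp (fst x))) (wp (snd x)) = ?h x"
      using s by (simp add: gp_def ldist_def norm_wp_def wp_append)
  qed
  have i1: "integrable (measure_pmf q) (\<lambda>x. norm_wp (fst x))"
    "integrable (measure_pmf q) (\<lambda>x. norm_wp (snd x))"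
    using integrable_norm_wp unfolding q_def
    by (metis integrable_map_pmf_eq map_fst_pair_pmf, metis integrable_map_pmf_eq map_snd_pair_pmf)
  have rep: "replicate_pmf (2 * k) \<mu> = map_pmf (\<lambda>x. fst x @ snd x) q"
    unfolding q_def mult_2 replicate_pmf_add by (simp add: case_prod_unfold)
  have i2: "integrable (measure_pmf q) (\<lambda>x. norm_wp (fst x @ snd x))"
    using integrable_norm_wp[of "2 * k"] unfolding rep by simp
  have m: "mean_len (2 * k) = measure_pmf.expectation q (\<lambda>x. norm_wp (fst x @ snd x))"
    unfolding mean_len_def rep by simp
  show "integrable (measure_pmf q) (\<lambda>x. gp (inv (wp (fst x))) (wp (snd x)))"
    using eq i1 i2 by (subst integrable_cong_AE[where g = ?h]) auto
  have "measure_pmf.expectation q (\<lambda>x. gp (inv (wp (fst x))) (wp (snd x))) = measure_pmf.expectation q ?h"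
    using eq by (intro integral_cong_AE) auto
  also have "\<dots> = mean_len k - mean_len (2 * k) / 2"
    using i1 i2 unfolding m by (simp add: q_def mean_len_def)
  finally show "measure_pmf.expectation q (\<lambda>x. gp (inv (wp (fst x))) (wp (snd x)))
      = mean_len k - mean_len (2 * k) / 2" .
qed

lemma backtrack_sublinear:
  "(\<lambda>k. (mean_len k - mean_len (2 * k) / 2) / real k) \<longlonglongrightarrow> 0"
proof -
  have "(\<lambda>k. mean_len (2 * k) / real (2 * k)) \<longlonglongrightarrow> rate"
    using mean_len_tendsto
    by (rule filterlim_compose[where f = "\<lambda>k. 2 * k"]) (auto intro!: filterlim_subseq simp: strict_mono_def)
  with mean_len_tendsto have "(\<lambda>k. mean_len k / real k - mean_len (2 * k) / real (2 * k)) \<longlonglongrightarrow> rate - rate"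
    by (rule tendsto_diff)
  then show ?thesis by (simp add: diff_divide_distrib mult.commute)
qed

text \<open>Seen from time \<open>\<tau>\<close>, past and future are independent; after \<open>O(\<epsilon> sqrt n)\<close> steps both
  have left the ball of radius \<open>2 \<epsilon> sqrt n\<close> for good, so a backtrack longer than \<open>\<epsilon> sqrt n\<close> is
  already visible in these first steps, where its mean is sublinear.\<close>

lemma tracking:
  assumes "\<theta> > 0" "\<epsilon> > 0" "\<kappa> > 0"
  obtains n0 where "\<And>n \<tau>. n \<ge> n0 \<Longrightarrow> \<kappa> * real n \<le> real \<tau> \<Longrightarrow> real \<tau> \<le> (1 - \<kappa>) * real n \<Longrightarrow>
    measure_pmf.prob (replicate_pmf n \<mu>)
      {xs. norm_wp (take \<tau> xs) - gp (wp (take \<tau> xs)) (wp xs) > \<epsilon> * sqrt (real n)} \<le> \<theta>"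
proof -
  interpret inv_walk: hyperbolic_walk G len \<delta> "map_pmf (m_inv G) \<mu>" by (rule hyperbolic_walk_inv)
  \<comment> \<open>For \<open>k \<ge> c * sqrt n\<close> the height \<open>rate / 2 * k\<close>
    guaranteed by \<open>far_future\<close> is at least \<open>2 * \<epsilon> * sqrt n\<close>,
    twice the deviation in question.\<close>
  define c where "c = 4 * \<epsilon> / rate"
  have c: "c > 0" using assms rate_pos by (simp add: c_def)
  define K where "K n = nat \<lceil>c * sqrt (real n)\<rceil>" for n :: nat
  obtain n1 where n1: "\<And>n k m. n \<ge> n1 \<Longrightarrow> c * sqrt (real n) \<le> real k \<Longrightarrow> k \<le> m \<Longrightarrow> m \<le> n \<Longrightarrow>
    measure_pmf.prob (replicate_pmf m \<mu>) {xs. gp (wp (take k xs)) (wp xs) < rate / 2 * real k} \<le> \<theta> / 3"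
    using far_future[of "\<theta> / 3" c] assms c by auto
  obtain n2 where n2: "\<And>n k m. n \<ge> n2 \<Longrightarrow> c * sqrt (real n) \<le> real k \<Longrightarrow> k \<le> m \<Longrightarrow> m \<le> n \<Longrightarrow>
    measure_pmf.prob (replicate_pmf m (map_pmf (m_inv G) \<mu>))
      {xs. gp (wp (take k xs)) (wp xs) < rate / 2 * real k} \<le> \<theta> / 3"
    using inv_walk.far_future[of "\<theta> / 3" c] assms c unfolding rate_inv by auto
  \<comment> \<open>Markov's inequality then yields \<open>\<theta> / 3\<close>: a mean of at most
    \<open>\<eta> * (2 * c * sqrt n)\<close> against the threshold
    \<open>\<epsilon> * sqrt n / 2\<close>.\<close>
  define \<eta> where "\<eta> = \<theta> * \<epsilon> / (12 * c)"
  have \<eta>: "\<eta> > 0" using assms c by (simp add: \<eta>_def)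
  have "\<forall>\<^sub>F k in sequentially. (mean_len k - mean_len (2 * k) / 2) / real k < \<eta>"
    using backtrack_sublinear \<eta> by (rule order_tendstoD)
  then obtain k1 where k1: "\<And>k. k \<ge> k1 \<Longrightarrow> (mean_len k - mean_len (2 * k) / 2) / real k < \<eta>"
    by (auto simp: eventually_sequentially)
  have "\<forall>\<^sub>F n in sequentially. real k1 \<le> c * sqrt (real n)" using c by real_asymp
  moreover have "\<forall>\<^sub>F n in sequentially. c * sqrt (real n) + 1 \<le> \<kappa> * real n" using assms c by real_asymp
  moreover have "\<forall>\<^sub>F n in sequentially. c * sqrt (real n) + 1 \<le> 2 * c * sqrt (real n)" using c by real_asymp
  moreover have "\<forall>\<^sub>F n in sequentially. 2 * \<delta> \<le> \<epsilon> / 2 * sqrt (real n)"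
    using assms by real_asymp
  ultimately have "\<forall>\<^sub>F n in sequentially. n \<ge> max n1 n2 \<and> n \<ge> 1 \<and> real k1 \<le> c * sqrt (real n)
      \<and> c * sqrt (real n) + 1 \<le> \<kappa> * real n \<and> c * sqrt (real n) + 1 \<le> 2 * c * sqrt (real n)
      \<and> 2 * \<delta> \<le> \<epsilon> / 2 * sqrt (real n)"
    using eventually_ge_at_top[of "max n1 n2"] eventually_ge_at_top[of 1] by eventually_elim simp
  then obtain n0 where n0: "\<And>n. n \<ge> n0 \<Longrightarrow> n \<ge> max n1 n2 \<and> n \<ge> 1 \<and> real k1 \<le> c * sqrt (real n)
      \<and> c * sqrt (real n) + 1 \<le> \<kappa> * real n \<and> c * sqrt (real n) + 1 \<le> 2 * c * sqrt (real n)
      \<and> 2 * \<delta> \<le> \<epsilon> / 2 * sqrt (real n)"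
    by (auto simp: eventually_sequentially)
  show thesis
  proof (rule that[of n0])
    fix n \<tau> assume n: "n \<ge> n0" and \<tau>: "\<kappa> * real n \<le> real \<tau>" "real \<tau> \<le> (1 - \<kappa>) * real n"
    note N = n0[OF n]
    define k where "k = K n"
    define R where "R = \<epsilon> * sqrt (real n)"
    define m where "m = n - \<tau>"
    let ?P = "\<lambda>n. replicate_pmf n \<mu>"
    let ?I = "\<lambda>xs. rev (map (m_inv G) xs)"
    have R: "R > 0" using assms N by (simp add: R_def)
    have \<delta>R: "2 * \<delta> \<le> R / 2" using N by (simp add: R_def)
    have \<tau>n: "\<tau> \<le> n"
    proof -
      have "(1 - \<kappa>) * real n \<le> 1 * real n" using assms by (intro mult_right_mono) auto
      then show ?thesis using \<tau> by simp
    qed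
    have k_ge: "c * sqrt (real n) \<le> real k" unfolding k_def K_def by (rule real_nat_ceiling_ge)
    have k_le: "real k \<le> c * sqrt (real n) + 1"
      using c unfolding k_def K_def by (simp add: of_nat_nat ceiling_correct)
    \<comment> \<open>The distance \<open>\<kappa> * n\<close> of \<open>\<tau>\<close> from both
      ends leaves room for \<open>k\<close> steps in the past and in the future.\<close>
    have k\<tau>: "k \<le> \<tau>" using k_le N \<tau> by linarith
    have "real n - real \<tau> \<ge> \<kappa> * real n" using \<tau> by (simp add: algebra_simps)
    then have "real k + real \<tau> \<le> real n" using k_le N by linarith
    then have km: "k \<le> m" by (simp add: m_def)
    have mn: "m \<le> n" by (simp add: m_def)
    have kpos: "real k > 0" using k_ge c N by (smt (verit) mult_pos_pos real_sqrt_gt_0_iff of_nat_0_less_iff less_le_trans zero_less_one)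
    have big: "rate / 2 * real k \<ge> 2 * R"
    proof -
      have "2 * R = rate / 2 * (c * sqrt (real n))" using rate_pos by (simp add: R_def c_def)
      also have "\<dots> \<le> rate / 2 * real k" using k_ge rate_pos by (intro mult_left_mono) auto
      finally show ?thesis .
    qed
    let ?q = "pair_pmf (?P \<tau>) (?P m)"
    let ?E1 = "\<lambda>x. gp (wp (take k (?I (fst x)))) (wp (?I (fst x))) < rate / 2 * real k"
    let ?E2 = "\<lambda>x. gp (wp (take k (snd x))) (wp (snd x)) < rate / 2 * real k"
    let ?E3 = "\<lambda>x. gp (wp (take k (?I (fst x)))) (wp (take k (snd x))) \<ge> R / 2"
    have "measure_pmf.prob (?P n) {xs. norm_wp (take \<tau> xs) - gp (wp (take \<tau> xs)) (wp xs) > \<epsilon> * sqrt (real n)}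
        = measure_pmf.prob (?P n) {xs. norm_wp (take \<tau> xs)
            - gp (wp (take \<tau> xs)) (wp (take \<tau> xs @ drop \<tau> xs)) > R}"
      by (simp add: R_def)
    also have "\<dots> = measure_pmf.prob ?q {x. norm_wp (fst x) - gp (wp (fst x)) (wp (fst x @ snd x)) > R}"
      unfolding m_def take_drop_replicate_pmf[OF \<tau>n, symmetric] prob_map_pmf by simp
    also have "\<dots> \<le> measure_pmf.prob ?q {x. ?E1 x \<or> ?E2 x \<or> ?E3 x}"
    proof (rule prob_mono_support, rule ccontr)
      fix x assume x: "x \<in> set_pmf ?q" and far: "R < norm_wp (fst x) - gp (wp (fst x)) (wp (fst x @ snd x))"
        and no: "\<not> (?E1 x \<or> ?E2 x \<or> ?E3 x)"
      have s: "set (fst x) \<subseteq> carrier G" "set (snd x) \<subseteq> carrier G"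
        using x by (auto dest!: support_replicate)
      then have sI: "set (?I (fst x)) \<subseteq> carrier G" by auto
      have c1: "wp (take k (?I (fst x))) \<in> carrier G" "wp (take k (snd x)) \<in> carrier G"
        using s sI by (meson wp_closed set_take_subset subset_trans)+
      have c2: "wp (?I (fst x)) \<in> carrier G" "wp (snd x) \<in> carrier G" "wp (fst x) \<in> carrier G"
        using s sI by (meson wp_closed)+
      have "R < gp (inv (wp (fst x))) (wp (snd x))"
        using far gp_inv[of "wp (fst x)" "wp (snd x)"] c2 s by (simp add: norm_wp_def wp_append)
      then have g: "R < gp (wp (?I (fst x))) (wp (snd x))" using s by (simp add: wp_rev_inv)
      \<comment> \<open>Replacing each endpoint by the position after \<open>k\<close> steps costs
        one \<open>\<delta>\<close>; the two together are at most \<open>R / 2\<close>.\<close>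
      have "gp (wp (take k (?I (fst x)))) (wp (snd x)) \<ge> R - \<delta>"
        by (rule gp_trans[where y = "wp (?I (fst x))"]) (use no g big R c1 c2 in auto)
      moreover have "gp (wp (snd x)) (wp (take k (snd x))) \<ge> R - \<delta>"
        using no big R c1 c2 gp_sym[of "wp (snd x)" "wp (take k (snd x))"] delta_nonneg by auto
      ultimately have "gp (wp (take k (?I (fst x)))) (wp (take k (snd x))) \<ge> R - \<delta> - \<delta>"
        by (rule gp_trans[where y = "wp (snd x)"]) (use c1 c2 in auto)
      then show False using no \<delta>R by auto
    qed
    also have "\<dots> \<le> measure_pmf.prob ?q {x. ?E1 x} + (measure_pmf.prob ?q {x. ?E2 x} + measure_pmf.prob ?q {x. ?E3 x})"
      by (rule order_trans[OF prob_Un_le]) (intro add_left_mono prob_Un_le)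
    also have "measure_pmf.prob ?q {x. ?E1 x} = measure_pmf.prob (replicate_pmf \<tau> (map_pmf (m_inv G) \<mu>))
        {xs. gp (wp (take k xs)) (wp xs) < rate / 2 * real k}"
    proof -
      have "replicate_pmf \<tau> (map_pmf (m_inv G) \<mu>) = map_pmf (\<lambda>x. ?I (fst x)) ?q"
        unfolding replicate_pmf_inv by (subst map_fst_pair_pmf[symmetric, of _ "?P m"]) (simp add: pmf.map_comp o_def)
      then show ?thesis by (simp only: prob_map_pmf) simp
    qed
    also have "\<dots> \<le> \<theta> / 3" using n2[OF _ k_ge k\<tau> \<tau>n] N by simp
    also have "measure_pmf.prob ?q {x. ?E2 x} = measure_pmf.prob (?P m)
        {xs. gp (wp (take k xs)) (wp xs) < rate / 2 * real k}"
      by (subst (2) map_snd_pair_pmf[symmetric, of _ "?P \<tau>"]) (simp only: prob_map_pmf, simp)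
    also have "\<dots> \<le> \<theta> / 3" using n1[OF _ k_ge km mn] N by simp
    also have "measure_pmf.prob ?q {x. ?E3 x} \<le> \<theta> / 3"
    proof -
      let ?i = "map_pmf (m_inv G) \<mu>"
      let ?qk = "pair_pmf (?P k) (?P k)"
      let ?g = "\<lambda>x. gp (inv (wp (fst x))) (wp (snd x))"
      have "pair_pmf (replicate_pmf k ?i) (?P k) = pair_pmf (map_pmf (take k) (replicate_pmf \<tau> ?i)) (map_pmf (take k) (?P m))"
        using k\<tau> km by (simp add: take_replicate_pmf)
      also have "\<dots> = map_pmf (\<lambda>x. (take k (?I (fst x)), take k (snd x))) ?q"
        unfolding replicate_pmf_inv pmf.map_comp map_pair[symmetric]
        by (simp add: o_def case_prod_unfold)
      finally have "measure_pmf.prob ?q {x. ?E3 x}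
          = measure_pmf.prob (pair_pmf (replicate_pmf k ?i) (?P k)) {x. gp (wp (fst x)) (wp (snd x)) \<ge> R / 2}"
        by (simp only: prob_map_pmf) simp
      also have "\<dots> = measure_pmf.prob ?qk {x. gp (wp (?I (fst x))) (wp (snd x)) \<ge> R / 2}"
        unfolding replicate_pmf_inv pair_pmf_map_first prob_map_pmf by simp
      also have "\<dots> \<le> measure_pmf.prob ?qk {x. ?g x \<ge> R / 2}"
        by (rule prob_mono_support) (auto dest!: support_replicate simp: wp_rev_inv)
      also have "\<dots> \<le> measure_pmf.expectation ?qk ?g / (R / 2)"
        using R by (intro pmf_Markov expectation_backtrack) (auto intro!: gp_nonneg dest!: support_replicate)
      also have "measure_pmf.expectation ?qk ?g \<le> \<eta> * real k"
      proof -
        have "k1 \<le> k" using N k_ge by linarith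
        then show ?thesis using k1[of k] kpos unfolding expectation_backtrack by (simp add: field_simps)
      qed
      also have "\<eta> * real k \<le> \<eta> * (2 * c * sqrt (real n))"
        using k_le N \<eta> by (intro mult_left_mono) auto
      also have "\<eta> * (2 * c * sqrt (real n)) / (R / 2) = \<theta> / 3"
        using assms c N by (simp add: \<eta>_def R_def field_simps)
      finally show ?thesis using R by (simp add: divide_right_mono)
    qed
    finally show "measure_pmf.prob (?P n)
      {xs. norm_wp (take \<tau> xs) - gp (wp (take \<tau> xs)) (wp xs) > \<epsilon> * sqrt (real n)} \<le> \<theta>"
      by simp
  qed
qed

end

section \<open>Values of the homomorphism along the path\<close>

text \<open>Steps may skip heights, so a height counts as crossed by a step that starts at or below
  it and ends above it; a discrete intermediate value argument finds one for every height. A bad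
  height is crossed by bad steps only, and a step of length \<open>s \<tau>\<close> crosses at most
  \<open>s \<tau>\<close> heights.\<close>

lemma card_bad_heights:
  fixes f s :: "nat \<Rightarrow> nat"
  assumes "f t \<le> h1" "h2 \<le> f t'" "t \<le> t'"
    and step: "\<And>\<tau>. \<tau> \<in> {t..<t'} \<Longrightarrow> f (Suc \<tau>) \<le> f \<tau> + s \<tau>"
  shows "card {h \<in> {h1..<h2}. \<not> (\<exists>\<tau>\<in>{t..<t'}. good \<tau> \<and> f \<tau> \<le> h \<and> h < f (Suc \<tau>))}
    \<le> (\<Sum>\<tau>\<in>{t..<t'}. if good \<tau> then 0 else s \<tau>)"
proof -
  let ?I = "\<lambda>\<tau>. if good \<tau> then {} else {f \<tau>..<f (Suc \<tau>)}"
  have cross: "\<exists>\<tau>\<in>{t..<t'}. f \<tau> \<le> h \<and> h < f (Suc \<tau>)" if "f t \<le> h" "h < f t'" for h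
    using \<open>t \<le> t'\<close> that(2)
  proof (induction t' rule: dec_induct)
    case (step u)
    then show ?case
      by (cases "h < f u") (fastforce, auto intro!: bexI[of _ u])
  qed (use that in auto)
  have "{h \<in> {h1..<h2}. \<not> (\<exists>\<tau>\<in>{t..<t'}. good \<tau> \<and> f \<tau> \<le> h \<and> h < f (Suc \<tau>))} \<subseteq> (\<Union>\<tau>\<in>{t..<t'}. ?I \<tau>)"
  proof
    fix h assume h: "h \<in> {h \<in> {h1..<h2}. \<not> (\<exists>\<tau>\<in>{t..<t'}. good \<tau> \<and> f \<tau> \<le> h \<and> h < f (Suc \<tau>))}"
    with cross[of h] assms obtain \<tau> where "\<tau> \<in> {t..<t'}" "f \<tau> \<le> h" "h < f (Suc \<tau>)" by auto
    then show "h \<in> (\<Union>\<tau>\<in>{t..<t'}. ?I \<tau>)" using h by (intro UN_I[of \<tau>]) auto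
  qed
  then have "card {h \<in> {h1..<h2}. \<not> (\<exists>\<tau>\<in>{t..<t'}. good \<tau> \<and> f \<tau> \<le> h \<and> h < f (Suc \<tau>))}
      \<le> card (\<Union>\<tau>\<in>{t..<t'}. ?I \<tau>)" by (intro card_mono) auto
  also have "\<dots> \<le> (\<Sum>\<tau>\<in>{t..<t'}. card (?I \<tau>))" by (intro card_UN_le) auto
  also have "\<dots> \<le> (\<Sum>\<tau>\<in>{t..<t'}. if good \<tau> then 0 else s \<tau>)"
  proof (intro sum_mono)
    fix \<tau> assume "\<tau> \<in> {t..<t'}"
    from step[OF this] have "f (Suc \<tau>) - f \<tau> \<le> s \<tau>" by arith
    then show "card (?I \<tau>) \<le> (if good \<tau> then 0 else s \<tau>)" by simp
  qed
  finally show ?thesis .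
qed

context hyperbolic_walk
begin

text \<open>The bound on the step is there because a crossing only brackets the height: with it, the
  position before the step lies less than \<open>M\<close> below or at that height.\<close>

definition good_time :: "('a \<Rightarrow> real) \<Rightarrow> nat \<Rightarrow> real \<Rightarrow> nat \<Rightarrow> 'a list \<Rightarrow> nat \<Rightarrow> bool" where
  "good_time \<phi> M R t xs \<tau> \<longleftrightarrow> len (xs ! \<tau>) \<le> M
     \<and> norm_wp (take \<tau> xs) - gp (wp (take \<tau> xs)) (wp xs) \<le> R
     \<and> \<bar>\<phi> (wp (take \<tau> xs)) - \<phi> (wp (take t xs))\<bar> \<le> R"

definition bad_length :: "('a \<Rightarrow> real) \<Rightarrow> nat \<Rightarrow> real \<Rightarrow> nat \<Rightarrow> nat \<Rightarrow> 'a list \<Rightarrow> nat" where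
  "bad_length \<phi> M R t t' xs = (\<Sum>\<tau>\<in>{t..<t'}. if good_time \<phi> M R t xs \<tau> then 0 else len (xs ! \<tau>))"

text \<open>The heights \<open>h1\<close> and \<open>h2\<close> do not depend on the path, so
  different paths can be compared at them. The factor 2 makes fewer than half of the heights bad,
  whence two typical paths share a good one; the truncated difference also forces
  \<open>h1 < h2\<close>.\<close>

definition typical :: "('a \<Rightarrow> real) \<Rightarrow> nat \<Rightarrow> real \<Rightarrow> nat \<Rightarrow> nat \<Rightarrow> nat \<Rightarrow> nat \<Rightarrow> 'a list \<Rightarrow> bool" where
  "typical \<phi> M R t t' h1 h2 xs \<longleftrightarrow> len (wp (take t xs)) \<le> h1 \<and> h2 \<le> len (wp (take t' xs))
     \<and> 2 * bad_length \<phi> M R t t' xs < h2 - h1"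

lemma typical_heights:
  assumes xs: "set xs \<subseteq> carrier G" "length xs = n" and ty: "typical \<phi> M R t t' h1 h2 xs"
    and t: "t \<le> t'" "t' \<le> n"
  shows "2 * card {h \<in> {h1..<h2}. \<not> (\<exists>\<tau>\<in>{t..<t'}. good_time \<phi> M R t xs \<tau>
      \<and> len (wp (take \<tau> xs)) \<le> h \<and> h < len (wp (take (Suc \<tau>) xs)))} < h2 - h1"
    and "\<And>\<tau>. \<tau> \<in> {t..<t'} \<Longrightarrow> len (wp (take (Suc \<tau>) xs)) \<le> len (wp (take \<tau> xs)) + len (xs ! \<tau>)"
proof -
  show step: "len (wp (take (Suc \<tau>) xs)) \<le> len (wp (take \<tau> xs)) + len (xs ! \<tau>)" if "\<tau> \<in> {t..<t'}" for \<tau>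
  proof -
    have lt: "\<tau> < length xs" using that t xs by simp
    have s: "set (take \<tau> xs) \<subseteq> carrier G" "xs ! \<tau> \<in> carrier G"
      using xs lt by (auto dest: in_set_takeD)
    have "wp (take (Suc \<tau>) xs) = wp (take \<tau> xs) \<otimes> xs ! \<tau>"
      using lt s wp_append[of "take \<tau> xs" "[xs ! \<tau>]"] by (simp add: take_Suc_conv_app_nth)
    then show ?thesis using len_mult[of "wp (take \<tau> xs)" "xs ! \<tau>"] s by simp
  qed
  have "card {h \<in> {h1..<h2}. \<not> (\<exists>\<tau>\<in>{t..<t'}. good_time \<phi> M R t xs \<tau>
      \<and> len (wp (take \<tau> xs)) \<le> h \<and> h < len (wp (take (Suc \<tau>) xs)))} \<le> bad_length \<phi> M R t t' xs"
    unfolding bad_length_def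
    by (rule card_bad_heights) (use ty t step in \<open>simp_all add: typical_def\<close>)
  then show "2 * card {h \<in> {h1..<h2}. \<not> (\<exists>\<tau>\<in>{t..<t'}. good_time \<phi> M R t xs \<tau>
      \<and> len (wp (take \<tau> xs)) \<le> h \<and> h < len (wp (take (Suc \<tau>) xs)))} < h2 - h1"
    using ty unfolding typical_def by linarith
qed

text \<open>At a shared good height \<open>h\<close> each path has a position of length at most
  \<open>h\<close> whose Gromov product with \<open>g\<close> is nearly \<open>h\<close>: the
  position is close to the geodesic to its own endpoint, which agrees with \<open>g\<close> up to
  height \<open>h2\<close>. Through \<open>g\<close> the two positions have a Gromov product of
  nearly \<open>h\<close>, so they are close to each other, and \<open>\<phi>\<close> is
  Lipschitz.\<close>

lemma typical_agree:
  assumes xs: "set xs \<subseteq> carrier G" "length xs = n" "typical \<phi> M R t t' h1 h2 xs"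
    and ys: "set ys \<subseteq> carrier G" "length ys = n" "typical \<phi> M R t t' h1 h2 ys"
    and t: "t \<le> t'" "t' \<le> n"
    and g: "g \<in> carrier G" "gp (wp xs) g \<ge> real h2" "gp (wp ys) g \<ge> real h2"
    and lip: "\<And>x y. x \<in> carrier G \<Longrightarrow> y \<in> carrier G \<Longrightarrow> \<bar>\<phi> x - \<phi> y\<bar> \<le> C * ldist x y"
    and "C \<ge> 0" "R \<ge> 0"
  shows "\<bar>\<phi> (wp (take t xs)) - \<phi> (wp (take t ys))\<bar> \<le> 2 * R + C * (2 * R + 2 * real M + 6 * \<delta>)"
proof -
  let ?bad = "\<lambda>xs. {h \<in> {h1..<h2}. \<not> (\<exists>\<tau>\<in>{t..<t'}. good_time \<phi> M R t xs \<tau>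
      \<and> len (wp (take \<tau> xs)) \<le> h \<and> h < len (wp (take (Suc \<tau>) xs)))}"
  have "card (?bad xs \<union> ?bad ys) \<le> card (?bad xs) + card (?bad ys)" by (rule card_Un_le)
  also have "\<dots> < card {h1..<h2}"
    using typical_heights(1)[OF xs t] typical_heights(1)[OF ys t] by simp
  finally have less: "card (?bad xs \<union> ?bad ys) < card {h1..<h2}" .
  have "finite (?bad xs \<union> ?bad ys)" by simp
  from card_mono[OF this] less have "\<not> {h1..<h2} \<subseteq> ?bad xs \<union> ?bad ys"
    by (meson leD)
  then obtain h where h: "h \<in> {h1..<h2}" "h \<notin> ?bad xs" "h \<notin> ?bad ys" by blast
  have pt: "\<exists>\<tau>. wp (take \<tau> zs) \<in> carrier G \<and> real (len (wp (take \<tau> zs))) \<le> real h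
      \<and> gp (wp (take \<tau> zs)) g \<ge> real h - real M - R - \<delta> \<and> \<bar>\<phi> (wp (take \<tau> zs)) - \<phi> (wp (take t zs))\<bar> \<le> R"
    if zs: "set zs \<subseteq> carrier G" "length zs = n" "typical \<phi> M R t t' h1 h2 zs" "h \<notin> ?bad zs"
      and gz: "gp (wp zs) g \<ge> real h2" for zs
  proof -
    obtain \<tau> where \<tau>: "\<tau> \<in> {t..<t'}" "good_time \<phi> M R t zs \<tau>" "len (wp (take \<tau> zs)) \<le> h"
      "h < len (wp (take (Suc \<tau>) zs))" using zs(4) h(1) by blast
    have c: "wp (take \<tau> zs) \<in> carrier G" "wp zs \<in> carrier G"
      using zs(1) by (meson wp_closed set_take_subset subset_trans)+
    have "h < len (wp (take \<tau> zs)) + M"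
      using typical_heights(2)[OF zs(1-3) t \<tau>(1)] \<tau> by (auto simp: good_time_def)
    then have "real h - real M \<le> norm_wp (take \<tau> zs)" by (simp add: norm_wp_def)
    then have "gp (wp (take \<tau> zs)) (wp zs) \<ge> real h - real M - R"
      using \<tau>(2) by (auto simp: good_time_def)
    moreover have "gp (wp zs) g \<ge> real h - real M - R" using gz h(1) \<open>R \<ge> 0\<close> by auto
    ultimately have "gp (wp (take \<tau> zs)) g \<ge> real h - real M - R - \<delta>"
      by (rule gp_trans[where y = "wp zs"]) (use c g(1) in auto)
    then show ?thesis using \<tau> c by (auto simp: good_time_def)
  qed
  obtain \<tau> where u: "wp (take \<tau> xs) \<in> carrier G" "real (len (wp (take \<tau> xs))) \<le> real h"
      "gp (wp (take \<tau> xs)) g \<ge> real h - real M - R - \<delta>" "\<bar>\<phi> (wp (take \<tau> xs)) - \<phi> (wp (take t xs))\<bar> \<le> R"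
    using pt[OF xs h(2) g(2)] by blast
  obtain \<tau>' where v: "wp (take \<tau>' ys) \<in> carrier G" "real (len (wp (take \<tau>' ys))) \<le> real h"
      "gp (wp (take \<tau>' ys)) g \<ge> real h - real M - R - \<delta>" "\<bar>\<phi> (wp (take \<tau>' ys)) - \<phi> (wp (take t ys))\<bar> \<le> R"
    using pt[OF ys h(3) g(3)] by blast
  have "gp (wp (take \<tau> xs)) (wp (take \<tau>' ys)) \<ge> real h - real M - R - \<delta> - \<delta>"
    by (rule gp_trans[where y = g]) (use u v g(1) gp_sym[of g "wp (take \<tau>' ys)"] in auto)
  moreover have "d \<le> 2 * r + 2 * m + 6 * e"
    if "z - m - r - e - e \<le> (a + b - d) / 2" "a \<le> z" "b \<le> z" "e \<ge> 0" for a b d e m r z :: real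
    using that by simp
  ultimately have "ldist (wp (take \<tau> xs)) (wp (take \<tau>' ys)) \<le> 2 * R + 2 * real M + 6 * \<delta>"
    using u(2) v(2) delta_nonneg unfolding gp_def by blast
  then have "\<bar>\<phi> (wp (take \<tau> xs)) - \<phi> (wp (take \<tau>' ys))\<bar> \<le> C * (2 * R + 2 * real M + 6 * \<delta>)"
    using lip[OF u(1) v(1)] \<open>C \<ge> 0\<close> by (meson mult_left_mono order_trans)
  then show ?thesis using u(4) v(4) by linarith
qed

end

section \<open>Fluctuations of the homomorphism and the length of bad steps\<close>

locale hyperbolic_walk_hom = hyperbolic_walk +
  fixes \<phi> :: "'a \<Rightarrow> real" and C :: real
  assumes phi_mult: "x \<in> carrier G \<Longrightarrow> y \<in> carrier G \<Longrightarrow> \<phi> (x \<otimes> y) = \<phi> x + \<phi> y"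
    and phi_le: "x \<in> carrier G \<Longrightarrow> \<bar>\<phi> x\<bar> \<le> C * real (len x)"
    and C_nonneg: "C \<ge> 0"
    and phi_centered: "measure_pmf.expectation \<mu> \<phi> = 0"
begin

lemma phi_one: "\<phi> \<one> = 0"
  using phi_mult[of \<one> \<one>] by simp

lemma phi_inv: "x \<in> carrier G \<Longrightarrow> \<phi> (inv x) = - \<phi> x"
  using phi_mult[of x "inv x"] phi_one by simp

lemma phi_lipschitz:
  assumes "x \<in> carrier G" "y \<in> carrier G"
  shows "\<bar>\<phi> x - \<phi> y\<bar> \<le> C * ldist x y"
  using phi_le[of "inv x \<otimes> y"] assms by (simp add: phi_mult phi_inv ldist_def abs_minus_commute)

lemma phi_wp: "set xs \<subseteq> carrier G \<Longrightarrow> \<phi> (wp xs) = sum_list (map \<phi> xs)"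
  by (induction xs) (auto simp: phi_one phi_mult)

lemma integrable_phi4: "integrable (measure_pmf \<mu>) (\<lambda>x. \<phi> x ^ 4)"
  by (rule integrable_bounded_power[OF moment, of _ C]) (use supp phi_le in auto)

definition \<sigma>2 :: real where
  "\<sigma>2 = measure_pmf.expectation \<mu> (\<lambda>x. \<phi> x ^ 2)"

lemma sigma2_nonneg: "\<sigma>2 \<ge> 0"
  by (simp add: \<sigma>2_def)

text \<open>Chebyshev's inequality at one time \<open>\<tau>\<close> is enough, since bad times will
  be averaged over and not excluded.\<close>

lemma prob_phi_increment:
  assumes "t \<le> \<tau>" "\<tau> \<le> n" "R > 0"
  shows "measure_pmf.prob (replicate_pmf n \<mu>) {xs. \<bar>\<phi> (wp (take \<tau> xs)) - \<phi> (wp (take t xs))\<bar> > R}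
    \<le> real (\<tau> - t) * \<sigma>2 / R ^ 2"
proof -
  have law: "map_pmf (\<lambda>xs. take (\<tau> - t) (drop t xs)) (replicate_pmf n \<mu>) = replicate_pmf (\<tau> - t) \<mu>"
    using assms take_replicate_pmf[of "\<tau> - t" "n - t" \<mu>] drop_replicate_pmf[of t n \<mu>]
    by (simp add: pmf.map_comp o_def flip: pmf.map_comp[unfolded o_def, of "take (\<tau> - t)" "drop t"])
  have "measure_pmf.prob (replicate_pmf n \<mu>) {xs. \<bar>\<phi> (wp (take \<tau> xs)) - \<phi> (wp (take t xs))\<bar> > R}
      \<le> measure_pmf.prob (replicate_pmf n \<mu>) {xs. (sum_list (map \<phi> (take (\<tau> - t) (drop t xs)))) ^ 2 \<ge> R ^ 2}"
  proof (rule prob_mono_support)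
    fix xs assume xs: "xs \<in> set_pmf (replicate_pmf n \<mu>)"
      and big: "\<bar>\<phi> (wp (take \<tau> xs)) - \<phi> (wp (take t xs))\<bar> > R"
    have s: "set (take i xs) \<subseteq> carrier G" for i
      using support_replicate[OF xs] set_take_subset by (rule subset_trans[rotated])
    have "take \<tau> xs = take t xs @ take (\<tau> - t) (drop t xs)"
      using assms(1) take_add[of t "\<tau> - t" xs] by simp
    then have "\<phi> (wp (take \<tau> xs)) - \<phi> (wp (take t xs)) = sum_list (map \<phi> (take (\<tau> - t) (drop t xs)))"
      unfolding phi_wp[OF s] by simp
    then have "R \<le> \<bar>sum_list (map \<phi> (take (\<tau> - t) (drop t xs)))\<bar>" using big by simp
    then have "R ^ 2 \<le> \<bar>sum_list (map \<phi> (take (\<tau> - t) (drop t xs)))\<bar> ^ 2"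
      using assms(3) by (intro power_mono) auto
    then show "(sum_list (map \<phi> (take (\<tau> - t) (drop t xs)))) ^ 2 \<ge> R ^ 2" by simp
  qed
  also have "\<dots> = measure_pmf.prob (replicate_pmf (\<tau> - t) \<mu>) {xs. (sum_list (map \<phi> xs)) ^ 2 \<ge> R ^ 2}"
    unfolding law[symmetric] prob_map_pmf by simp
  also have "\<dots> \<le> measure_pmf.expectation (replicate_pmf (\<tau> - t) \<mu>) (\<lambda>xs. sum_list (map \<phi> xs) ^ 2) / R ^ 2"
    using assms by (intro pmf_Markov integrable_sum_list_power integrable_phi4) auto
  also have "\<dots> = real (\<tau> - t) * \<sigma>2 / R ^ 2"
    using sum_list_moments[OF integrable_phi4 phi_centered, of "\<tau> - t"] by (simp add: \<sigma>2_def)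
  finally show ?thesis .
qed

definition excess :: "nat \<Rightarrow> 'a \<Rightarrow> real" where
  "excess M x = (if len x > M then real (len x) else 0)"

lemma
  assumes "M \<ge> 1"
  shows integrable_excess: "integrable (measure_pmf \<mu>) (excess M)"
    and expectation_excess: "measure_pmf.expectation \<mu> (excess M)
      \<le> measure_pmf.expectation \<mu> (\<lambda>x. real (len x) ^ 4) / real M"
proof -
  have le: "excess M x \<le> real (len x) ^ 4 / real M" for x
  proof (cases "len x > M")
    case True
    then have "real (len x) * real M \<le> real (len x) * real (len x)" by (intro mult_left_mono) auto
    also have "\<dots> \<le> real (len x) ^ 4"
      using power_increasing[of 2 4 "real (len x)"] True assms by (simp add: power2_eq_square)
    finally show ?thesis using True assms by (simp add: excess_def field_simps)
  qed (simp add: excess_def)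
  have i: "integrable (measure_pmf \<mu>) (\<lambda>x. real (len x) ^ 4 / real M)" using moment by simp
  show ie: "integrable (measure_pmf \<mu>) (excess M)"
    by (rule Bochner_Integration.integrable_bound[OF i])
       (use le in \<open>auto intro!: AE_I2 simp: excess_def\<close>)
  have "measure_pmf.expectation \<mu> (excess M) \<le> measure_pmf.expectation \<mu> (\<lambda>x. real (len x) ^ 4 / real M)"
    by (rule integral_mono[OF ie i le])
  then show "measure_pmf.expectation \<mu> (excess M)
      \<le> measure_pmf.expectation \<mu> (\<lambda>x. real (len x) ^ 4) / real M" by simp
qed

text \<open>Whether \<open>\<tau>\<close> is a bad time depends on the whole path, including the
  step at \<open>\<tau>\<close>, so the mean length of bad steps does not factorise. Truncation
  decouples them: a step up to \<open>M\<close> is charged \<open>M\<close> times the indicator of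
  the failure, a longer one is charged in full through \<open>excess\<close>, whose mean is of order
  1/M.\<close>

lemma prob_bad_length:
  assumes "M \<ge> 1" "b > 0" "t' \<le> n" "p \<ge> 0"
    and track: "\<And>\<tau>. \<tau> \<in> {t..<t'} \<Longrightarrow> measure_pmf.prob (replicate_pmf n \<mu>)
      {xs. norm_wp (take \<tau> xs) - gp (wp (take \<tau> xs)) (wp xs) > R} \<le> p"
    and phi: "\<And>\<tau>. \<tau> \<in> {t..<t'} \<Longrightarrow> measure_pmf.prob (replicate_pmf n \<mu>)
      {xs. \<bar>\<phi> (wp (take \<tau> xs)) - \<phi> (wp (take t xs))\<bar> > R} \<le> p"
  shows "measure_pmf.prob (replicate_pmf n \<mu>) {xs. real (bad_length \<phi> M R t t' xs) \<ge> b}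
    \<le> real (t' - t) * (2 * real M * p + measure_pmf.expectation \<mu> (\<lambda>x. real (len x) ^ 4) / real M) / b"
proof -
  let ?P = "replicate_pmf n \<mu>"
  let ?A = "\<lambda>\<tau>. {xs. norm_wp (take \<tau> xs) - gp (wp (take \<tau> xs)) (wp xs) > R}"
  let ?F = "\<lambda>\<tau>. {xs. \<bar>\<phi> (wp (take \<tau> xs)) - \<phi> (wp (take t xs))\<bar> > R}"
  define f where "f \<tau> xs = real M * indicator (?A \<tau>) xs + real M * indicator (?F \<tau>) xs + excess M (xs ! \<tau>)" for \<tau> xs
  have f0: "f \<tau> xs \<ge> 0" for \<tau> xs by (auto simp: f_def excess_def)
  have iex: "integrable (measure_pmf ?P) (\<lambda>xs. excess M (xs ! \<tau>))"
    "measure_pmf.expectation ?P (\<lambda>xs. excess M (xs ! \<tau>)) = measure_pmf.expectation \<mu> (excess M)"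
    if "\<tau> \<in> {t..<t'}" for \<tau>
  proof -
    have lt: "\<tau> < n" using that assms by simp
    have law: "map_pmf (\<lambda>xs. xs ! \<tau>) ?P = \<mu>" using lt by (rule nth_replicate_pmf)
    have "integrable (measure_pmf (map_pmf (\<lambda>xs. xs ! \<tau>) ?P)) (excess M)"
      unfolding law using assms(1) by (rule integrable_excess)
    then show "integrable (measure_pmf ?P) (\<lambda>xs. excess M (xs ! \<tau>))" by simp
    have "measure_pmf.expectation (map_pmf (\<lambda>xs. xs ! \<tau>) ?P) (excess M) = measure_pmf.expectation \<mu> (excess M)"
      unfolding law ..
    then show "measure_pmf.expectation ?P (\<lambda>xs. excess M (xs ! \<tau>)) = measure_pmf.expectation \<mu> (excess M)"
      by simp
  qed
  have ind: "integrable (measure_pmf ?P) (indicator B :: _ \<Rightarrow> real)" for B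
    by (rule measure_pmf.integrable_const_bound[where B = 1]) auto
  have fi: "integrable (measure_pmf ?P) (f \<tau>)" if "\<tau> \<in> {t..<t'}" for \<tau>
    unfolding f_def using iex(1)[OF that] ind
    by (intro Bochner_Integration.integrable_add integrable_mult_right) auto
  have fe: "measure_pmf.expectation ?P (f \<tau>)
      \<le> 2 * real M * p + measure_pmf.expectation \<mu> (\<lambda>x. real (len x) ^ 4) / real M"
    if "\<tau> \<in> {t..<t'}" for \<tau>
  proof -
    have "measure_pmf.expectation ?P (f \<tau>) = real M * measure_pmf.prob ?P (?A \<tau>)
        + real M * measure_pmf.prob ?P (?F \<tau>) + measure_pmf.expectation \<mu> (excess M)"
      unfolding f_def using iex[OF that] ind by simp
    also have "\<dots> \<le> real M * p + real M * p + measure_pmf.expectation \<mu> (\<lambda>x. real (len x) ^ 4) / real M"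
      using track[OF that] phi[OF that] expectation_excess[OF assms(1)]
      by (intro add_mono mult_left_mono) auto
    finally show ?thesis by (simp add: mult_ac)
  qed
  have le: "real (bad_length \<phi> M R t t' xs) \<le> (\<Sum>\<tau>\<in>{t..<t'}. f \<tau> xs)" for xs
    unfolding bad_length_def of_nat_sum
  proof (rule sum_mono)
    fix \<tau>
    show "real (if good_time \<phi> M R t xs \<tau> then 0 else len (xs ! \<tau>)) \<le> f \<tau> xs"
      by (auto simp: good_time_def f_def excess_def indicator_def)
  qed
  have "measure_pmf.prob ?P {xs. real (bad_length \<phi> M R t t' xs) \<ge> b}
      \<le> measure_pmf.prob ?P {xs. (\<Sum>\<tau>\<in>{t..<t'}. f \<tau> xs) \<ge> b}"
    by (rule prob_mono_support) (use le in \<open>auto intro: order_trans\<close>)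
  also have "\<dots> \<le> measure_pmf.expectation ?P (\<lambda>xs. \<Sum>\<tau>\<in>{t..<t'}. f \<tau> xs) / b"
    using assms(2) fi f0 by (intro pmf_Markov Bochner_Integration.integrable_sum) (auto intro!: sum_nonneg)
  also have "measure_pmf.expectation ?P (\<lambda>xs. \<Sum>\<tau>\<in>{t..<t'}. f \<tau> xs)
      = (\<Sum>\<tau>\<in>{t..<t'}. measure_pmf.expectation ?P (f \<tau>))"
    using fi by (intro Bochner_Integration.integral_sum) auto
  also have "\<dots> \<le> real (card {t..<t'}) *
      (2 * real M * p + measure_pmf.expectation \<mu> (\<lambda>x. real (len x) ^ 4) / real M)"
    using fe by (intro sum_bounded_above) auto
  finally show ?thesis using assms(2) by (simp add: divide_right_mono)
qed

end

section \<open>Paths are typical with high probability\<close>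

context hyperbolic_walk_hom
begin

text \<open>The window from \<open>t n\<close> to \<open>t' n\<close> has length about \<omega> n:
  long enough for the heights it crosses to be linear in n, short enough for \<open>\<phi>\<close>
  to be unlikely to move by \<open>\<epsilon> * sqrt n\<close> up to a given time in it. Then the
  expected length of bad steps is a small part of the range of heights.\<close>

lemma typical_prob:
  fixes t :: "nat \<Rightarrow> nat"
  assumes pos: "\<theta> > 0" "\<epsilon> > 0" "c0 > 0" "\<kappa> > 0"
    and small: "\<kappa> \<le> 1 / 4" "rate * \<kappa> \<le> c0 / 2"
    and lim: "(\<lambda>n. real (t n) / real n) \<longlonglongrightarrow> \<kappa>"
  obtains n0 M t' h1 h2 where "\<And>n. n \<ge> n0 \<Longrightarrow> t n \<le> t' n \<and> t' n \<le> n \<and> real (h2 n) \<le> c0 * real n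
    \<and> measure_pmf.prob (replicate_pmf n \<mu>)
        {xs. \<not> typical \<phi> M (\<epsilon> * sqrt (real n)) (t n) (t' n) (h1 n) (h2 n) xs} \<le> \<theta>"
proof -
  define M4 where "M4 = measure_pmf.expectation \<mu> (\<lambda>x. real (len x) ^ 4)"
  \<comment> \<open>Writing b for the window length \<open>\<omega> * n\<close>, the mean bad length
    will be at most \<open>3 * \<zeta> * b\<close> and the threshold is \<open>rate * b / 8\<close>;
    Markov's inequality then gives \<open>\<theta> / 2\<close>.\<close>
  define \<zeta> where "\<zeta> = \<theta> * rate / 48"
  have \<zeta>: "\<zeta> > 0" using pos rate_pos by (simp add: \<zeta>_def)
  define M where "M = nat \<lceil>M4 / \<zeta>\<rceil> + 1"
  have M: "M \<ge> 1" by (simp add: M_def)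
  have M_ge: "M4 / real M \<le> \<zeta>"
  proof -
    have "M4 / \<zeta> \<le> real M" unfolding M_def by linarith
    then show ?thesis using \<zeta> M by (simp add: field_simps)
  qed
  \<comment> \<open>Three constraints: the window ends before time \<open>n\<close>, the heights
    stay below \<open>c0 * n\<close>, and the variance of \<open>\<phi>\<close> over the window is
    small against \<open>\<epsilon> ^ 2 * n\<close>. The last depends on \<open>M\<close>, which is
    therefore fixed earlier; \<open>\<sigma>2 + 1\<close> keeps the denominator positive.\<close>
  define \<omega> where "\<omega> = min (1 / 4) (min (c0 / (2 * rate)) (\<zeta> * \<epsilon> ^ 2 / (real M * (\<sigma>2 + 1))))"
  have \<omega>: "\<omega> > 0" unfolding \<omega>_def using pos rate_pos \<zeta> M sigma2_nonneg by (simp add: add_nonneg_pos)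
  have \<omega>1: "\<omega> \<le> 1 / 4" unfolding \<omega>_def by (rule min.cobounded1)
  have \<omega>2: "rate * \<omega> \<le> c0 / 2"
  proof -
    have "\<omega> \<le> c0 / (2 * rate)" by (simp add: \<omega>_def)
    then have "rate * \<omega> \<le> rate * (c0 / (2 * rate))" using rate_pos by (intro mult_left_mono) auto
    then show ?thesis using rate_pos by simp
  qed
  have \<omega>3: "\<omega> * \<sigma>2 / \<epsilon> ^ 2 \<le> \<zeta> / real M"
  proof -
    have "\<omega> \<le> \<zeta> * \<epsilon> ^ 2 / (real M * (\<sigma>2 + 1))" by (simp add: \<omega>_def)
    then have "\<omega> * (real M * (\<sigma>2 + 1)) \<le> \<zeta> * \<epsilon> ^ 2"
      using M sigma2_nonneg by (subst (asm) pos_le_divide_eq) (auto intro!: mult_pos_pos)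
    moreover have "\<omega> * (real M * \<sigma>2) \<le> \<omega> * (real M * (\<sigma>2 + 1))" using \<omega> M by (intro mult_left_mono) auto
    ultimately have "\<omega> * (real M * \<sigma>2) \<le> \<zeta> * \<epsilon> ^ 2" by linarith
    then show ?thesis using M pos by (simp add: field_simps)
  qed
  obtain n1 where n1: "\<And>n \<tau>. n \<ge> n1 \<Longrightarrow> \<kappa> / 2 * real n \<le> real \<tau> \<Longrightarrow> real \<tau> \<le> (1 - \<kappa> / 2) * real n \<Longrightarrow>
    measure_pmf.prob (replicate_pmf n \<mu>)
      {xs. norm_wp (take \<tau> xs) - gp (wp (take \<tau> xs)) (wp xs) > \<epsilon> * sqrt (real n)} \<le> \<zeta> / real M"
    using tracking[of "\<zeta> / real M" \<epsilon> "\<kappa> / 2"] \<zeta> M pos by auto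
  \<comment> \<open>At any time up to \<open>n\<close> the length then deviates from its linear
    value by at most a sixteenth of \<open>rate * \<omega> * n\<close>.\<close>
  define \<eta> where "\<eta> = \<omega> * rate / 16"
  have \<eta>: "\<eta> > 0" using \<omega> rate_pos by (simp add: \<eta>_def)
  obtain k0 where k0: "\<And>n. measure_pmf.prob (replicate_pmf n \<mu>)
    {xs. \<exists>i\<in>{k0..n}. \<bar>norm_wp (take i xs) - rate * real i\<bar> > \<eta> * real i} \<le> \<theta> / 2"
    using uniform_rate[of "\<theta> / 2" \<eta>] pos \<eta> by auto
  define w where "w n = nat \<lfloor>\<omega> * real n\<rfloor>" for n :: nat
  define t' where "t' n = t n + w n" for n
  \<comment> \<open>The walk is near height \<open>rate * \<kappa> * n\<close> at the start of the
    window and near \<open>rate * (\<kappa> + \<omega>) * n\<close> at its end. The offsets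
    \<open>\<omega> / 8\<close> and \<open>3 / 4 * \<omega>\<close> leave margins for the error of
    \<open>t n\<close>, the deviation of the length, and rounding.\<close>
  define h1 where "h1 n = nat \<lceil>rate * (\<kappa> + \<omega> / 8) * real n\<rceil>" for n :: nat
  define h2 where "h2 n = nat \<lfloor>rate * (\<kappa> + 3 / 4 * \<omega>) * real n\<rfloor>" for n :: nat
  define \<beta> where "\<beta> = min (\<omega> / 16) (\<kappa> / 2)"
  have \<beta>: "\<beta> > 0" "\<beta> \<le> \<omega> / 16" "\<beta> \<le> \<kappa> / 2" using \<omega> pos by (auto simp: \<beta>_def)
  have "\<forall>\<^sub>F n in sequentially. dist (real (t n) / real n) \<kappa> < \<beta>" using lim \<beta>(1) by (rule tendstoD)
  moreover have "\<forall>\<^sub>F n in sequentially. x \<le> b * real n" if "b > 0" for b x :: real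
    using that by real_asymp
  from this[of "rate * \<omega> / 8" 2] this[of "\<omega> / 16" 1] this[of "\<kappa> / 2" "real k0"]
  have "\<forall>\<^sub>F n in sequentially. 2 \<le> rate * \<omega> / 8 * real n" "\<forall>\<^sub>F n in sequentially. 1 \<le> \<omega> / 16 * real n"
    "\<forall>\<^sub>F n in sequentially. real k0 \<le> \<kappa> / 2 * real n" using \<omega> rate_pos pos by auto
  ultimately have "\<forall>\<^sub>F n in sequentially. dist (real (t n) / real n) \<kappa> < \<beta> \<and> 2 \<le> rate * \<omega> / 8 * real n
      \<and> 1 \<le> \<omega> / 16 * real n \<and> real k0 \<le> \<kappa> / 2 * real n \<and> n \<ge> n1 \<and> n \<ge> 1"
    using eventually_ge_at_top[of n1] eventually_ge_at_top[of 1] by eventually_elim simp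
  then obtain n0 where n0: "\<And>n. n \<ge> n0 \<Longrightarrow> dist (real (t n) / real n) \<kappa> < \<beta> \<and> 2 \<le> rate * \<omega> / 8 * real n
      \<and> 1 \<le> \<omega> / 16 * real n \<and> real k0 \<le> \<kappa> / 2 * real n \<and> n \<ge> n1 \<and> n \<ge> 1"
    by (auto simp: eventually_sequentially)
  show thesis
  proof (rule that[of n0 t' h2 M h1])
    fix n assume n: "n \<ge> n0"
    note N = n0[OF n]
    have np: "real n > 0" using N by simp
    let ?P = "replicate_pmf n \<mu>"
    let ?n = "real n"
    let ?R = "\<epsilon> * sqrt (real n)"
    have R: "?R > 0" "?R ^ 2 = \<epsilon> ^ 2 * ?n" using pos np by (auto simp: power_mult_distrib)
    have t_up: "real (t n) \<le> (\<kappa> + \<beta>) * ?n" and t_lo: "real (t n) \<ge> (\<kappa> - \<beta>) * ?n"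
    proof -
      have "\<bar>real (t n) / ?n - \<kappa>\<bar> < \<beta>" using N by (simp add: dist_real_def)
      then have "real (t n) / ?n \<le> \<kappa> + \<beta>" "\<kappa> - \<beta> \<le> real (t n) / ?n" by linarith+
      then show "real (t n) \<le> (\<kappa> + \<beta>) * ?n" "real (t n) \<ge> (\<kappa> - \<beta>) * ?n"
        using np by (simp_all add: pos_divide_le_eq pos_le_divide_eq)
    qed
    have w_up: "real (w n) \<le> \<omega> * ?n" and w_lo: "real (w n) \<ge> \<omega> * ?n - 1"
      unfolding w_def using \<omega> np by (simp_all add: of_nat_floor)
    define a b where "a = \<kappa> * ?n" and "b = \<omega> * ?n"
    have ab: "a \<le> ?n / 4" "b \<le> ?n / 4" "b > 0" "a > 0" using small(1) \<omega>1 \<omega> pos np by (auto simp: a_def b_def)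
    have \<beta>b: "\<beta> * ?n \<le> b / 16" "\<beta> * ?n \<le> a / 2"
      using \<beta> np by (auto simp: a_def b_def intro: order_trans[OF mult_right_mono])
    have b16: "1 \<le> b / 16" using N by (simp add: b_def)
    have T: "real (t n) \<le> a + b / 16" "real (t n) \<ge> a - b / 16" "real (t n) \<ge> a / 2"
      using t_up t_lo \<beta>b by (auto simp: a_def[symmetric] algebra_simps)
    have W: "real (w n) \<le> b" "real (w n) \<ge> b - 1" using w_up w_lo by (auto simp: b_def)
    have T': "real (t' n) \<ge> a + 7 / 8 * b" "real (t' n) \<le> a + 17 / 16 * b"
      using T W b16 by (auto simp: t'_def)
    have t't: "t n \<le> t' n" by (simp add: t'_def)
    have t'n: "t' n \<le> n" using T' ab by linarith
    have k0t: "k0 \<le> t n" using N T(3) by (simp add: a_def)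
    have rb: "2 \<le> rate * b / 8" using N by (simp add: b_def)
    have h1_ge: "real (h1 n) \<ge> rate * a + rate * b / 8" and h1_le: "real (h1 n) \<le> rate * a + rate * b / 8 + 1"
    proof -
      have e: "rate * (\<kappa> + \<omega> / 8) * ?n = rate * a + rate * b / 8" by (simp add: a_def b_def algebra_simps)
      have p: "rate * a + rate * b / 8 \<ge> 0" using rate_pos ab by simp
      show "real (h1 n) \<ge> rate * a + rate * b / 8" unfolding h1_def e by linarith
      show "real (h1 n) \<le> rate * a + rate * b / 8 + 1" unfolding h1_def e using p by linarith
    qed
    have h2_ge: "real (h2 n) \<ge> rate * a + 3 / 4 * (rate * b) - 1" and h2_le: "real (h2 n) \<le> rate * a + 3 / 4 * (rate * b)"
    proof -
      have e: "rate * (\<kappa> + 3 / 4 * \<omega>) * ?n = rate * a + 3 / 4 * (rate * b)" by (simp add: a_def b_def algebra_simps)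
      have p: "rate * a + 3 / 4 * (rate * b) \<ge> 0" using rate_pos ab by simp
      show "real (h2 n) \<ge> rate * a + 3 / 4 * (rate * b) - 1" unfolding h2_def e by linarith
      show "real (h2 n) \<le> rate * a + 3 / 4 * (rate * b)" unfolding h2_def e using p by linarith
    qed
    have dh: "real (h2 n) - real (h1 n) \<ge> rate * b / 4" using h2_ge h1_le rb by linarith
    have h2c: "real (h2 n) \<le> c0 * ?n"
    proof -
      have "rate * a \<le> c0 / 2 * ?n" "rate * b \<le> c0 / 2 * ?n"
        using mult_right_mono[OF small(2), of ?n] mult_right_mono[OF \<omega>2, of ?n] by (simp_all add: a_def b_def)
      moreover have "rate * b \<ge> 0" using rate_pos ab by simp
      ultimately show ?thesis using h2_le by linarith
    qed
    define bb where "bb = rate * b / 8"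
    have bb: "bb > 0" using rb by (simp add: bb_def)
    let ?L = "\<lambda>xs. \<exists>i\<in>{k0..n}. \<bar>norm_wp (take i xs) - rate * real i\<bar> > \<eta> * real i"
    let ?B = "\<lambda>xs. real (bad_length \<phi> M ?R (t n) (t' n) xs) \<ge> bb"
    have "measure_pmf.prob ?P {xs. \<not> typical \<phi> M ?R (t n) (t' n) (h1 n) (h2 n) xs}
        \<le> measure_pmf.prob ?P {xs. ?L xs \<or> ?B xs}"
    proof (rule prob_mono_support, rule ccontr)
      fix xs assume nt: "\<not> typical \<phi> M ?R (t n) (t' n) (h1 n) (h2 n) xs" and no: "\<not> (?L xs \<or> ?B xs)"
      have \<eta>n: "\<eta> * real i \<le> rate * b / 16" if "i \<le> n" for i
      proof -
        have "\<eta> * real i \<le> \<eta> * ?n" using that \<eta> by (intro mult_left_mono) auto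
        then show ?thesis by (simp add: \<eta>_def b_def algebra_simps)
      qed
      have "\<bar>norm_wp (take (t n) xs) - rate * real (t n)\<bar> \<le> \<eta> * real (t n)"
        using no k0t t't t'n by (auto simp: not_less)
      then have "norm_wp (take (t n) xs) \<le> rate * real (t n) + rate * b / 16"
        using \<eta>n[of "t n"] t't t'n by linarith
      also have "rate * real (t n) \<le> rate * (a + b / 16)" using T rate_pos by (intro mult_left_mono) auto
      finally have "norm_wp (take (t n) xs) \<le> real (h1 n)" using h1_ge by (simp add: algebra_simps)
      then have 1: "len (wp (take (t n) xs)) \<le> h1 n" by (simp add: norm_wp_def)
      have "\<bar>norm_wp (take (t' n) xs) - rate * real (t' n)\<bar> \<le> \<eta> * real (t' n)"
        using no k0t t't t'n by (auto simp: not_less)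
      then have "norm_wp (take (t' n) xs) \<ge> rate * real (t' n) - rate * b / 16"
        using \<eta>n[of "t' n"] t'n by linarith
      moreover have "rate * real (t' n) \<ge> rate * (a + 7 / 8 * b)" using T' rate_pos by (intro mult_left_mono) auto
      moreover have "rate * (a + 7 / 8 * b) = rate * a + 7 / 8 * (rate * b)" by (simp add: algebra_simps)
      ultimately have "norm_wp (take (t' n) xs) \<ge> real (h2 n)" using h2_le rb by linarith
      then have 2: "h2 n \<le> len (wp (take (t' n) xs))" by (simp add: norm_wp_def)
      have "real (bad_length \<phi> M ?R (t n) (t' n) xs) < bb" using no by simp
      then have "real (2 * bad_length \<phi> M ?R (t n) (t' n) xs) < real (h2 n) - real (h1 n)"
        using dh unfolding bb_def by simp
      then have 3: "2 * bad_length \<phi> M ?R (t n) (t' n) xs < h2 n - h1 n" by linarith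
      show False using nt 1 2 3 by (simp add: typical_def)
    qed
    also have "\<dots> \<le> measure_pmf.prob ?P {xs. ?L xs} + measure_pmf.prob ?P {xs. ?B xs}"
      by (rule prob_Un_le)
    also have "measure_pmf.prob ?P {xs. ?L xs} \<le> \<theta> / 2" by (rule k0)
    also have "measure_pmf.prob ?P {xs. ?B xs}
        \<le> real (t' n - t n) * (2 * real M * (\<zeta> / real M) + measure_pmf.expectation \<mu> (\<lambda>x. real (len x) ^ 4) / real M) / bb"
    proof (rule prob_bad_length[OF M bb t'n])
      show "\<zeta> / real M \<ge> 0" using \<zeta> by simp
      fix \<tau> assume \<tau>: "\<tau> \<in> {t n..<t' n}"
      show "measure_pmf.prob ?P {xs. norm_wp (take \<tau> xs) - gp (wp (take \<tau> xs)) (wp xs) > ?R} \<le> \<zeta> / real M"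
      proof (rule n1)
        show "n \<ge> n1" using N by blast
        show "\<kappa> / 2 * real n \<le> real \<tau>" using \<tau> T(3) by (simp add: a_def)
        have "real \<tau> \<le> a + 17 / 16 * b" using \<tau> T'(2) by auto
        moreover have "(1 - \<kappa> / 2) * real n = ?n - a / 2" by (simp add: a_def algebra_simps)
        ultimately show "real \<tau> \<le> (1 - \<kappa> / 2) * real n" using ab by linarith
      qed
      have "measure_pmf.prob ?P {xs. \<bar>\<phi> (wp (take \<tau> xs)) - \<phi> (wp (take (t n) xs))\<bar> > ?R}
          \<le> real (\<tau> - t n) * \<sigma>2 / ?R ^ 2"
        using \<tau> t'n R by (intro prob_phi_increment) auto
      also have "\<dots> \<le> b * \<sigma>2 / ?R ^ 2"
      proof (intro divide_right_mono mult_right_mono sigma2_nonneg)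
        have "\<tau> - t n \<le> w n" using \<tau> by (auto simp: t'_def)
        then show "real (\<tau> - t n) \<le> b" using W by linarith
      qed simp
      also have "\<dots> = \<omega> * \<sigma>2 / \<epsilon> ^ 2" unfolding R(2) using np by (simp add: b_def)
      finally show "measure_pmf.prob ?P {xs. \<bar>\<phi> (wp (take \<tau> xs)) - \<phi> (wp (take (t n) xs))\<bar> > ?R} \<le> \<zeta> / real M"
        using \<omega>3 by linarith
    qed
    also have "\<dots> \<le> b * (3 * \<zeta>) / bb"
    proof (intro divide_right_mono mult_mono)
      show "real (t' n - t n) \<le> b" using W by (simp add: t'_def)
      have twice: "2 * real M * (\<zeta> / real M) = 2 * \<zeta>" using M by simp
      show "2 * real M * (\<zeta> / real M) + measure_pmf.expectation \<mu> (\<lambda>x. real (len x) ^ 4) / real M \<le> 3 * \<zeta>"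
        unfolding twice using M_ge unfolding M4_def by linarith
    qed (use bb ab \<zeta> in auto)
    also have "\<dots> = \<theta> / 2" unfolding bb_def \<zeta>_def using ab rate_pos by simp
    finally have "measure_pmf.prob ?P {xs. \<not> typical \<phi> M ?R (t n) (t' n) (h1 n) (h2 n) xs} \<le> \<theta>" by simp
    then show "t n \<le> t' n \<and> t' n \<le> n \<and> real (h2 n) \<le> c0 * real n
      \<and> measure_pmf.prob ?P {xs. \<not> typical \<phi> M ?R (t n) (t' n) (h1 n) (h2 n) xs} \<le> \<theta>"
      using t't t'n h2c by blast
  qed
qed

text \<open>The conclusion concerns any two paths of a fixed set \<open>T n\<close> and involves no
  coupling. As both marginals of the noise are \<open>\<mu>\<close>, the same set will serve both
  coordinates and both correlations.\<close>

lemma endpoint_determines_value: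
  fixes t :: "nat \<Rightarrow> nat"
  assumes pos: "\<theta> > 0" "\<epsilon> > 0" "c0 > 0" "\<kappa> > 0"
    and small: "\<kappa> \<le> 1 / 4" "rate * \<kappa> \<le> c0 / 2"
    and lim: "(\<lambda>n. real (t n) / real n) \<longlonglongrightarrow> \<kappa>"
  obtains n0 T where "\<And>n. n \<ge> n0 \<Longrightarrow> measure_pmf.prob (replicate_pmf n \<mu>) {xs. xs \<notin> T n} \<le> \<theta>"
    and "\<And>n xs ys g. \<lbrakk>n \<ge> n0; xs \<in> T n; ys \<in> T n; set xs \<subseteq> carrier G; set ys \<subseteq> carrier G; length xs = n;
      length ys = n; g \<in> carrier G; gp (wp xs) g \<ge> c0 * real n; gp (wp ys) g \<ge> c0 * real n\<rbrakk>
      \<Longrightarrow> \<bar>\<phi> (wp (take (t n) xs)) - \<phi> (wp (take (t n) ys))\<bar> \<le> \<epsilon> * sqrt (real n)"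
proof -
  \<comment> \<open>The bound of \<open>typical_agree\<close> is \<open>2 * C + 2\<close> times the
    tracking error plus constants, for which one more such error is reserved.\<close>
  define \<epsilon>' where "\<epsilon>' = \<epsilon> / (2 * C + 3)"
  have \<epsilon>': "\<epsilon>' > 0" using pos C_nonneg by (simp add: \<epsilon>'_def)
  obtain n1 M t' h1 h2 where n1: "\<And>n. n \<ge> n1 \<Longrightarrow> t n \<le> t' n \<and> t' n \<le> n \<and> real (h2 n) \<le> c0 * real n
    \<and> measure_pmf.prob (replicate_pmf n \<mu>)
        {xs. \<not> typical \<phi> M (\<epsilon>' * sqrt (real n)) (t n) (t' n) (h1 n) (h2 n) xs} \<le> \<theta>"
    using typical_prob[OF pos(1) \<epsilon>' pos(3,4) small lim] by metis
  have "\<forall>\<^sub>F n in sequentially. x \<le> \<epsilon>' * sqrt (real n)" for x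
    using \<epsilon>' by real_asymp
  then obtain n2 where n2: "\<And>n. n \<ge> n2 \<Longrightarrow> C * (2 * real M + 6 * \<delta>) \<le> \<epsilon>' * sqrt (real n)"
    by (meson eventually_sequentially)
  show thesis
  proof (rule that[of "max n1 n2" "\<lambda>n. {xs. typical \<phi> M (\<epsilon>' * sqrt (real n)) (t n) (t' n) (h1 n) (h2 n) xs}"])
    fix n xs ys g assume n: "n \<ge> max n1 n2"
      and ty: "xs \<in> {xs. typical \<phi> M (\<epsilon>' * sqrt (real n)) (t n) (t' n) (h1 n) (h2 n) xs}"
        "ys \<in> {xs. typical \<phi> M (\<epsilon>' * sqrt (real n)) (t n) (t' n) (h1 n) (h2 n) xs}"
      and xy: "set xs \<subseteq> carrier G" "set ys \<subseteq> carrier G" "length xs = n" "length ys = n"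
      and g: "g \<in> carrier G" "gp (wp xs) g \<ge> c0 * real n" "gp (wp ys) g \<ge> c0 * real n"
    have N: "t n \<le> t' n" "t' n \<le> n" "real (h2 n) \<le> c0 * real n" using n1[of n] n by auto
    define R where "R = \<epsilon>' * sqrt (real n)"
    have "\<bar>\<phi> (wp (take (t n) xs)) - \<phi> (wp (take (t n) ys))\<bar> \<le> 2 * R + C * (2 * R + 2 * real M + 6 * \<delta>)"
      by (rule typical_agree[OF xy(1,3) _ xy(2,4) _ N(1,2) g(1)])
         (use ty g N phi_lipschitz C_nonneg \<epsilon>' in \<open>auto simp: R_def\<close>)
    also have "\<dots> = (2 * C + 2) * R + C * (2 * real M + 6 * \<delta>)" by (simp add: algebra_simps)
    also have "\<dots> \<le> (2 * C + 2) * R + R" using n2[of n] n by (simp add: R_def)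
    also have "\<dots> = ((2 * C + 3) * \<epsilon>') * sqrt (real n)" by (simp add: R_def algebra_simps)
    also have "(2 * C + 3) * \<epsilon>' = \<epsilon>" using C_nonneg by (simp add: \<epsilon>'_def)
    finally show "\<bar>\<phi> (wp (take (t n) xs)) - \<phi> (wp (take (t n) ys))\<bar> \<le> \<epsilon> * sqrt (real n)" .
  qed (use n1 in auto)
qed

end

section \<open>Distinguishing the correlations\<close>

text \<open>Second moments alone are assumed because this is applied to centred squares of block
  sums: their squares are integrable by the fourth moment of the steps, their fourth powers would
  ask for an eighth.\<close>

lemma sum_list_second_moment:
  fixes f :: "'a \<Rightarrow> real"
  defines "S \<equiv> \<lambda>xs. sum_list (map f xs)"
  assumes f2: "integrable (measure_pmf p) (\<lambda>x. f x ^ 2)"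
    and f0: "measure_pmf.expectation p f = 0"
  shows "integrable (measure_pmf (replicate_pmf n p)) (\<lambda>xs. S xs ^ 2)"
    and "measure_pmf.expectation (replicate_pmf n p) (\<lambda>xs. S xs ^ 2)
      = real n * measure_pmf.expectation p (\<lambda>x. f x ^ 2)"
proof -
  have f1: "integrable (measure_pmf p) f"
  proof (rule Bochner_Integration.integrable_bound)
    show "integrable (measure_pmf p) (\<lambda>x. 1 + f x ^ 2)" using f2 by simp
    show "AE x in measure_pmf p. norm (f x) \<le> norm (1 + f x ^ 2)"
    proof (rule AE_I2)
      fix x
      have "0 \<le> (\<bar>f x\<bar> - 1) ^ 2 + f x ^ 2 + 1" by simp
      also have "(\<bar>f x\<bar> - 1) ^ 2 = f x ^ 2 - 2 * \<bar>f x\<bar> + 1" by (simp add: power2_diff)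
      finally have "\<bar>f x\<bar> \<le> 1 + f x ^ 2" by simp
      then show "norm (f x) \<le> norm (1 + f x ^ 2)" by simp
    qed
  qed simp
  have "integrable (measure_pmf (replicate_pmf n p)) S \<and> measure_pmf.expectation (replicate_pmf n p) S = 0
    \<and> integrable (measure_pmf (replicate_pmf n p)) (\<lambda>xs. S xs ^ 2)
    \<and> measure_pmf.expectation (replicate_pmf n p) (\<lambda>xs. S xs ^ 2)
      = real n * measure_pmf.expectation p (\<lambda>x. f x ^ 2)"
  proof (induction n)
    case 0
    then show ?case by (auto simp: S_def intro!: integrable_measure_pmf_finite)
  next
    case (Suc n)
    let ?r = "replicate_pmf n p"
    let ?pp = "pair_pmf p ?r"
    have S_Cons: "S (x # xs) = f x + S xs" for x xs by (simp add: S_def)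
    have i: "integrable (measure_pmf ?pp) (\<lambda>x. f (fst x))" "integrable (measure_pmf ?pp) (\<lambda>x. S (snd x))"
      "integrable (measure_pmf ?pp) (\<lambda>x. f (fst x) ^ 2)" "integrable (measure_pmf ?pp) (\<lambda>x. S (snd x) ^ 2)"
      "integrable (measure_pmf ?pp) (\<lambda>x. f (fst x) * S (snd x))"
      using expectation_mult_split(1)[of p f ?r "\<lambda>_. 1"] expectation_mult_split(1)[of p "\<lambda>_. 1" ?r S]
        expectation_mult_split(1)[of p "\<lambda>x. f x ^ 2" ?r "\<lambda>_. 1"]
        expectation_mult_split(1)[of p "\<lambda>_. 1" ?r "\<lambda>x. S x ^ 2"]
        expectation_mult_split(1)[of p f ?r S] f1 f2 Suc by simp_all
    have e: "measure_pmf.expectation ?pp (\<lambda>x. f (fst x) * S (snd x)) = 0"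
      using expectation_mult_split(2)[of p f ?r S] f1 Suc f0 by simp
    have sq: "(f (fst x) + S (snd x)) ^ 2 = f (fst x) ^ 2 + 2 * (f (fst x) * S (snd x)) + S (snd x) ^ 2" for x
      by (simp add: power2_sum)
    have "measure_pmf.expectation ?pp (\<lambda>x. (f (fst x) + S (snd x)) ^ 2)
        = measure_pmf.expectation p (\<lambda>x. f x ^ 2) + real n * measure_pmf.expectation p (\<lambda>x. f x ^ 2)"
      unfolding sq using i e Suc expectation_mult_split(2)[of p "\<lambda>x. f x ^ 2" ?r "\<lambda>_. 1"]
        expectation_mult_split(2)[of p "\<lambda>_. 1" ?r "\<lambda>x. S x ^ 2"] f2 by simp
    moreover have "integrable (measure_pmf ?pp) (\<lambda>x. (f (fst x) + S (snd x)) ^ 2)"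
      unfolding sq using i by simp
    ultimately show ?case using i f0 Suc unfolding replicate_pmf_Suc_pair
      by (simp add: case_prod_unfold S_Cons algebra_simps)
  qed
  then show "integrable (measure_pmf (replicate_pmf n p)) (\<lambda>xs. S xs ^ 2)"
    and "measure_pmf.expectation (replicate_pmf n p) (\<lambda>xs. S xs ^ 2)
      = real n * measure_pmf.expectation p (\<lambda>x. f x ^ 2)" by auto
qed

text \<open>The quadratic variation of the partial sums of \<open>f\<close>, sampled at the ends of
  \<open>K\<close> blocks.\<close>

definition block_variation :: "('a \<Rightarrow> real) \<Rightarrow> nat \<Rightarrow> nat \<Rightarrow> 'a list \<Rightarrow> real" where
  "block_variation f K s xs = (\<Sum>k<K. sum_list (map f (take s (drop (k * s) xs))) ^ 2)"

lemma take_drop_concat: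
  "(\<And>b. b \<in> set bs \<Longrightarrow> length b = s) \<Longrightarrow> k < length bs \<Longrightarrow> take s (drop (k * s) (concat bs)) = bs ! k"
proof (induction bs arbitrary: k)
  case (Cons b bs)
  then show ?case by (cases k) auto
qed simp

lemma block_variation_take:
  assumes "k * s \<le> m"
  shows "block_variation f k s (take m xs) = block_variation f k s xs"
proof -
  have "take s (drop (i * s) (take m xs)) = take s (drop (i * s) xs)" if "i < k" for i
  proof -
    have "(i + 1) * s \<le> k * s" using that by (intro mult_right_mono) auto
    then have "s \<le> m - i * s" using assms by simp
    then show ?thesis by (simp add: drop_take min_def)
  qed
  then show ?thesis by (simp add: block_variation_def)
qed

text \<open>Chebyshev's inequality over \<open>K\<close> independent squared block sums. Each has
  variance at most 4 s^2 m4, so after division by \<open>s\<close> the bound depends on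
  \<open>K\<close> only, and \<open>K\<close> may stay fixed while \<open>s\<close> grows with
  \<open>n\<close>.\<close>

lemma prob_block_variation:
  fixes f :: "'a \<Rightarrow> real" and p :: "'a pmf"
  defines "m2 \<equiv> measure_pmf.expectation p (\<lambda>x. f x ^ 2)"
    and "m4 \<equiv> measure_pmf.expectation p (\<lambda>x. f x ^ 4)"
  assumes f4: "integrable (measure_pmf p) (\<lambda>x. f x ^ 4)"
    and f0: "measure_pmf.expectation p f = 0"
    and K: "K \<ge> 1" "s \<ge> 1" "K * s \<le> n" and \<eta>: "\<eta> > 0"
  shows "measure_pmf.prob (replicate_pmf n p)
      {xs. \<bar>block_variation f K s xs / (real K * real s) - m2\<bar> > \<eta>} \<le> 4 * m4 / (real K * \<eta> ^ 2)"
proof -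
  let ?P = "replicate_pmf s p"
  define S where "S = (\<lambda>xs. sum_list (map f xs))"
  define q where "q b = S b ^ 2 - real s * m2" for b
  have S2: "integrable (measure_pmf ?P) (\<lambda>b. S b ^ 2)" and S4: "integrable (measure_pmf ?P) (\<lambda>b. S b ^ 4)"
    unfolding S_def by (intro integrable_sum_list_power f4; simp)+
  have ES2: "measure_pmf.expectation ?P (\<lambda>b. S b ^ 2) = real s * m2"
    and ES4: "measure_pmf.expectation ?P (\<lambda>b. S b ^ 4) \<le> 4 * real s ^ 2 * m4"
    using sum_list_moments[OF f4 f0, of s] by (auto simp: S_def m2_def m4_def)
  have q0: "measure_pmf.expectation ?P q = 0" unfolding q_def using S2 ES2 by simp
  have q_sq: "q b ^ 2 = S b ^ 4 - 2 * (real s * m2) * S b ^ 2 + (real s * m2) ^ 2" for b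
    by (simp add: q_def power2_diff flip: power_mult)
  have q2: "integrable (measure_pmf ?P) (\<lambda>b. q b ^ 2)" unfolding q_sq using S2 S4 by simp
  have Eq2: "measure_pmf.expectation ?P (\<lambda>b. q b ^ 2) \<le> 4 * real s ^ 2 * m4"
  proof -
    have "measure_pmf.expectation ?P (\<lambda>b. q b ^ 2)
        = measure_pmf.expectation ?P (\<lambda>b. S b ^ 4) - 2 * (real s * m2) * (real s * m2) + (real s * m2) ^ 2"
      unfolding q_sq using S2 S4 ES2 by simp
    also have "\<dots> \<le> measure_pmf.expectation ?P (\<lambda>b. S b ^ 4)"
      using zero_le_power2[of "real s * m2"] unfolding power2_eq_square by linarith
    finally show ?thesis using ES4 by linarith
  qed
  define c where "c = real K * real s * \<eta>"
  have Ks: "real K * real s > 0" using K by simp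
  have c: "c > 0" using Ks \<eta> by (simp add: c_def)
  have "measure_pmf.prob (replicate_pmf n p) {xs. \<bar>block_variation f K s xs / (real K * real s) - m2\<bar> > \<eta>}
      = measure_pmf.prob (map_pmf (take (K * s)) (replicate_pmf n p))
          {xs. \<bar>block_variation f K s xs / (real K * real s) - m2\<bar> > \<eta>}"
    unfolding prob_map_pmf by (simp add: block_variation_take)
  also have "map_pmf (take (K * s)) (replicate_pmf n p) = map_pmf concat (replicate_pmf K ?P)"
    using K by (simp add: take_replicate_pmf concat_replicate_pmf)
  also have "measure_pmf.prob (map_pmf concat (replicate_pmf K ?P))
          {xs. \<bar>block_variation f K s xs / (real K * real s) - m2\<bar> > \<eta>}
      \<le> measure_pmf.prob (replicate_pmf K ?P) {bs. sum_list (map q bs) ^ 2 \<ge> c ^ 2}"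
    unfolding prob_map_pmf mem_Collect_eq
  proof (rule prob_mono_support)
    fix bs assume bs: "bs \<in> set_pmf (replicate_pmf K ?P)"
      and big: "\<bar>block_variation f K s (concat bs) / (real K * real s) - m2\<bar> > \<eta>"
    have len: "length bs = K" "\<And>b. b \<in> set bs \<Longrightarrow> length b = s"
      using length_replicate_pmf[OF bs] set_replicate_pmf_subset[OF bs] length_replicate_pmf by auto
    have "block_variation f K s (concat bs) = (\<Sum>k<K. S (bs ! k) ^ 2)"
      unfolding block_variation_def S_def using len by (intro sum.cong) (simp_all add: take_drop_concat)
    also have "\<dots> = sum_list (map (\<lambda>b. S b ^ 2) bs)"
      using len by (simp add: sum_list_sum_nth atLeast0LessThan)
    also have "\<dots> = sum_list (map q bs) + real K * (real s * m2)"
      unfolding len(1)[symmetric] q_def by (induction bs) (auto simp: algebra_simps)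
    finally have "block_variation f K s (concat bs) / (real K * real s) - m2 = sum_list (map q bs) / (real K * real s)"
      using K by (simp add: field_simps)
    then have "\<eta> < \<bar>sum_list (map q bs)\<bar> / (real K * real s)" using big Ks by simp
    then have "c \<le> \<bar>sum_list (map q bs)\<bar>" using Ks by (simp add: c_def field_simps)
    then have "c ^ 2 \<le> \<bar>sum_list (map q bs)\<bar> ^ 2" using c by (intro power_mono) auto
    then show "sum_list (map q bs) ^ 2 \<ge> c ^ 2" by simp
  qed
  also have "\<dots> \<le> measure_pmf.expectation (replicate_pmf K ?P) (\<lambda>bs. sum_list (map q bs) ^ 2) / c ^ 2"
    using c by (intro pmf_Markov sum_list_second_moment q2 q0) auto
  also have "\<dots> = real K * measure_pmf.expectation ?P (\<lambda>b. q b ^ 2) / c ^ 2"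
    by (subst sum_list_second_moment(2)[OF q2 q0]) simp
  also have "\<dots> \<le> real K * (4 * real s ^ 2 * m4) / c ^ 2"
    using Eq2 by (intro divide_right_mono mult_left_mono) auto
  also have "\<dots> = 4 * m4 / (real K * \<eta> ^ 2)"
    unfolding c_def using K \<eta> by (simp add: field_simps power2_eq_square)
  finally show ?thesis .
qed

section \<open>Marginals and variance of the noise\<close>

lemma map_fst_noise: "map_pmf fst (noise \<mu> \<rho>) = \<mu>"
  and map_snd_noise: "map_pmf snd (noise \<mu> \<rho>) = \<mu>"
proof -
  have "(\<lambda>b. map_pmf fst (if b then pair_pmf \<mu> \<mu> else map_pmf (\<lambda>x. (x, x)) \<mu>)) = (\<lambda>b. \<mu>)"
    "(\<lambda>b. map_pmf snd (if b then pair_pmf \<mu> \<mu> else map_pmf (\<lambda>x. (x, x)) \<mu>)) = (\<lambda>b. \<mu>)"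
    by (auto simp: fun_eq_iff map_fst_pair_pmf map_snd_pair_pmf pmf.map_comp o_def)
  then show "map_pmf fst (noise \<mu> \<rho>) = \<mu>" "map_pmf snd (noise \<mu> \<rho>) = \<mu>"
    by (simp_all add: noise_def map_bind_pmf)
qed

text \<open>The marginals do not see \<open>\<rho>\<close>, but the difference of the coordinates
  does: it vanishes on the diagonal part and has variance twice that of \<open>\<phi>\<close> on the
  independent part, which carries weight \<open>\<rho>\<close>.\<close>

lemma noise_moments:
  fixes \<phi> :: "'a \<Rightarrow> real"
  defines "f \<equiv> \<lambda>x. \<phi> (fst x) - \<phi> (snd x)"
  assumes \<rho>: "\<rho> \<in> {0..1}" and \<phi>4: "integrable (measure_pmf \<mu>) (\<lambda>x. \<phi> x ^ 4)"
    and \<phi>0: "measure_pmf.expectation \<mu> \<phi> = 0"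
  shows "integrable (measure_pmf (noise \<mu> \<rho>)) (\<lambda>x. f x ^ 4)"
    and "measure_pmf.expectation (noise \<mu> \<rho>) f = 0"
    and "measure_pmf.expectation (noise \<mu> \<rho>) (\<lambda>x. f x ^ 2) = 2 * \<rho> * measure_pmf.expectation \<mu> (\<lambda>x. \<phi> x ^ 2)"
proof -
  let ?N = "noise \<mu> \<rho>"
  have i: "integrable (measure_pmf ?N) (\<lambda>x. g (fst x))" "integrable (measure_pmf ?N) (\<lambda>x. g (snd x))"
    if "integrable (measure_pmf \<mu>) g" for g :: "'a \<Rightarrow> real"
    using that map_fst_noise[of \<mu> \<rho>] map_snd_noise[of \<mu> \<rho>]
    by (metis integrable_map_pmf_eq, metis integrable_map_pmf_eq)
  have e: "measure_pmf.expectation ?N (\<lambda>x. g (fst x)) = measure_pmf.expectation \<mu> g"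
    "measure_pmf.expectation ?N (\<lambda>x. g (snd x)) = measure_pmf.expectation \<mu> g" for g :: "'a \<Rightarrow> real"
    using integral_map_pmf[of fst ?N g] integral_map_pmf[of snd ?N g] by (simp_all add: map_fst_noise map_snd_noise)
  have \<phi>1: "integrable (measure_pmf \<mu>) \<phi>" and \<phi>2: "integrable (measure_pmf \<mu>) (\<lambda>x. \<phi> x ^ 2)"
    using integrable_lower_power[OF \<phi>4, of 1] integrable_lower_power[OF \<phi>4, of 2] by simp_all
  show f4: "integrable (measure_pmf ?N) (\<lambda>x. f x ^ 4)"
  proof (rule Bochner_Integration.integrable_bound)
    show "integrable (measure_pmf ?N) (\<lambda>x. 8 * (\<phi> (fst x) ^ 4 + \<phi> (snd x) ^ 4))" using i[OF \<phi>4] by simp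
    have "(a - b) ^ 4 \<le> 8 * (a ^ 4 + b ^ 4)" for a b :: real
    proof -
      have sq: "(x - y) ^ 2 \<le> 2 * (x ^ 2 + y ^ 2)" "(x + y) ^ 2 \<le> 2 * (x ^ 2 + y ^ 2)" for x y :: real
        using zero_le_power2[of "x + y"] zero_le_power2[of "x - y"] by (simp_all add: power2_sum power2_diff)
      have "(a - b) ^ 4 = ((a - b) ^ 2) ^ 2" by (simp flip: power_mult)
      also have "\<dots> \<le> (2 * (a ^ 2 + b ^ 2)) ^ 2" using sq(1) by (intro power_mono) auto
      also have "\<dots> = 4 * (a ^ 2 + b ^ 2) ^ 2" unfolding power_mult_distrib by simp
      also have "\<dots> \<le> 4 * (2 * ((a ^ 2) ^ 2 + (b ^ 2) ^ 2))" by (rule mult_left_mono[OF sq(2)]) simp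
      finally show ?thesis by (simp flip: power_mult)
    qed
    then show "AE x in measure_pmf ?N. norm (f x ^ 4) \<le> norm (8 * (\<phi> (fst x) ^ 4 + \<phi> (snd x) ^ 4))"
      by (intro AE_I2) (simp add: f_def)
  qed simp
  show "measure_pmf.expectation ?N f = 0"
    unfolding f_def using i[OF \<phi>1] e[of \<phi>] \<phi>0 by simp
  have "integrable (measure_pmf (pair_pmf \<mu> \<mu>)) (\<lambda>x. \<phi> (fst x) ^ 2)"
    "integrable (measure_pmf (pair_pmf \<mu> \<mu>)) (\<lambda>x. \<phi> (snd x) ^ 2)"
    "integrable (measure_pmf (pair_pmf \<mu> \<mu>)) (\<lambda>x. \<phi> (fst x) * \<phi> (snd x))"
    using expectation_mult_split(1)[of \<mu> "\<lambda>x. \<phi> x ^ 2" \<mu> "\<lambda>_. 1"]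
      expectation_mult_split(1)[of \<mu> "\<lambda>_. 1" \<mu> "\<lambda>x. \<phi> x ^ 2"] expectation_mult_split(1)[OF \<phi>1 \<phi>1] \<phi>2 by simp_all
  note ip = this
  have fsq: "f x ^ 2 = \<phi> (fst x) ^ 2 + \<phi> (snd x) ^ 2 - 2 * (\<phi> (fst x) * \<phi> (snd x))" for x
    by (simp add: f_def power2_diff)
  have ifp: "integrable (measure_pmf (pair_pmf \<mu> \<mu>)) (\<lambda>x. f x ^ 2)" unfolding fsq using ip by simp
  have "measure_pmf.expectation (pair_pmf \<mu> \<mu>) (\<lambda>x. f x ^ 2) = 2 * measure_pmf.expectation \<mu> (\<lambda>x. \<phi> x ^ 2)"
    unfolding fsq using ip expectation_mult_split(2)[OF \<phi>1 \<phi>1] \<phi>0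
      expectation_mult_split(2)[of \<mu> "\<lambda>x. \<phi> x ^ 2" \<mu> "\<lambda>_. 1"]
      expectation_mult_split(2)[of \<mu> "\<lambda>_. 1" \<mu> "\<lambda>x. \<phi> x ^ 2"] \<phi>2 by simp
  \<comment> \<open>Nonnegative integrals are used since they split over the \<open>bind_pmf\<close>
    in \<open>noise\<close> without integrability conditions.\<close>
  then have pair: "(\<integral>\<^sup>+x. ennreal (f x ^ 2) \<partial>pair_pmf \<mu> \<mu>) = ennreal (2 * measure_pmf.expectation \<mu> (\<lambda>x. \<phi> x ^ 2))"
    using ifp by (subst nn_integral_eq_integral) auto
  have "(\<integral>\<^sup>+x. ennreal (f x ^ 2) \<partial>?N) = ennreal (2 * measure_pmf.expectation \<mu> (\<lambda>x. \<phi> x ^ 2)) * ennreal \<rho>"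
    unfolding noise_def nn_integral_bind_pmf using \<rho> pair by (simp add: f_def)
  also have "\<dots> = ennreal (2 * \<rho> * measure_pmf.expectation \<mu> (\<lambda>x. \<phi> x ^ 2))"
    using \<rho> by (simp add: ennreal_mult'[symmetric] mult_ac)
  finally have "(\<integral>\<^sup>+x. ennreal (f x ^ 2) \<partial>?N) = ennreal (2 * \<rho> * measure_pmf.expectation \<mu> (\<lambda>x. \<phi> x ^ 2))" .
  then show "measure_pmf.expectation ?N (\<lambda>x. f x ^ 2) = 2 * \<rho> * measure_pmf.expectation \<mu> (\<lambda>x. \<phi> x ^ 2)"
    using \<rho> by (subst integral_eq_nn_integral) (auto intro!: mult_nonneg_nonneg)
qed

section \<open>Comparison with a second word metric\<close>

context group
begin

text \<open>A bound on the finitely many generators and their inverses propagates along words. It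
  serves both for comparing two word lengths and for the Lipschitz bound on a homomorphism.\<close>

lemma subadditive_le_word_length:
  fixes f :: "'a \<Rightarrow> real"
  assumes S: "generating_set G S" and "f \<one> \<le> 0"
    and add: "\<And>x y. x \<in> carrier G \<Longrightarrow> y \<in> carrier G \<Longrightarrow> f (x \<otimes> y) \<le> f x + f y"
  obtains C where "C \<ge> 0" "\<And>x. x \<in> carrier G \<Longrightarrow> f x \<le> C * real (word_length G S x)"
proof -
  let ?A = "S \<union> m_inv G ` S"
  have A: "finite ?A" "?A \<subseteq> carrier G" using S by (auto simp: generating_set_def)
  define C where "C = Max (insert 0 (f ` ?A))"
  have C: "C \<ge> 0" "\<And>a. a \<in> ?A \<Longrightarrow> f a \<le> C" unfolding C_def using A(1) by auto
  have word: "foldr (\<otimes>) xs \<one> \<in> carrier G \<and> f (foldr (\<otimes>) xs \<one>) \<le> C * real (length xs)" if "set xs \<subseteq> ?A" for xs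
    using that
  proof (induction xs)
    case (Cons x xs)
    then have x: "x \<in> ?A" "x \<in> carrier G" and xs: "foldr (\<otimes>) xs \<one> \<in> carrier G"
        "f (foldr (\<otimes>) xs \<one>) \<le> C * real (length xs)" using A(2) by auto
    have "f (x \<otimes> foldr (\<otimes>) xs \<one>) \<le> C + C * real (length xs)"
      using add[OF x(2) xs(1)] C(2)[OF x(1)] xs(2) by linarith
    then show ?case using x xs by (simp add: algebra_simps)
  qed (use assms(2) in simp)
  show thesis
  proof (rule that[OF C(1)])
    fix x assume "x \<in> carrier G"
    from word_length_witness[OF S this] obtain xs where "length xs = word_length G S x"
      "set xs \<subseteq> ?A" "foldr (\<otimes>) xs \<one> = x" .
    then show "f x \<le> C * real (word_length G S x)" using word[of xs] by auto
  qed
qed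

end

lemma (in length_group) len_le_word_length:
  assumes S: "generating_set G S"
  obtains C where "C \<ge> 0" "\<And>x. x \<in> carrier G \<Longrightarrow> real (len x) \<le> C * real (word_length G S x)"
proof (rule subadditive_le_word_length[OF S, of "\<lambda>x. real (len x)"])
  show "real (len (x \<otimes> y)) \<le> real (len x) + real (len y)" if "x \<in> carrier G" "y \<in> carrier G" for x y
    using len_mult[OF that] by linarith
qed (use that in auto)

text \<open>A word from \<open>x\<close> to \<open>g\<close> of length at most \<open>\<alpha> n\<close> stays at linear distance from the identity, and
  in a hyperbolic space a path of linear length outside a ball of linear radius has endpoints with
  large Gromov product. Hence no comparison of geodesics of the two word metrics is needed.\<close>

lemma (in hyperbolic_group) gp_linear:
  assumes S: "generating_set G S" and c: "c > 0"
    and le: "\<And>x. x \<in> carrier G \<Longrightarrow> real (word_length G S x) \<le> c * real (len x)"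
    and "e > 0" "\<alpha> > 0"
  obtains n0 where "\<And>n x g. n \<ge> n0 \<Longrightarrow> x \<in> carrier G \<Longrightarrow> g \<in> carrier G \<Longrightarrow>
    real (word_length G S x) \<ge> (\<alpha> + e) * real n \<Longrightarrow> word_dist G S x g \<le> \<alpha> * real n \<Longrightarrow>
    gp x g \<ge> e / (2 * c) * real n"
proof -
  interpret W: length_group G "word_length G S" by (rule length_group_word_length[OF S])
  obtain K where K: "K \<ge> 0" "\<And>x. x \<in> carrier G \<Longrightarrow> real (len x) \<le> K * real (word_length G S x)"
    using len_le_word_length[OF S] by blast
  define A where "A = nat \<lceil>\<alpha>\<rceil>"
  have A: "\<alpha> \<le> real A" "A \<ge> 1" using assms(5) unfolding A_def by linarith+
  have pos: "e / (2 * c) > 0" using assms by simp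
  have "\<forall>\<^sub>F n in sequentially. k + (log 2 (a * real n) + 1) * d \<le> b * real n" if "a > 0" "b > 0" "d > 0" for a b d k :: real
    using that by real_asymp
  from this[of "real A" "e / (2 * c)" "\<delta> + 1" K]
  have "\<forall>\<^sub>F n in sequentially. K + (log 2 (real A * real n) + 1) * (\<delta> + 1) \<le> e / (2 * c) * real n"
    using A pos delta_nonneg by auto
  then obtain n0 where n0: "\<And>n. n \<ge> n0 \<Longrightarrow> K + (log 2 (real A * real n) + 1) * (\<delta> + 1) \<le> e / (2 * c) * real n"
    by (auto simp: eventually_sequentially)
  show thesis
  proof (rule that[of "max n0 1"])
    fix n x g assume n: "n \<ge> max n0 1" and x: "x \<in> carrier G" and g: "g \<in> carrier G"
      and far: "real (word_length G S x) \<ge> (\<alpha> + e) * real n" and close: "word_dist G S x g \<le> \<alpha> * real n"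
    have xg: "inv x \<otimes> g \<in> carrier G" using x g by simp
    obtain zs where zs: "length zs = word_length G S (inv x \<otimes> g)" "set zs \<subseteq> S \<union> m_inv G ` S"
      "foldr (\<otimes>) zs \<one> = inv x \<otimes> g" using word_length_witness[OF S xg] .
    have sz: "set zs \<subseteq> carrier G" using zs(2) S by (auto simp: generating_set_def)
    have gen: "word_length G S z \<le> 1" if "z \<in> set zs" for z
    proof -
      have "word_length G S z \<le> length [z]"
        using that zs(2) sz by (intro word_length_le) auto
      then show ?thesis by simp
    qed
    define l where "l = length zs"
    have l: "real l \<le> \<alpha> * real n" using close zs(1) by (simp add: word_dist_def l_def)
    define y where "y i = x \<otimes> wp (take i zs)" for i
    have tz: "wp (take i zs) \<in> carrier G" for i using sz by (meson wp_closed set_take_subset subset_trans)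
    have yc: "y i \<in> carrier G" for i using x tz by (simp add: y_def)
    have yl: "y l = g" using zs(3) x g by (simp add: y_def l_def wp_def m_assoc[symmetric])
    have y0: "y 0 = x" using x by (simp add: y_def)
    \<comment> \<open>In the metric of \<open>S\<close> every point of the path is within
      \<open>\<alpha> * n\<close> of \<open>x\<close>, hence at distance at least
      \<open>e * n\<close> from the identity; \<open>len\<close> retains at least the fraction
      \<open>1 / c\<close> of this.\<close>
    have far_y: "real (len (y i)) \<ge> e / c * real n" if "i \<le> l" for i
    proof -
      have "W.ldist x (y i) = real (word_length G S (wp (take i zs)))"
        unfolding W.ldist_def y_def using x tz[of i] by (simp add: m_assoc[symmetric])
      also have "\<dots> \<le> real (sum_list (map (word_length G S) (take i zs)))"
        unfolding wp_def[symmetric] using W.len_wp_le[of "take i zs"] sz set_take_subset[of i zs]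
        by (simp add: W.wp_def wp_def)
      also have "sum_list (map (word_length G S) (take i zs)) \<le> sum_list (map (\<lambda>_. 1) (take i zs))"
        using gen by (intro sum_list_mono) (auto dest: in_set_takeD)
      also have "real (sum_list (map (\<lambda>_. 1) (take i zs))) \<le> real l"
        by (simp add: sum_list_triv l_def)
      finally have "W.ldist x (y i) \<le> \<alpha> * real n" using l by simp
      then have "real (word_length G S (y i)) \<ge> e * real n"
        using W.ldist_ge[OF x yc[of i]] far by (simp add: algebra_simps)
      then have "e * real n \<le> c * real (len (y i))" using le[OF yc[of i]] by linarith
      then show ?thesis using c by (simp add: field_simps)
    qed
    \<comment> \<open>One half of the height \<open>e / c * n\<close> is given up to pay for the
      longest link \<open>K\<close> and for the logarithm.\<close>
    have half: "e / c * real n = 2 * (e / (2 * c) * real n)" using c by (simp add: field_simps)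
    have N: "K + (log 2 (real A * real n) + 1) * (\<delta> + 1) \<le> e / (2 * c) * real n" using n0 n by simp
    show "gp x g \<ge> e / (2 * c) * real n"
    proof (cases "l = 0")
      case True
      then have "g = x" using yl y0 by simp
      then show ?thesis using far_y[of 0] half x pos n y0 by (simp add: gp_def) 
    next
      case False
      have lA: "l \<le> A * n"
      proof -
        have "\<alpha> * real n \<le> real A * real n" using A by (intro mult_right_mono) auto
        then have "real l \<le> real (A * n)" using l by simp
        then show ?thesis by linarith
      qed
      have "gp (y 0) (y l) \<ge> (e / c * real n - K) - (log 2 (real (A * n)) + 1) * \<delta>"
      proof (rule gp_chain_log)
        fix i assume i: "i < l"
        have z: "zs ! i \<in> carrier G" "zs ! i \<in> set zs" using i sz by (auto simp: l_def)
        have "wp (take (Suc i) zs) = wp (take i zs) \<otimes> zs ! i"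
          using i z sz wp_append[of "take i zs" "[zs ! i]"] set_take_subset[of i zs]
          by (simp add: take_Suc_conv_app_nth l_def)
        then have "y (Suc i) = y i \<otimes> zs ! i" using x tz[of i] z by (simp add: y_def m_assoc)
        then have "ldist (y i) (y (Suc i)) = real (len (zs ! i))"
          using yc[of i] z by (simp add: ldist_def m_assoc[symmetric])
        also have "\<dots> \<le> K * 1"
          using K(2)[OF z(1)] gen[OF z(2)] K(1) mult_left_mono[of "real (word_length G S (zs ! i))" 1 K] by linarith
        finally show "gp (y i) (y (Suc i)) \<ge> e / c * real n - K"
          using gp_ge[OF yc[of i] yc[of "Suc i"]] far_y[of i] i by linarith
      qed (use yc False lA in auto)
      moreover have "(log 2 (real (A * n)) + 1) * \<delta> \<le> (log 2 (real A * real n) + 1) * (\<delta> + 1)"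
      proof -
        have "real 1 \<le> real (A * n)" using A n by (intro of_nat_mono) (simp add: Suc_le_eq)
        then have "log 2 (real (A * n)) \<ge> 0" by simp
        then show ?thesis by (simp add: algebra_simps)
      qed
      ultimately show ?thesis using N half yl y0 by simp
    qed
  qed
qed

section \<open>Convolution powers and stability of the block variation\<close>

lemma replicate_pmf_snoc:
  "replicate_pmf (Suc n) p = map_pmf (\<lambda>(xs, x). xs @ [x]) (pair_pmf (replicate_pmf n p) p)"
proof -
  have "replicate_pmf (n + 1) p
      = map_pmf (\<lambda>(xs, ys). xs @ ys) (pair_pmf (map_pmf id (replicate_pmf n p)) (map_pmf (\<lambda>x. [x]) p))"
    unfolding replicate_pmf_add replicate_pmf_1 pmf.map_id ..
  then show ?thesis unfolding map_pair[symmetric] by (simp add: pmf.map_comp o_def case_prod_unfold)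
qed

lemma (in group) convolution_power_replicate:
  assumes "set_pmf p \<subseteq> carrier G"
  shows "convolution_power G p n = map_pmf (\<lambda>xs. foldr (\<otimes>) xs \<one>) (replicate_pmf n p)"
proof (induction n)
  case (Suc n)
  let ?F = "\<lambda>xs. foldr (\<otimes>) xs \<one>"
  have snoc: "?F xs \<in> carrier G \<and> ?F (xs @ [x]) = ?F xs \<otimes> x" if "set xs \<subseteq> carrier G" "x \<in> carrier G" for xs x
    using that by (induction xs) (auto simp: m_assoc)
  have "convolution_power G p (Suc n)
      = map_pmf (\<lambda>(x, y). x \<otimes> y) (pair_pmf (map_pmf ?F (replicate_pmf n p)) (map_pmf id p))"
    by (simp add: convolution_def Suc)
  also have "\<dots> = map_pmf (\<lambda>(xs, x). ?F xs \<otimes> x) (pair_pmf (replicate_pmf n p) p)"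
    unfolding map_pair[symmetric] by (simp add: pmf.map_comp o_def case_prod_unfold)
  also have "\<dots> = map_pmf (\<lambda>(xs, x). ?F (xs @ [x])) (pair_pmf (replicate_pmf n p) p)"
  proof (rule map_pmf_cong[OF refl])
    fix z assume "z \<in> set_pmf (pair_pmf (replicate_pmf n p) p)"
    then have z: "fst z \<in> set_pmf (replicate_pmf n p)" "snd z \<in> set_pmf p" by auto
    then have "set (fst z) \<subseteq> carrier G" "snd z \<in> carrier G"
      using assms set_replicate_pmf_subset[OF z(1)] by blast+
    from snoc[OF this] show "(case z of (xs, x) \<Rightarrow> ?F xs \<otimes> x) = (case z of (xs, x) \<Rightarrow> ?F (xs @ [x]))"
      by (simp add: case_prod_unfold)
  qed
  also have "\<dots> = map_pmf ?F (replicate_pmf (Suc n) p)"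
    unfolding replicate_pmf_snoc by (simp add: pmf.map_comp o_def case_prod_unfold)
  finally show ?case .
qed simp

lemma foldr_DirProd:
  "foldr (\<otimes>\<^bsub>G \<times>\<times> H\<^esub>) zs \<one>\<^bsub>G \<times>\<times> H\<^esub>
    = (foldr (\<otimes>\<^bsub>G\<^esub>) (map fst zs) \<one>\<^bsub>G\<^esub>, foldr (\<otimes>\<^bsub>H\<^esub>) (map snd zs) \<one>\<^bsub>H\<^esub>)"
  by (induction zs) (auto simp: DirProd_def)

text \<open>The error in a square is (u - v)^2 plus 2 (u - v) v, and the block sum v has no
  pointwise bound. Young's inequality with weight \<open>\<beta>\<close> moves it into a small
  multiple of the variation itself, which is under control on the events considered.\<close>

lemma block_variation_close:
  assumes d: "\<And>k. k < K \<Longrightarrow> \<bar>sum_list (map f (take s (drop (k * s) xs)))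
      - sum_list (map f (take s (drop (k * s) ys)))\<bar> \<le> d"
    and \<beta>: "\<beta> > 0"
  shows "\<bar>block_variation f K s xs - block_variation f K s ys\<bar>
    \<le> real K * (d ^ 2 * (1 + 1 / \<beta>)) + \<beta> * block_variation f K s ys"
proof -
  let ?u = "\<lambda>k. sum_list (map f (take s (drop (k * s) xs)))"
  let ?v = "\<lambda>k. sum_list (map f (take s (drop (k * s) ys)))"
  have one: "\<bar>u ^ 2 - v ^ 2\<bar> \<le> d ^ 2 * (1 + 1 / \<beta>) + \<beta> * v ^ 2" if "\<bar>u - v\<bar> \<le> d" for u v :: real
  proof -
    have "(u - v) ^ 2 \<le> d ^ 2" using that by (rule abs_le_square_iff[THEN iffD1, OF order_trans]) simp
    moreover have "2 * (\<bar>u - v\<bar> * \<bar>v\<bar>) \<le> (u - v) ^ 2 / \<beta> + \<beta> * v ^ 2"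
    proof -
      have "0 \<le> (\<bar>u - v\<bar> - \<beta> * \<bar>v\<bar>) ^ 2 / \<beta>" using \<beta> by simp
      also have "\<dots> = (u - v) ^ 2 / \<beta> + \<beta> * v ^ 2 - 2 * (\<bar>u - v\<bar> * \<bar>v\<bar>)"
        using \<beta> by (simp add: power2_diff power_mult_distrib field_simps power2_eq_square)
      finally show ?thesis by simp
    qed
    moreover have "(u - v) ^ 2 / \<beta> \<le> d ^ 2 / \<beta>" using calculation(1) \<beta> by (intro divide_right_mono) auto
    moreover have "\<bar>u ^ 2 - v ^ 2\<bar> \<le> (u - v) ^ 2 + 2 * (\<bar>u - v\<bar> * \<bar>v\<bar>)"
    proof -
      have "u ^ 2 - v ^ 2 = (u - v) ^ 2 + 2 * ((u - v) * v)" by (simp add: power2_eq_square algebra_simps)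
      also have "\<bar>\<dots>\<bar> \<le> \<bar>(u - v) ^ 2\<bar> + \<bar>2 * ((u - v) * v)\<bar>" by (rule abs_triangle_ineq)
      finally show ?thesis by (simp add: abs_mult)
    qed
    moreover have "d ^ 2 * (1 + 1 / \<beta>) = d ^ 2 + d ^ 2 / \<beta>" by (simp add: algebra_simps)
    ultimately show ?thesis by linarith
  qed
  have "block_variation f K s xs - block_variation f K s ys = (\<Sum>k<K. ?u k ^ 2 - ?v k ^ 2)"
    by (simp add: block_variation_def sum_subtractf)
  also have "\<bar>\<dots>\<bar> \<le> (\<Sum>k<K. \<bar>?u k ^ 2 - ?v k ^ 2\<bar>)" by (rule sum_abs)
  also have "\<dots> \<le> (\<Sum>k<K. d ^ 2 * (1 + 1 / \<beta>) + \<beta> * ?v k ^ 2)"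
    by (intro sum_mono one d) auto
  also have "\<dots> = real K * (d ^ 2 * (1 + 1 / \<beta>)) + \<beta> * block_variation f K s ys"
    by (simp add: block_variation_def sum.distrib sum_distrib_left)
  finally show ?thesis .
qed

section \<open>Separating events for two correlations\<close>

context hyperbolic_walk_hom
begin

text \<open>The number of sampling times is fixed as \<open>n\<close> grows, so a union bound over
  \<open>endpoint_determines_value\<close> is affordable. At \<open>k = 0\<close> both values are
  equal, which leaves the times with a positive limit \<open>k / m\<close>.\<close>

lemma endpoint_determines_values:
  assumes pos: "\<theta> > 0" "\<epsilon> > 0" "c0 > 0" and m: "m \<ge> 1"
    and small: "real K / real m \<le> 1 / 4" "rate * (real K / real m) \<le> c0 / 2"
  obtains n0 T where "\<And>n. n \<ge> n0 \<Longrightarrow> measure_pmf.prob (replicate_pmf n \<mu>) {xs. xs \<notin> T n} \<le> \<theta>"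
    and "\<And>n xs ys g k. \<lbrakk>n \<ge> n0; xs \<in> T n; ys \<in> T n; set xs \<subseteq> carrier G; set ys \<subseteq> carrier G; length xs = n;
      length ys = n; g \<in> carrier G; gp (wp xs) g \<ge> c0 * real n; gp (wp ys) g \<ge> c0 * real n; k \<le> K\<rbrakk>
      \<Longrightarrow> \<bar>\<phi> (wp (take (k * (n div m)) xs)) - \<phi> (wp (take (k * (n div m)) ys))\<bar> \<le> \<epsilon> * sqrt (real n)"
proof -
  define \<theta>' where "\<theta>' = \<theta> / (real K + 1)"
  have \<theta>': "\<theta>' > 0" using pos by (simp add: \<theta>'_def add_nonneg_pos)
  \<comment> \<open>Packaged as a predicate so that thresholds and path sets can be chosen for all
    \<open>k\<close> at once.\<close>
  define Q where "Q k n0 T \<longleftrightarrow> (\<forall>n\<ge>n0. measure_pmf.prob (replicate_pmf n \<mu>) {xs. xs \<notin> T n} \<le> \<theta>')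
    \<and> (\<forall>n xs ys g. n \<ge> n0 \<longrightarrow> xs \<in> T n \<longrightarrow> ys \<in> T n \<longrightarrow> set xs \<subseteq> carrier G \<longrightarrow> set ys \<subseteq> carrier G
      \<longrightarrow> length xs = n \<longrightarrow> length ys = n \<longrightarrow> g \<in> carrier G \<longrightarrow> gp (wp xs) g \<ge> c0 * real n
      \<longrightarrow> gp (wp ys) g \<ge> c0 * real n
      \<longrightarrow> \<bar>\<phi> (wp (take (k * (n div m)) xs)) - \<phi> (wp (take (k * (n div m)) ys))\<bar> \<le> \<epsilon> * sqrt (real n))"
    for k n0 and T :: "nat \<Rightarrow> 'a list set"
  have div_lim: "(\<lambda>n. real (n div m) / real n) \<longlonglongrightarrow> 1 / real m"
  proof -
    have "(\<lambda>n. real (n mod m) / real n) \<longlonglongrightarrow> 0"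
    proof (rule tendsto_sandwich[where f = "\<lambda>_. 0" and h = "\<lambda>n. real m * (1 / real n)"])
      show "\<forall>\<^sub>F n in sequentially. real (n mod m) / real n \<le> real m * (1 / real n)"
        using m by (intro always_eventually allI) (auto intro!: divide_right_mono simp: less_imp_le)
    qed (use tendsto_mult_right_zero[OF lim_1_over_n, of "real m"] in auto)
    then have "(\<lambda>n. (1 - real (n mod m) / real n) / real m) \<longlonglongrightarrow> (1 - 0) / real m"
      using m by (intro tendsto_intros) auto
    then have "(\<lambda>n. (1 - real (n mod m) / real n) / real m) \<longlonglongrightarrow> 1 / real m" by simp
    moreover have "\<forall>\<^sub>F n in sequentially. (1 - real (n mod m) / real n) / real m = real (n div m) / real n"
    proof (rule eventually_sequentiallyI[of 1])
      fix n :: nat assume n: "n \<ge> 1"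
      have "real n = real (n div m) * real m + real (n mod m)"
        by (metis div_mult_mod_eq of_nat_add of_nat_mult)
      then have "real n - real (n mod m) = real (n div m) * real m" by simp
      moreover have "(1 - real (n mod m) / real n) / real m = (real n - real (n mod m)) / real n / real m"
        using n by (simp add: diff_divide_distrib)
      ultimately show "(1 - real (n mod m) / real n) / real m = real (n div m) / real n" using m by simp
    qed
    ultimately show ?thesis by (rule Lim_transform_eventually)
  qed
  have ex: "\<exists>n0 T. Q k n0 T" if k: "k \<in> {1..K}" for k
  proof -
    have kK: "real k / real m \<le> real K / real m" using k by (intro divide_right_mono) auto
    then have "rate * (real k / real m) \<le> rate * (real K / real m)" using rate_pos by (intro mult_left_mono) auto
    then have s: "real k / real m \<le> 1 / 4" "rate * (real k / real m) \<le> c0 / 2" using small kK by linarith+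
    have p: "real k / real m > 0" using k m by simp
    have l: "(\<lambda>n. real (k * (n div m)) / real n) \<longlonglongrightarrow> real k / real m"
      using tendsto_mult_left[OF div_lim, of "real k"] by simp
    show ?thesis
      unfolding Q_def by (rule endpoint_determines_value[OF \<theta>' pos(2,3) p s l]) blast
  qed
  then obtain N T where Q: "\<And>k. k \<in> {1..K} \<Longrightarrow> Q k (N k) (T k)" by metis
  define n0 where "n0 = (\<Sum>k\<in>{1..K}. N k)"
  have n0: "N k \<le> n0" if "k \<in> {1..K}" for k unfolding n0_def using that by (intro member_le_sum) auto
  show thesis
  proof (rule that[of n0 "\<lambda>n. {xs. \<forall>k\<in>{1..K}. xs \<in> T k n}"])
    fix n assume n: "n \<ge> n0"
    have "measure_pmf.prob (replicate_pmf n \<mu>) {xs. xs \<notin> {xs. \<forall>k\<in>{1..K}. xs \<in> T k n}}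
        = measure_pmf.prob (replicate_pmf n \<mu>) (\<Union>k\<in>{1..K}. {xs. xs \<notin> T k n})"
      by (intro arg_cong[where f = "measure_pmf.prob _"]) auto
    also have "\<dots> \<le> (\<Sum>k\<in>{1..K}. measure_pmf.prob (replicate_pmf n \<mu>) {xs. xs \<notin> T k n})"
      by (rule measure_pmf.finite_measure_subadditive_finite) auto
    also have "\<dots> \<le> (\<Sum>k\<in>{1..K}. \<theta>')"
    proof (rule sum_mono)
      fix k assume k: "k \<in> {1..K}"
      have "N k \<le> n" using n0[OF k] n by simp
      then show "measure_pmf.prob (replicate_pmf n \<mu>) {xs. xs \<notin> T k n} \<le> \<theta>'" using Q[OF k] unfolding Q_def by blast
    qed
    also have "\<dots> = real K * \<theta>'" by simp
    also have "\<dots> \<le> \<theta>" using pos by (simp add: \<theta>'_def field_simps)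
    finally show "measure_pmf.prob (replicate_pmf n \<mu>) {xs. xs \<notin> {xs. \<forall>k\<in>{1..K}. xs \<in> T k n}} \<le> \<theta>" .
  next
    fix n xs ys g k
    assume n: "n \<ge> n0" and T: "xs \<in> {xs. \<forall>k\<in>{1..K}. xs \<in> T k n}" "ys \<in> {xs. \<forall>k\<in>{1..K}. xs \<in> T k n}"
      and rest: "set xs \<subseteq> carrier G" "set ys \<subseteq> carrier G" "length xs = n" "length ys = n" "g \<in> carrier G"
      "gp (wp xs) g \<ge> c0 * real n" "gp (wp ys) g \<ge> c0 * real n" and k: "k \<le> K"
    show "\<bar>\<phi> (wp (take (k * (n div m)) xs)) - \<phi> (wp (take (k * (n div m)) ys))\<bar> \<le> \<epsilon> * sqrt (real n)"
    proof (cases "k = 0")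
      case True
      then show ?thesis using pos by simp
    next
      case False
      then have k1: "k \<in> {1..K}" using k by simp
      have "N k \<le> n" using n0[OF k1] n by simp
      then show ?thesis using Q[OF k1] T k1 rest unfolding Q_def by blast
    qed
  qed
qed

text \<open>Two paths whose endpoints are near the same pair of points have nearly the same values
  of \<open>\<phi>\<close> at the block ends in both coordinates, hence nearly the same block
  variation, whereas the events force the variations towards different limits. Stated for pairs of
  paths and arbitrary \<open>g\<close> and \<open>h\<close>, it can be fed with any coupling of the
  endpoints.\<close>

lemma distinguishing_paths:
  assumes S: "generating_set G S" and c: "c > 0"
    and le: "\<And>x. x \<in> carrier G \<Longrightarrow> real (word_length G S x) \<le> c * real (len x)"
    and e: "e > 0" and \<alpha>: "\<alpha> > 0" and \<theta>: "\<theta> > 0"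
    and \<rho>: "\<rho> \<in> {0..1}" "\<rho>' \<in> {0..1}" "\<rho> \<noteq> \<rho>'" and sigma: "\<sigma>2 > 0"
    and far: "\<And>t. t > 0 \<Longrightarrow> \<exists>n0. \<forall>n\<ge>n0. measure_pmf.prob (replicate_pmf n \<mu>)
      {xs. real (word_length G S (wp xs)) < (\<alpha> + e) * real n} \<le> t"
  obtains n0 E where
    "\<And>r n. r \<in> {\<rho>, \<rho>'} \<Longrightarrow> n \<ge> n0 \<Longrightarrow> measure_pmf.prob (replicate_pmf n (noise \<mu> r)) {zs. \<not> E r n zs} \<le> \<theta>"
    "\<And>n zs zs' g h. \<lbrakk>n \<ge> n0; zs \<in> set_pmf (replicate_pmf n (noise \<mu> \<rho>)); zs' \<in> set_pmf (replicate_pmf n (noise \<mu> \<rho>'));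
      E \<rho> n zs; E \<rho>' n zs'; g \<in> carrier G; h \<in> carrier G;
      word_dist G S (wp (map fst zs)) g \<le> \<alpha> * real n; word_dist G S (wp (map snd zs)) h \<le> \<alpha> * real n;
      word_dist G S (wp (map fst zs')) g \<le> \<alpha> * real n; word_dist G S (wp (map snd zs')) h \<le> \<alpha> * real n\<rbrakk> \<Longrightarrow> False"
proof -
  define f where "f x = \<phi> (fst x) - \<phi> (snd x)" for x :: "'a \<times> 'a"
  have fm: "integrable (measure_pmf (noise \<mu> r)) (\<lambda>x. f x ^ 4)" "measure_pmf.expectation (noise \<mu> r) f = 0"
    "measure_pmf.expectation (noise \<mu> r) (\<lambda>x. f x ^ 2) = 2 * r * \<sigma>2" if "r \<in> {\<rho>, \<rho>'}" for r
  proof -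
    have "r \<in> {0..1}" using that \<rho> by auto
    from noise_moments[OF this integrable_phi4 phi_centered]
    show "integrable (measure_pmf (noise \<mu> r)) (\<lambda>x. f x ^ 4)" "measure_pmf.expectation (noise \<mu> r) f = 0"
      "measure_pmf.expectation (noise \<mu> r) (\<lambda>x. f x ^ 2) = 2 * r * \<sigma>2"
      by (simp_all add: f_def[abs_def] \<sigma>2_def)
  qed
  define \<Delta> where "\<Delta> = 2 * \<sigma>2 * \<bar>\<rho> - \<rho>'\<bar>"
  have \<Delta>: "\<Delta> > 0" using sigma \<rho> by (simp add: \<Delta>_def)
  \<comment> \<open>The errors will add up to three quarters of the gap \<open>\<Delta>\<close>:
    \<open>\<eta>\<close> for each of the two paths and \<open>\<Delta> / 4\<close> for the
    difference of their variations.\<close>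
  define \<eta> where "\<eta> = \<Delta> / 4"
  have \<eta>: "\<eta> > 0" using \<Delta> by (simp add: \<eta>_def)
  define m4 where "m4 r = measure_pmf.expectation (noise \<mu> r) (\<lambda>x. f x ^ 4)" for r
  have m4: "m4 r \<ge> 0" for r by (simp add: m4_def)
  \<comment> \<open>Makes the Chebyshev bound at most \<open>\<theta> / 3\<close> for both
    correlations. This comes before \<open>m\<close> and \<open>\<epsilon>\<close>, both of which
    depend on \<open>K\<close>.\<close>
  define K where "K = nat \<lceil>4 * (m4 \<rho> + m4 \<rho>') / (\<eta> ^ 2 * (\<theta> / 3))\<rceil> + 1"
  have K: "K \<ge> 1" by (simp add: K_def)
  have K_ge: "4 * m4 r / (real K * \<eta> ^ 2) \<le> \<theta> / 3" if "r \<in> {\<rho>, \<rho>'}" for r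
  proof -
    have p: "\<eta> ^ 2 * (\<theta> / 3) > 0" using \<eta> \<theta> by simp
    have "4 * (m4 \<rho> + m4 \<rho>') / (\<eta> ^ 2 * (\<theta> / 3)) \<le> real K" unfolding K_def by linarith
    then have "4 * (m4 \<rho> + m4 \<rho>') \<le> real K * (\<eta> ^ 2 * (\<theta> / 3))" using p by (simp only: pos_divide_le_eq)
    moreover have "4 * m4 r \<le> 4 * (m4 \<rho> + m4 \<rho>')" using that m4 by auto
    ultimately have "4 * m4 r \<le> \<theta> / 3 * (real K * \<eta> ^ 2)" by (simp add: mult_ac)
    moreover have "real K * \<eta> ^ 2 > 0" using K \<eta> by simp
    ultimately show ?thesis by (simp only: pos_divide_le_eq)
  qed
  define c0 where "c0 = e / (2 * c)"
  have c0: "c0 > 0" using e c by (simp add: c0_def)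
  \<comment> \<open>A Gromov product of \<open>c0 * n\<close> controls the path while it is below
    that height. Up to time \<open>\<kappa> * n\<close> the expected height is at most half of it,
    and \<open>m\<close> is chosen so that the \<open>K\<close> blocks end by then.\<close>
  define \<kappa> where "\<kappa> = min (1 / 4) (c0 / (2 * rate))"
  have \<kappa>: "\<kappa> > 0" using c0 rate_pos by (simp add: \<kappa>_def)
  define m where "m = nat \<lceil>real K / \<kappa>\<rceil> + 1"
  have m: "m \<ge> 1" by (simp add: m_def)
  have Km: "real K / real m \<le> \<kappa>"
  proof -
    have "real K / \<kappa> \<le> real m" unfolding m_def by linarith
    then show ?thesis using \<kappa> m by (simp add: field_simps)
  qed
  have Km1: "real K / real m \<le> 1 / 4" using Km by (simp add: \<kappa>_def)
  have Km2: "rate * (real K / real m) \<le> c0 / 2"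
  proof -
    have "real K / real m \<le> c0 / (2 * rate)" using Km by (simp add: \<kappa>_def)
    then have "rate * (real K / real m) \<le> rate * (c0 / (2 * rate))" using rate_pos by (intro mult_left_mono) auto
    then show ?thesis using rate_pos by simp
  qed
  have K_le_m: "K \<le> m"
  proof -
    have "real K \<le> 1 / 4 * real m" using Km1 m by (simp add: field_simps)
    then show ?thesis by linarith
  qed
  \<comment> \<open>One of the two halves of \<open>\<Delta> / 4\<close>: a variation of at most
    \<open>2 * \<sigma>2 + \<Delta>\<close> contributes a relative error of at most
    \<open>\<Delta> / 8\<close>.\<close>
  define \<beta> where "\<beta> = \<Delta> / (8 * (2 * \<sigma>2 + \<Delta>))"
  have \<beta>: "\<beta> > 0" using \<Delta> sigma by (simp add: \<beta>_def)
  \<comment> \<open>The other half. A block sum is a difference of two values of \<open>W\<close>,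
    each known up to \<open>2 * \<epsilon> * sqrt n\<close>, so
    \<open>d ^ 2 = 16 * \<epsilon> ^ 2 * n\<close>; with \<open>n \<le> 2 * m * s\<close> this gives
    the factor 32.\<close>
  define \<epsilon> where "\<epsilon> = sqrt (\<Delta> / (8 * (32 * real m * (1 + 1 / \<beta>))))"
  have q: "32 * real m * (1 + 1 / \<beta>) > 0" using m \<beta> by (simp add: add_pos_pos)
  have \<epsilon>: "\<epsilon> > 0" unfolding \<epsilon>_def using \<Delta> q by simp
  have \<epsilon>2: "32 * real m * (1 + 1 / \<beta>) * \<epsilon> ^ 2 = \<Delta> / 8"
  proof -
    have "\<epsilon> ^ 2 = \<Delta> / (8 * (32 * real m * (1 + 1 / \<beta>)))" unfolding \<epsilon>_def using \<Delta> q by simp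
    moreover have "x * (\<Delta> / (8 * x)) = \<Delta> / 8" if "x > 0" for x using that by simp
    ultimately show ?thesis using q by metis
  qed
  obtain n1 T where T: "\<And>n. n \<ge> n1 \<Longrightarrow> measure_pmf.prob (replicate_pmf n \<mu>) {xs. xs \<notin> T n} \<le> \<theta> / 6"
    and agree: "\<And>n xs ys g k. \<lbrakk>n \<ge> n1; xs \<in> T n; ys \<in> T n; set xs \<subseteq> carrier G; set ys \<subseteq> carrier G; length xs = n;
      length ys = n; g \<in> carrier G; gp (wp xs) g \<ge> c0 * real n; gp (wp ys) g \<ge> c0 * real n; k \<le> K\<rbrakk>
      \<Longrightarrow> \<bar>\<phi> (wp (take (k * (n div m)) xs)) - \<phi> (wp (take (k * (n div m)) ys))\<bar> \<le> \<epsilon> * sqrt (real n)"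
  proof (rule endpoint_determines_values[OF _ \<epsilon> c0 m Km1 Km2, of "\<theta> / 6"], goal_cases)
    case 1
    then show ?case using \<theta> by simp
  next
    case (2 n0 T)
    show ?case by (rule 2(1)[of n0 T]) (use 2(2,3) in blast)+
  qed
  obtain n2 where n2: "\<And>n x g. n \<ge> n2 \<Longrightarrow> x \<in> carrier G \<Longrightarrow> g \<in> carrier G \<Longrightarrow>
    real (word_length G S x) \<ge> (\<alpha> + e) * real n \<Longrightarrow> word_dist G S x g \<le> \<alpha> * real n \<Longrightarrow> gp x g \<ge> c0 * real n"
    using gp_linear[OF S c le e \<alpha>] unfolding c0_def by metis
  obtain n3 where n3: "\<And>n. n \<ge> n3 \<Longrightarrow> measure_pmf.prob (replicate_pmf n \<mu>)
      {xs. real (word_length G S (wp xs)) < (\<alpha> + e) * real n} \<le> \<theta> / 6"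
    using far[of "\<theta> / 6"] \<theta> by auto
  define V where "V n zs = block_variation f K (n div m) zs / (real K * real (n div m))" for n zs
  define F where "F n xs \<longleftrightarrow> xs \<in> T n \<and> real (word_length G S (wp xs)) \<ge> (\<alpha> + e) * real n" for n xs
  define E where "E r n zs \<longleftrightarrow> F n (map fst zs) \<and> F n (map snd zs) \<and> \<bar>V n zs - 2 * r * \<sigma>2\<bar> \<le> \<eta>" for r n zs
  have PF: "measure_pmf.prob (replicate_pmf n \<mu>) {xs. \<not> F n xs} \<le> \<theta> / 3" if "n \<ge> max n1 n3" for n
  proof -
    have "measure_pmf.prob (replicate_pmf n \<mu>) {xs. \<not> F n xs}
      \<le> measure_pmf.prob (replicate_pmf n \<mu>) {xs. xs \<notin> T n}
        + measure_pmf.prob (replicate_pmf n \<mu>) {xs. real (word_length G S (wp xs)) < (\<alpha> + e) * real n}"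
      by (rule order_trans[OF prob_mono_support prob_Un_le]) (auto simp: F_def)
    then show ?thesis using T[of n] n3[of n] that by simp
  qed
  show thesis
  proof (rule that[of "max (max n1 n2) (max n3 m)" E])
    fix r n assume r: "r \<in> {\<rho>, \<rho>'}" and n: "n \<ge> max (max n1 n2) (max n3 m)"
    let ?P = "replicate_pmf n (noise \<mu> r)"
    have s: "n div m \<ge> 1" using n m by (simp add: Suc_le_eq div_greater_zero_iff)
    have "K * (n div m) \<le> m * (n div m)" using K_le_m by (rule mult_right_mono) simp
    also have "\<dots> \<le> n" by (rule times_div_less_eq_dividend)
    finally have Ks: "K * (n div m) \<le> n" .
    have "measure_pmf.prob ?P {zs. \<not> E r n zs}
        \<le> measure_pmf.prob ?P {zs. \<not> F n (map fst zs)} + (measure_pmf.prob ?P {zs. \<not> F n (map snd zs)}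
          + measure_pmf.prob ?P {zs. \<bar>V n zs - 2 * r * \<sigma>2\<bar> > \<eta>})"
    proof -
      have "measure_pmf.prob ?P {zs. \<not> E r n zs} \<le> measure_pmf.prob ?P
          {zs. \<not> F n (map fst zs) \<or> \<not> F n (map snd zs) \<or> \<bar>V n zs - 2 * r * \<sigma>2\<bar> > \<eta>}"
        by (rule prob_mono_support) (auto simp: E_def not_le)
      also have "\<dots> \<le> measure_pmf.prob ?P {zs. \<not> F n (map fst zs)}
          + measure_pmf.prob ?P {zs. \<not> F n (map snd zs) \<or> \<bar>V n zs - 2 * r * \<sigma>2\<bar> > \<eta>}"
        by (rule prob_Un_le)
      finally show ?thesis using prob_Un_le[of ?P "\<lambda>zs. \<not> F n (map snd zs)" "\<lambda>zs. \<bar>V n zs - 2 * r * \<sigma>2\<bar> > \<eta>"]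
        by linarith
    qed
    also have "measure_pmf.prob ?P {zs. \<not> F n (map fst zs)} = measure_pmf.prob (replicate_pmf n \<mu>) {xs. \<not> F n xs}"
      by (subst (2) map_fst_noise[of \<mu> r, symmetric]) (simp only: map_replicate_pmf[symmetric] prob_map_pmf mem_Collect_eq)
    also have "measure_pmf.prob ?P {zs. \<not> F n (map snd zs)} = measure_pmf.prob (replicate_pmf n \<mu>) {xs. \<not> F n xs}"
      by (subst (2) map_snd_noise[of \<mu> r, symmetric]) (simp only: map_replicate_pmf[symmetric] prob_map_pmf mem_Collect_eq)
    also have "measure_pmf.prob ?P {zs. \<bar>V n zs - 2 * r * \<sigma>2\<bar> > \<eta>} \<le> 4 * m4 r / (real K * \<eta> ^ 2)"
      using prob_block_variation[OF fm(1,2)[OF r] K s Ks \<eta>] unfolding V_def m4_def fm(3)[OF r] .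
    also have "\<dots> \<le> \<theta> / 3" by (rule K_ge[OF r])
    finally show "measure_pmf.prob ?P {zs. \<not> E r n zs} \<le> \<theta>" using PF[of n] n by simp
  next
    fix n zs zs' g h
    assume n: "n \<ge> max (max n1 n2) (max n3 m)"
      and zs: "zs \<in> set_pmf (replicate_pmf n (noise \<mu> \<rho>))" and zs': "zs' \<in> set_pmf (replicate_pmf n (noise \<mu> \<rho>'))"
      and EE: "E \<rho> n zs" "E \<rho>' n zs'" and gh: "g \<in> carrier G" "h \<in> carrier G"
      and near: "word_dist G S (wp (map fst zs)) g \<le> \<alpha> * real n" "word_dist G S (wp (map snd zs)) h \<le> \<alpha> * real n"
        "word_dist G S (wp (map fst zs')) g \<le> \<alpha> * real n" "word_dist G S (wp (map snd zs')) h \<le> \<alpha> * real n"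
    define s where "s = n div m"
    have s: "s \<ge> 1" using n m by (simp add: s_def Suc_le_eq div_greater_zero_iff)
    have ns: "real n \<le> 2 * real m * real s"
    proof -
      have "n = s * m + n mod m" by (simp add: s_def)
      also have "\<dots> \<le> s * m + m" using m by (simp add: less_imp_le)
      also have "\<dots> \<le> s * m + s * m" using s by simp
      finally have "real n \<le> real (s * m + s * m)" by (rule of_nat_mono)
      then show ?thesis by simp
    qed
    have path: "set (map fst ws) \<subseteq> carrier G \<and> set (map snd ws) \<subseteq> carrier G \<and> length ws = n"
      if "ws \<in> set_pmf (replicate_pmf n (noise \<mu> r))" for ws r
    proof -
      have "set ws \<subseteq> set_pmf (noise \<mu> r)" using that by (rule set_replicate_pmf_subset)
      then have "fst ` set ws \<subseteq> set_pmf (map_pmf fst (noise \<mu> r))" "snd ` set ws \<subseteq> set_pmf (map_pmf snd (noise \<mu> r))"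
        by auto
      then show ?thesis using supp length_replicate_pmf[OF that] by (auto simp: map_fst_noise map_snd_noise)
    qed
    note p = path[OF zs] and p' = path[OF zs']
    have far_gp: "gp (wp xs) y \<ge> c0 * real n"
      if "F n xs" "set xs \<subseteq> carrier G" "y \<in> carrier G" "word_dist G S (wp xs) y \<le> \<alpha> * real n" for xs y
      using n2[of n "wp xs" y] n that by (auto simp: F_def)
    have close1: "\<bar>\<phi> (wp (take (k * s) (map fst zs))) - \<phi> (wp (take (k * s) (map fst zs')))\<bar> \<le> \<epsilon> * sqrt (real n)" if "k \<le> K" for k
      unfolding s_def by (rule agree[OF _ _ _ _ _ _ _ gh(1) _ _ that])
        (use n EE p p' near gh far_gp in \<open>auto simp: E_def F_def\<close>)
    have close2: "\<bar>\<phi> (wp (take (k * s) (map snd zs))) - \<phi> (wp (take (k * s) (map snd zs')))\<bar> \<le> \<epsilon> * sqrt (real n)" if "k \<le> K" for k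
      unfolding s_def by (rule agree[OF _ _ _ _ _ _ _ gh(2) _ _ that])
        (use n EE p p' near gh far_gp in \<open>auto simp: E_def F_def\<close>)
    define W where "W k ws = \<phi> (wp (take (k * s) (map fst ws))) - \<phi> (wp (take (k * s) (map snd ws)))" for k ws
    have W_close: "\<bar>W k zs - W k zs'\<bar> \<le> 2 * \<epsilon> * sqrt (real n)" if "k \<le> K" for k
      unfolding W_def using close1[OF that] close2[OF that] by linarith
    have W_eq: "W k ws = sum_list (map f (take (k * s) ws))"
      if "set (map fst ws) \<subseteq> carrier G \<and> set (map snd ws) \<subseteq> carrier G \<and> length ws = n" for k ws
    proof -
      have "set (take (k * s) (map fst ws)) \<subseteq> carrier G" "set (take (k * s) (map snd ws)) \<subseteq> carrier G"
        using that set_take_subset by (metis subset_trans)+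
      then have "W k ws = sum_list (map \<phi> (take (k * s) (map fst ws))) - sum_list (map \<phi> (take (k * s) (map snd ws)))"
        unfolding W_def by (simp only: phi_wp)
      also have "\<dots> = sum_list (map f (take (k * s) ws))"
        unfolding take_map f_def by (simp add: o_def sum_list_subtractf)
      finally show ?thesis .
    qed
    have block: "sum_list (map f (take s (drop (k * s) ws))) = W (Suc k) ws - W k ws"
      if "set (map fst ws) \<subseteq> carrier G \<and> set (map snd ws) \<subseteq> carrier G \<and> length ws = n" for k ws
    proof -
      have "take (Suc k * s) ws = take (k * s) ws @ take s (drop (k * s) ws)"
        using take_add[of "k * s" s ws] by (simp add: add.commute)
      then show ?thesis unfolding W_eq[OF that] by simp
    qed
    define d where "d = 4 * \<epsilon> * sqrt (real n)"
    define B where "B ws = block_variation f K s ws" for ws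
    have "\<bar>B zs - B zs'\<bar> \<le> real K * (d ^ 2 * (1 + 1 / \<beta>)) + \<beta> * B zs'"
      unfolding B_def
    proof (rule block_variation_close[OF _ \<beta>])
      fix k assume k: "k < K"
      show "\<bar>sum_list (map f (take s (drop (k * s) zs))) - sum_list (map f (take s (drop (k * s) zs')))\<bar> \<le> d"
        unfolding block[OF p] block[OF p'] d_def using W_close[of k] W_close[of "Suc k"] k by simp
    qed
    moreover have Ks: "real K * real s > 0" using K s by simp
    ultimately have "\<bar>B zs - B zs'\<bar> / (real K * real s) \<le> (real K * (d ^ 2 * (1 + 1 / \<beta>)) + \<beta> * B zs') / (real K * real s)"
      by (intro divide_right_mono) auto
    also have "\<dots> = d ^ 2 * (1 + 1 / \<beta>) / real s + \<beta> * V n zs'"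
      using K by (simp add: V_def B_def s_def[symmetric] add_divide_distrib)
    also have "\<bar>B zs - B zs'\<bar> / (real K * real s) = \<bar>V n zs - V n zs'\<bar>"
      using Ks by (simp add: V_def B_def s_def[symmetric] abs_divide flip: diff_divide_distrib)
    also have "d ^ 2 * (1 + 1 / \<beta>) / real s \<le> \<Delta> / 8"
    proof -
      have "d ^ 2 = 16 * \<epsilon> ^ 2 * real n" by (simp add: d_def power_mult_distrib)
      also have "\<dots> \<le> 16 * \<epsilon> ^ 2 * (2 * real m * real s)" using ns by (intro mult_left_mono) auto
      finally have "d ^ 2 * (1 + 1 / \<beta>) \<le> 16 * \<epsilon> ^ 2 * (2 * real m * real s) * (1 + 1 / \<beta>)"
        using \<beta> by (intro mult_right_mono) auto
      also have "\<dots> = 32 * real m * (1 + 1 / \<beta>) * \<epsilon> ^ 2 * real s" by (simp add: algebra_simps)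
      finally have "d ^ 2 * (1 + 1 / \<beta>) \<le> \<Delta> / 8 * real s" unfolding \<epsilon>2 .
      then show ?thesis using s by (simp add: pos_divide_le_eq)
    qed
    also have "\<beta> * V n zs' \<le> \<Delta> / 8"
    proof -
      have "V n zs' \<le> 2 * \<rho>' * \<sigma>2 + \<eta>" using EE(2) unfolding E_def by linarith
      moreover have "\<rho>' * \<sigma>2 \<le> 1 * \<sigma>2" using \<rho> sigma by (intro mult_right_mono) auto
      ultimately have "V n zs' \<le> 2 * \<sigma>2 + \<Delta>" using \<Delta> unfolding \<eta>_def by linarith
      then have "\<beta> * V n zs' \<le> \<beta> * (2 * \<sigma>2 + \<Delta>)" using \<beta> by (intro mult_left_mono) auto
      also have "\<dots> = \<Delta> / 8"
      proof -
        have "\<Delta> / (8 * x) * x = \<Delta> / 8" if "x > 0" for x using that by simp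
        from this[of "2 * \<sigma>2 + \<Delta>"] show ?thesis unfolding \<beta>_def using sigma \<Delta> by simp
      qed
      finally show ?thesis .
    qed
    finally have "\<bar>V n zs - V n zs'\<bar> \<le> \<Delta> / 4" by simp
    moreover have "\<bar>V n zs - 2 * \<rho> * \<sigma>2\<bar> \<le> \<Delta> / 4" "\<bar>V n zs' - 2 * \<rho>' * \<sigma>2\<bar> \<le> \<Delta> / 4"
      using EE by (auto simp: E_def \<eta>_def)
    moreover have "\<bar>2 * \<rho> * \<sigma>2 - 2 * \<rho>' * \<sigma>2\<bar> = \<Delta>"
    proof -
      have "2 * \<rho> * \<sigma>2 - 2 * \<rho>' * \<sigma>2 = 2 * \<sigma>2 * (\<rho> - \<rho>')" by (simp add: algebra_simps)
      then show ?thesis unfolding \<Delta>_def using sigma by (simp add: abs_mult)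
    qed
    ultimately show False using \<Delta> by linarith
  qed
qed

end

text \<open>It transfers positivity: the hypothesis on \<alpha> makes the rate positive for the word
  metric in which errors are measured, and the tracking argument needs it for the hyperbolic
  one.\<close>

lemma (in random_walk) rate_le_of_len_le:
  assumes "random_walk G len' \<mu>" and c: "c \<ge> 0"
    and le: "\<And>x. x \<in> carrier G \<Longrightarrow> real (len x) \<le> c * real (len' x)"
  shows "rate \<le> c * random_walk.rate G len' \<mu>"
proof -
  interpret W: random_walk G len' \<mu> by fact
  have mean: "mean_len n \<le> c * W.mean_len n" for n
  proof -
    have "mean_len n \<le> measure_pmf.expectation (replicate_pmf n \<mu>) (\<lambda>xs. c * W.norm_wp xs)"
      unfolding mean_len_def
    proof (rule integral_mono_AE)
      show "AE xs in replicate_pmf n \<mu>. norm_wp xs \<le> c * W.norm_wp xs"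
      proof (rule AE_pmfI)
        fix xs assume "xs \<in> set_pmf (replicate_pmf n \<mu>)"
        then have "wp xs \<in> carrier G" using support_replicate by auto
        then show "norm_wp xs \<le> c * W.norm_wp xs"
          using le by (simp add: norm_wp_def W.norm_wp_def wp_def W.wp_def)
      qed
    qed (use integrable_norm_wp W.integrable_norm_wp in auto)
    then show ?thesis by (simp add: W.mean_len_def)
  qed
  have "(\<lambda>n. c * (W.mean_len n / real n)) \<longlonglongrightarrow> c * W.rate"
    by (intro tendsto_intros W.mean_len_tendsto)
  moreover have "rate \<le> c * (W.mean_len n / real n)" if "n \<ge> 1" for n
    using rate_le[OF that] divide_right_mono[OF mean[of n], of "real n"] by simp
  ultimately show ?thesis by (intro LIMSEQ_le_const) auto
qed

text \<open>From y \<le> exp y at y = c L / 4, raised to the fourth power; hence the constant 256 =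
  4^4.\<close>

lemma finite_exponential_moment_imp_fourth:
  assumes "finite_exponential_moment G S \<mu>" "set_pmf \<mu> \<subseteq> carrier G"
  shows "integrable (measure_pmf \<mu>) (\<lambda>x. real (word_length G S x) ^ 4)"
proof -
  let ?L = "\<lambda>x. real (word_length G S x)"
  obtain c where c: "c > 0" and sum: "(\<lambda>x. exp (c * ?L x) * pmf \<mu> x) summable_on carrier G"
    using assms(1) by (auto simp: finite_exponential_moment_def)
  have "(\<lambda>x. exp (c * ?L x) * pmf \<mu> x) summable_on UNIV"
    using sum by (rule summable_on_cong_neutral[THEN iffD1, rotated -1])
      (use assms(2) in \<open>auto simp: set_pmf_iff\<close>)
  then have "Infinite_Sum.abs_summable_on (\<lambda>x. exp (c * ?L x) * pmf \<mu> x) UNIV"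
    by (rule summable_on_iff_abs_summable_on_real[THEN iffD1])
  then have "Infinite_Set_Sum.abs_summable_on (\<lambda>x. exp (c * ?L x) * pmf \<mu> x) UNIV"
    using abs_summable_equivalent by blast
  then have exp_int: "integrable (measure_pmf \<mu>) (\<lambda>x. exp (c * ?L x))"
    by (simp add: integrable_measure_pmf_iff mult.commute)
  show ?thesis
  proof (rule Bochner_Integration.integrable_bound)
    show "integrable (measure_pmf \<mu>) (\<lambda>x. 256 / c ^ 4 * exp (c * ?L x))" using exp_int by simp
    show "AE x in measure_pmf \<mu>. norm (?L x ^ 4) \<le> norm (256 / c ^ 4 * exp (c * ?L x))"
    proof (rule AE_I2)
      fix x
      have "c * ?L x / 4 \<le> exp (c * ?L x / 4)" using exp_ge_add_one_self[of "c * ?L x / 4"] by linarith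
      then have "(c * ?L x / 4) ^ 4 \<le> exp (c * ?L x / 4) ^ 4" using c by (intro power_mono) auto
      also have "exp (c * ?L x / 4) ^ 4 = exp (c * ?L x)" by (simp flip: exp_of_nat_mult)
      finally have "c ^ 4 * ?L x ^ 4 \<le> 256 * exp (c * ?L x)"
        by (simp add: power_mult_distrib power_divide)
      then have "?L x ^ 4 \<le> 256 / c ^ 4 * exp (c * ?L x)" using c by (simp add: field_simps)
      then show "norm (?L x ^ 4) \<le> norm (256 / c ^ 4 * exp (c * ?L x))" by simp
    qed
  qed simp
qed

section \<open>Couplings of the endpoint laws\<close>

theorem theorem1p2:
  fixes G :: "('a, 'b) monoid_scheme" and S :: "'a set"
    and \<mu> :: "'a pmf" and \<phi> :: "'a \<Rightarrow> real" and \<rho> \<rho>' \<alpha> :: real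
  assumes "group G" and "word_hyperbolic G" and "nonelementary_group G"
    and "generating_set G S"
    and "set_pmf \<mu> \<subseteq> carrier G" and "nonelementary_measure G S \<mu>"
    and "finite_exponential_moment G S \<mu>"
    and "\<phi> \<in> hom G real_additive_group" and "centered (map_pmf \<phi> \<mu>)"
    and "\<exists>x\<in>set_pmf \<mu>. \<phi> x \<noteq> 0"
    and "\<rho> \<in> {0..1}" and "\<rho>' \<in> {0..1}" and "\<rho> \<noteq> \<rho>'"
    and "\<alpha> \<in> {0<..<escape_rate G S \<mu>}"
  shows "(\<lambda>n. approximate_tv G S (\<alpha> * real n)
                (convolution_power (G \<times>\<times> G) (noise \<mu> \<rho>) n)
                (convolution_power (G \<times>\<times> G) (noise \<mu> \<rho>') n)) \<longlonglongrightarrow> 1"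
proof -
  interpret group G by fact
  note S = assms(4) and supp = assms(5)
  \<comment> \<open>Errors are measured with \<open>S\<close>, while hyperbolicity is available for
    some \<open>S'\<close>. The walk is analysed with the length of \<open>S'\<close>; the length of
    \<open>S\<close> enters through the position of the endpoint.\<close>
  obtain S' where S': "generating_set G S'" and "hyperbolic_metric G S'"
    using assms(2) by (auto simp: word_hyperbolic_def)
  then obtain \<delta> where \<delta>: "\<delta> \<ge> 0" and hyp: "\<And>x y z. x \<in> carrier G \<Longrightarrow> y \<in> carrier G \<Longrightarrow> z \<in> carrier G \<Longrightarrow>
      gromov_product G S' \<one>\<^bsub>G\<^esub> x z \<ge> min (gromov_product G S' \<one>\<^bsub>G\<^esub> x y) (gromov_product G S' \<one>\<^bsub>G\<^esub> y z) - \<delta>"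
    unfolding hyperbolic_metric_def by (meson one_closed)
  let ?L = "word_length G S" and ?L' = "word_length G S'"
  interpret W: length_group G ?L by (rule length_group_word_length[OF S])
  interpret W': length_group G ?L' by (rule length_group_word_length[OF S'])
  have gp_eq: "gromov_product G S' \<one>\<^bsub>G\<^esub> x y = W'.gp x y" if "x \<in> carrier G" "y \<in> carrier G" for x y
    using that by (simp add: gromov_product_def W'.gp_def word_dist_def W'.ldist_def)
  interpret H: hyperbolic_group G ?L' \<delta>
    by unfold_locales (use \<delta> hyp gp_eq in auto)
  have mom: "integrable (measure_pmf \<mu>) (\<lambda>x. real (?L x) ^ 4)"
    by (rule finite_exponential_moment_imp_fourth[OF assms(7) supp])
  interpret A: random_walk G ?L \<mu> by unfold_locales (use supp mom in auto)
  obtain k where k: "k \<ge> 0" "\<And>x. x \<in> carrier G \<Longrightarrow> real (?L' x) \<le> k * real (?L x)"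
    using W'.len_le_word_length[OF S] by blast
  have mom': "integrable (measure_pmf \<mu>) (\<lambda>x. real (?L' x) ^ 4)"
    by (rule integrable_bounded_power[OF mom, of _ k]) (use k supp in auto)
  interpret B: random_walk G ?L' \<mu> by unfold_locales (use supp mom' in auto)
  obtain c' where c': "c' \<ge> 0" "\<And>x. x \<in> carrier G \<Longrightarrow> real (?L x) \<le> c' * real (?L' x)"
    using W.len_le_word_length[OF S'] by blast
  define c where "c = c' + 1"
  have c: "c > 0" using c' by (simp add: c_def)
  have le: "real (?L x) \<le> c * real (?L' x)" if "x \<in> carrier G" for x
    using c'(2)[OF that] by (simp add: c_def algebra_simps)
  have \<alpha>: "0 < \<alpha>" "\<alpha> < A.rate" using assms(14) A.escape_rate_eq[OF refl] by auto
  have "A.rate \<le> c * B.rate"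
    by (rule A.rate_le_of_len_le[OF B.random_walk_axioms]) (use c le in auto)
  then have "0 < c * B.rate" using \<alpha> by linarith
  then have B_pos: "B.rate > 0" using c by (simp add: zero_less_mult_iff)
  have phi_mult: "\<phi> (x \<otimes>\<^bsub>G\<^esub> y) = \<phi> x + \<phi> y" if "x \<in> carrier G" "y \<in> carrier G" for x y
    using assms(8) that by (auto simp: hom_def real_additive_group_def)
  have phi_one: "\<phi> \<one>\<^bsub>G\<^esub> = 0" using phi_mult[of "\<one>\<^bsub>G\<^esub>" "\<one>\<^bsub>G\<^esub>"] by simp
  obtain C where C: "C \<ge> 0" "\<And>x. x \<in> carrier G \<Longrightarrow> \<bar>\<phi> x\<bar> \<le> C * real (?L' x)"
    by (rule subadditive_le_word_length[OF S', of "\<lambda>x. \<bar>\<phi> x\<bar>"]) (auto simp: phi_one phi_mult)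
  have phi0: "measure_pmf.expectation \<mu> \<phi> = 0"
    using assms(9) by (simp add: centered_def)
  interpret H: hyperbolic_walk_hom G ?L' \<delta> \<mu> \<phi> C
    by unfold_locales (use B_pos phi_mult C phi0 in auto)
  have sigma: "H.\<sigma>2 > 0"
  proof -
    have i2: "integrable (measure_pmf \<mu>) (\<lambda>x. \<phi> x ^ 2)"
      by (rule integrable_lower_power[OF H.integrable_phi4]) simp
    have "H.\<sigma>2 \<noteq> 0"
    proof
      assume "H.\<sigma>2 = 0"
      then have "AE x in measure_pmf \<mu>. \<phi> x ^ 2 = 0"
        unfolding H.\<sigma>2_def using i2 by (subst (asm) integral_nonneg_eq_0_iff_AE) auto
      then show False using assms(10) by (auto simp: AE_measure_pmf_iff)
    qed
    then show ?thesis using H.sigma2_nonneg by simp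
  qed
  \<comment> \<open>Half the gap between \<open>\<alpha>\<close> and the rate: a typical endpoint
    has length at least \<open>(\<alpha> + e) * n\<close>, so that after an error of
    \<open>\<alpha> * n\<close> it is still at distance \<open>e * n\<close> from the
    identity.\<close>
  define e where "e = (A.rate - \<alpha>) / 2"
  have e: "e > 0" using \<alpha> by (simp add: e_def)
  have far: "\<exists>n0. \<forall>n\<ge>n0. measure_pmf.prob (replicate_pmf n \<mu>)
      {xs. real (?L (W.wp xs)) < (\<alpha> + e) * real n} \<le> t" if t: "t > 0" for t
  proof -
    obtain n0 where n0: "\<And>n. n \<ge> n0 \<Longrightarrow> measure_pmf.prob (replicate_pmf n \<mu>)
      {xs. \<bar>A.norm_wp xs - A.rate * real n\<bar> > e * real n} \<le> t"
      using A.rate_in_prob[OF t e] by blast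
    have "A.rate = \<alpha> + 2 * e" by (simp add: e_def field_simps)
    then have r: "A.rate * real n = (\<alpha> + e) * real n + e * real n" for n by (simp add: algebra_simps)
    have "measure_pmf.prob (replicate_pmf n \<mu>) {xs. real (?L (W.wp xs)) < (\<alpha> + e) * real n}
        \<le> measure_pmf.prob (replicate_pmf n \<mu>) {xs. \<bar>A.norm_wp xs - A.rate * real n\<bar> > e * real n}" for n
      by (rule prob_mono_support) (auto simp: A.norm_wp_def W.wp_def r)
    then show ?thesis using n0 by (meson order_trans)
  qed
  interpret GG: group "G \<times>\<times> G" by (rule DirProd_group) fact+
  have supp2: "set_pmf (noise \<mu> r) \<subseteq> carrier (G \<times>\<times> G)" for r
  proof
    fix x assume "x \<in> set_pmf (noise \<mu> r)"
    then have "fst x \<in> set_pmf (map_pmf fst (noise \<mu> r))" "snd x \<in> set_pmf (map_pmf snd (noise \<mu> r))"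
      by auto
    then show "x \<in> carrier (G \<times>\<times> G)" using supp by (cases x) (auto simp: map_fst_noise map_snd_noise)
  qed
  define \<Phi> where "\<Phi> zs = (W.wp (map fst zs), W.wp (map snd zs))" for zs
  have conv: "convolution_power (G \<times>\<times> G) (noise \<mu> r) n = map_pmf \<Phi> (replicate_pmf n (noise \<mu> r))" for r n
    unfolding GG.convolution_power_replicate[OF supp2] foldr_DirProd \<Phi>_def W.wp_def ..
  let ?tv = "\<lambda>n. approximate_tv G S (\<alpha> * real n)
    (convolution_power (G \<times>\<times> G) (noise \<mu> \<rho>) n) (convolution_power (G \<times>\<times> G) (noise \<mu> \<rho>') n)"
  let ?C = "\<lambda>n. approximate_couplings G S (\<alpha> * real n)
    (convolution_power (G \<times>\<times> G) (noise \<mu> \<rho>) n) (convolution_power (G \<times>\<times> G) (noise \<mu> \<rho>') n)"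
  let ?U = "{(z1, z1', z2, z2'). z1' \<noteq> z2'} :: (('a \<times> 'a) \<times> ('a \<times> 'a) \<times> ('a \<times> 'a) \<times> ('a \<times> 'a)) set"
  have path: "\<Phi> zs \<in> carrier G \<times> carrier G" if "zs \<in> set_pmf (replicate_pmf n (noise \<mu> r))" for zs n r
  proof -
    have "set zs \<subseteq> carrier (G \<times>\<times> G)" using set_replicate_pmf_subset[OF that] supp2 by blast
    then have "set (map fst zs) \<subseteq> carrier G" "set (map snd zs) \<subseteq> carrier G" by auto
    then show ?thesis unfolding \<Phi>_def using W.wp_closed by blast
  qed
  \<comment> \<open>The infimum of an empty set of reals has no useful value, so a coupling must be
    exhibited: the independent one, left unperturbed.\<close>
  have nonempty: "?C n \<noteq> {}" for n
  proof -
    let ?p = "convolution_power (G \<times>\<times> G) (noise \<mu> \<rho>) n" and ?q = "convolution_power (G \<times>\<times> G) (noise \<mu> \<rho>') n"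
    let ?J = "map_pmf (\<lambda>(x, y). (x, x, y, y)) (pair_pmf ?p ?q)"
    have "?J \<in> ?C n"
      unfolding approximate_couplings_def
    proof (intro CollectI conjI)
      show "map_pmf (\<lambda>(z1, z1', z2, z2'). z1) ?J = ?p" "map_pmf (\<lambda>(z1, z1', z2, z2'). z2) ?J = ?q"
        by (simp_all add: pmf.map_comp o_def case_prod_unfold map_fst_pair_pmf map_snd_pair_pmf)
      have refl: "pair_dist G S x x \<le> \<alpha> * real n" if "x \<in> carrier G \<times> carrier G" for x
        using that \<alpha> W.len_one by (auto simp: pair_dist_def word_dist_def)
      show "\<forall>(z1, z1', z2, z2')\<in>set_pmf ?J. z1' \<in> carrier (G \<times>\<times> G) \<and> z2' \<in> carrier (G \<times>\<times> G) \<and>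
            pair_dist G S z1 z1' \<le> \<alpha> * real n \<and> pair_dist G S z2 z2' \<le> \<alpha> * real n"
      proof
        fix w assume "w \<in> set_pmf ?J"
        then obtain x y where xy: "w = (x, x, y, y)" "x \<in> set_pmf ?p" "y \<in> set_pmf ?q" by auto
        then have "x \<in> carrier G \<times> carrier G" "y \<in> carrier G \<times> carrier G" using path by (auto simp: conv)
        then show "case w of (z1, z1', z2, z2') \<Rightarrow> z1' \<in> carrier (G \<times>\<times> G) \<and> z2' \<in> carrier (G \<times>\<times> G) \<and>
            pair_dist G S z1 z1' \<le> \<alpha> * real n \<and> pair_dist G S z2 z2' \<le> \<alpha> * real n"
          unfolding xy using refl by simp
      qed
    qed
    then show ?thesis by blast
  qed
  have upper: "?tv n \<le> 1" for n
  proof -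
    obtain J where J: "J \<in> ?C n" using nonempty by blast
    have "?tv n \<le> measure_pmf.prob J ?U"
      unfolding approximate_tv_def using J by (intro cINF_lower bdd_belowI[of _ 0]) auto
    also have "\<dots> \<le> 1" by simp
    finally show ?thesis .
  qed
  have lower: "\<exists>n0. \<forall>n\<ge>n0. 1 - 2 * \<theta> \<le> ?tv n" if \<theta>: "\<theta> > 0" for \<theta>
  proof -
    obtain n0 E where E: "\<And>r n. r \<in> {\<rho>, \<rho>'} \<Longrightarrow> n \<ge> n0 \<Longrightarrow>
        measure_pmf.prob (replicate_pmf n (noise \<mu> r)) {zs. \<not> E r n zs} \<le> \<theta>"
      and disj: "\<And>n zs zs' g h. \<lbrakk>n \<ge> n0; zs \<in> set_pmf (replicate_pmf n (noise \<mu> \<rho>));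
        zs' \<in> set_pmf (replicate_pmf n (noise \<mu> \<rho>')); E \<rho> n zs; E \<rho>' n zs'; g \<in> carrier G; h \<in> carrier G;
        word_dist G S (W.wp (map fst zs)) g \<le> \<alpha> * real n; word_dist G S (W.wp (map snd zs)) h \<le> \<alpha> * real n;
        word_dist G S (W.wp (map fst zs')) g \<le> \<alpha> * real n; word_dist G S (W.wp (map snd zs')) h \<le> \<alpha> * real n\<rbrakk> \<Longrightarrow> False"
    proof (rule H.distinguishing_paths[OF S c le e \<alpha>(1) \<theta> assms(11-13) sigma far], goal_cases)
      case (3 n0 E)
      show ?case by (rule 3(1)[of n0 E]) (use 3(2,3) in blast)+
    qed
    \<comment> \<open>A coupling knows endpoints and not paths, so the path events are pushed
      forward. One good path above a point suffices for membership, which can only increase the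
      probability, and the separation still applies to any such choice of paths.\<close>
    define D where "D r n = \<Phi> ` {zs \<in> set_pmf (replicate_pmf n (noise \<mu> r)). E r n zs}" for r n
    have PD: "measure_pmf.prob (convolution_power (G \<times>\<times> G) (noise \<mu> r) n) {x. x \<notin> D r n} \<le> \<theta>"
      if "r \<in> {\<rho>, \<rho>'}" "n \<ge> n0" for r n
      unfolding conv prob_map_pmf mem_Collect_eq
      by (rule order_trans[OF prob_mono_support E[OF that]]) (auto simp: D_def)
    have "1 - 2 * \<theta> \<le> ?tv n" if n: "n \<ge> n0" for n
      unfolding approximate_tv_def
    proof (rule cINF_greatest[OF nonempty])
      fix J assume J: "J \<in> ?C n"
      have m1: "map_pmf (\<lambda>(z1, z1', z2, z2'). z1) J = convolution_power (G \<times>\<times> G) (noise \<mu> \<rho>) n"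
        and m2: "map_pmf (\<lambda>(z1, z1', z2, z2'). z2) J = convolution_power (G \<times>\<times> G) (noise \<mu> \<rho>') n"
        and near: "\<And>z1 z1' z2 z2'. (z1, z1', z2, z2') \<in> set_pmf J \<Longrightarrow>
            z1' \<in> carrier (G \<times>\<times> G) \<and> z2' \<in> carrier (G \<times>\<times> G) \<and>
            pair_dist G S z1 z1' \<le> \<alpha> * real n \<and> pair_dist G S z2 z2' \<le> \<alpha> * real n"
        using J by (auto simp: approximate_couplings_def)
      have "1 - measure_pmf.prob J ?U = measure_pmf.prob J (- ?U)"
        using measure_pmf.prob_compl[of ?U J] by (simp add: Compl_eq_Diff_UNIV)
      also have "- ?U = {w. w \<in> - ?U}" by blast
      also have "measure_pmf.prob J {w. w \<in> - ?U} \<le> measure_pmf.prob J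
          {w. (case w of (z1, z1', z2, z2') \<Rightarrow> z1) \<notin> D \<rho> n \<or> (case w of (z1, z1', z2, z2') \<Rightarrow> z2) \<notin> D \<rho>' n}"
      proof (rule prob_mono_support, rule ccontr)
        fix w assume w: "w \<in> set_pmf J" "w \<in> - ?U" and no: "\<not> ((case w of (z1, z1', z2, z2') \<Rightarrow> z1) \<notin> D \<rho> n
          \<or> (case w of (z1, z1', z2, z2') \<Rightarrow> z2) \<notin> D \<rho>' n)"
        obtain z1 z1' z2 z2' where w_eq: "w = (z1, z1', z2, z2')" by (cases w) auto
        have z: "z1' = z2'" "z1 \<in> D \<rho> n" "z2 \<in> D \<rho>' n" using w no w_eq by auto
        obtain zs where zs: "zs \<in> set_pmf (replicate_pmf n (noise \<mu> \<rho>))" "E \<rho> n zs" "z1 = \<Phi> zs"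
          using z(2) by (auto simp: D_def)
        obtain zs' where zs': "zs' \<in> set_pmf (replicate_pmf n (noise \<mu> \<rho>'))" "E \<rho>' n zs'" "z2 = \<Phi> zs'"
          using z(3) by (auto simp: D_def)
        obtain g h where gh: "z1' = (g, h)" by (cases z1')
        have "(z1, z1', z2, z2') \<in> set_pmf J" using w w_eq by simp
        from near[OF this] show False
          using disj[OF n zs(1) zs'(1) zs(2) zs'(2), of g h] z(1) gh zs(3) zs'(3)
          by (auto simp: pair_dist_def \<Phi>_def)
      qed
      also have "\<dots> \<le> measure_pmf.prob J {w. (case w of (z1, z1', z2, z2') \<Rightarrow> z1) \<notin> D \<rho> n}
          + measure_pmf.prob J {w. (case w of (z1, z1', z2, z2') \<Rightarrow> z2) \<notin> D \<rho>' n}"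
        by (rule prob_Un_le)
      also have "measure_pmf.prob J {w. (case w of (z1, z1', z2, z2') \<Rightarrow> z1) \<notin> D \<rho> n} \<le> \<theta>"
        using PD[of \<rho> n] n unfolding m1[symmetric] prob_map_pmf mem_Collect_eq by blast
      also have "measure_pmf.prob J {w. (case w of (z1, z1', z2, z2') \<Rightarrow> z2) \<notin> D \<rho>' n} \<le> \<theta>"
        using PD[of \<rho>' n] n unfolding m2[symmetric] prob_map_pmf mem_Collect_eq by blast
      finally show "1 - 2 * \<theta> \<le> measure_pmf.prob J ?U" by simp
    qed
    then show ?thesis by blast
  qed
  show ?thesis
  proof (rule LIMSEQ_I)
    fix r :: real assume r: "r > 0"
    obtain n0 where n0: "\<And>n. n \<ge> n0 \<Longrightarrow> 1 - 2 * (r / 4) \<le> ?tv n" using lower[of "r / 4"] r by auto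
    show "\<exists>no. \<forall>n\<ge>no. norm (?tv n - 1) < r"
    proof (intro exI allI impI)
      fix n assume "n \<ge> n0"
      then show "norm (?tv n - 1) < r" using n0[of n] upper[of n] r unfolding real_norm_def by linarith
    qed
  qed
qed

end
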